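(* Suppose $\phi:\mathbb{D}\to\mathbb{D}$ is holomorphic and univalent and has a boundary regular fixed point at $\sigma\in\mathbb{T}=\partial\mathbb{D}$. Then for any $t_0>0$ and for any locally absolutely continuous function $\Lambda:[0,+\infty)\to\mathbb{R}$ with $\Lambda(0)=0$ and $\Lambda(t_0)=-\log\phi'(\sigma)$ there exists an evolution family $(\varphi_{s,t})$ satisfying the following conditions: (i) $(\varphi_{s,t})$ has a boundary regular fixed point at $\sigma$; (ii) the spectral function of $(\varphi_{s,t})$ at $\sigma$ coincides with $\Lambda$; (iii) $\varphi_{0,t_0}=\phi$.
   Context: $\mathbb{D}$ is the open unit disc of $\mathbb{C}$; $\angle\lim$ denotes the angular (non-tangential) limit. Boundary regular fixed point: $\sigma\in\mathbb{T}$ is a boundary regular fixed point of a holomorphic $\varphi:\mathbb{D}\to\mathbb{D}$ if $\angle\lim_{z\to\sigma}\varphi(z)=\sigma$ and the angular derivative $\varphi'(\sigma):=\angle\lim_{z\to\sigma}\frac{\varphi(z)-\sigma}{z-\sigma}$ exists finitely (it is then a positive real number). Evolution family of order $d\in[1,+\infty]$: a family $(\varphi_{s,t})_{0\le s\le t<+\infty}$ of holomorphic self-maps of $\mathbb{D}$ such that (1) $\varphi_{s,s}=\mathrm{id}_{\mathbb{D}}$; (2) $\varphi_{s,t}=\varphi_{u,t}\circ\varphi_{s,u}$ for $0\le s\le u\le t$; (3) for any $z\in\mathbb{D}$ and $T>0$ there is a non-negative $k_{z,T}\in L^d([0,T],\mathbb{R})$ with $|\varphi_{s,u}(z)-\varphi_{s,t}(z)|\le\int_u^t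 k_{z,T}(\xi)\,d\xi$ for $0\le s\le u\le t\le T$. An "evolution family" with no order mentioned is an evolution family of some order $d\in[1,+\infty]$ (equivalently, of order $1$). $\sigma$ is a boundary regular fixed point of $(\varphi_{s,t})$ if it is a boundary regular fixed point of $\varphi_{s,t}$ for all $t\ge s\ge0$. The spectral function of $(\varphi_{s,t})$ at such $\sigma$ is $t\mapsto-\log|\varphi_{0,t}'(\sigma)|$, $t\ge0$. *)

theory Defs
  imports "HOL-Analysis.Analysis"
begin

section \<open>Angular limits and boundary regular fixed points\<close>

text \<open>The approach region \<open>{z \<in> \<DD>. \<bar>z - \<sigma>\<bar> < M (1 - \<bar>z\<bar>)}\<close>
  with vertex \<open>\<sigma>\<close>; it is empty for \<open>M \<le> 1\<close>. Letting \<open>M\<close>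
  range over all reals above 1 gives the same limits as all Stolz angles at \<open>\<sigma>\<close>.\<close>

definition stolz_region :: "complex \<Rightarrow> real \<Rightarrow> complex set" where
  "stolz_region \<sigma> M = {z \<in> ball 0 1. dist z \<sigma> < M * (1 - norm z)}"

definition has_angular_limit :: "(complex \<Rightarrow> complex) \<Rightarrow> complex \<Rightarrow> complex \<Rightarrow> bool" where
  "has_angular_limit f \<sigma> l \<longleftrightarrow> (\<forall>M>1. (f \<longlongrightarrow> l) (at \<sigma> within stolz_region \<sigma> M))"

definition has_angular_derivative :: "(complex \<Rightarrow> complex) \<Rightarrow> complex \<Rightarrow> complex \<Rightarrow> bool" where
  "has_angular_derivative f \<sigma> D \<longleftrightarrow>
     has_angular_limit (\<lambda>z. (f z - \<sigma>) / (z - \<sigma>)) \<sigma> D"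

text \<open>Since \<open>has_angular_derivative\<close> uses \<open>\<sigma>\<close> itself in place of the boundary value
  of \<open>f\<close>, it is the angular derivative only at a boundary fixed point.\<close>

definition angular_deriv :: "(complex \<Rightarrow> complex) \<Rightarrow> complex \<Rightarrow> complex" where
  "angular_deriv f \<sigma> = (THE D. has_angular_derivative f \<sigma> D)"

definition boundary_regular_fixed_point :: "(complex \<Rightarrow> complex) \<Rightarrow> complex \<Rightarrow> bool" where
  "boundary_regular_fixed_point f \<sigma> \<longleftrightarrow>
     norm \<sigma> = 1 \<and> has_angular_limit f \<sigma> \<sigma> \<and> (\<exists>D. has_angular_derivative f \<sigma> D)"

lemma at_within_stolz_region_nontrivial:
  assumes "norm \<sigma> = 1" and "M > 1"
  shows "at \<sigma> within stolz_region \<sigma> M \<noteq> bot"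
proof -
  have "\<exists>z\<in>stolz_region \<sigma> M. z \<noteq> \<sigma> \<and> dist z \<sigma> < e" if "e > 0" for e
  proof -
    define r where "r = 1 - min (1/2) (e/2)"
    have r: "0 < r" "r < 1" "1 - r < e" using that by (auto simp: r_def min_def)
    have "dist (of_real r * \<sigma>) \<sigma> = norm ((of_real r - 1) * \<sigma>)"
      by (simp add: dist_norm algebra_simps)
    also have "\<dots> = norm (complex_of_real (r - 1))"
      using assms by (simp add: norm_mult)
    also have "\<dots> = 1 - r" using r by (simp only: norm_of_real)
    finally have d: "dist (of_real r * \<sigma>) \<sigma> = 1 - r" .
    have n: "norm (of_real r * \<sigma>) = r" using r assms by (simp add: norm_mult)
    have "1 * (1 - r) < M * (1 - r)" using r assms by (intro mult_strict_right_mono) auto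
    then have "of_real r * \<sigma> \<in> stolz_region \<sigma> M"
      using d n r by (simp add: stolz_region_def)
    moreover have "of_real r * \<sigma> \<noteq> \<sigma>" using d r by auto
    ultimately show ?thesis using d r by metis
  qed
  then show ?thesis
    by (simp add: trivial_limit_within islimpt_approachable)
qed

lemma angular_deriv_eq:
  assumes "norm \<sigma> = 1" and "has_angular_derivative f \<sigma> D"
  shows "angular_deriv f \<sigma> = D"
  unfolding angular_deriv_def
proof (rule the_equality[where P = "has_angular_derivative f \<sigma>", OF assms(2)])
  fix E assume "has_angular_derivative f \<sigma> E"
  with assms(2) show "E = D"
    using tendsto_unique[OF at_within_stolz_region_nontrivial[OF assms(1), of 2]]
    unfolding has_angular_derivative_def has_angular_limit_def
    by (metis one_less_numeral_iff semiring_norm(76))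
qed

section \<open>Evolution families\<close>

definition mem_Lp :: "ennreal \<Rightarrow> 'a measure \<Rightarrow> ('a \<Rightarrow> real) \<Rightarrow> bool" where
  "mem_Lp d M k \<longleftrightarrow> k \<in> borel_measurable M \<and>
     (if d = \<infinity> then \<exists>C. AE x in M. \<bar>k x\<bar> \<le> C
      else integrable M (\<lambda>x. \<bar>k x\<bar> powr enn2real d))"

text \<open>Only the values \<open>\<phi> s t z\<close> with \<open>0 \<le> s \<le> t\<close> and \<open>z \<in> \<DD>\<close> are meaningful.\<close>

definition evolution_family_of_order ::
  "ennreal \<Rightarrow> (real \<Rightarrow> real \<Rightarrow> complex \<Rightarrow> complex) \<Rightarrow> bool" where
  "evolution_family_of_order d \<phi> \<longleftrightarrow>
     (\<forall>s t. 0 \<le> s \<and> s \<le> t \<longrightarrow> \<phi> s t holomorphic_on ball 0 1 \<and> \<phi> s t ` ball 0 1 \<subseteq> ball 0 1) \<and>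
     (\<forall>s\<ge>0. \<forall>z\<in>ball 0 1. \<phi> s s z = z) \<and>
     (\<forall>s u t. 0 \<le> s \<and> s \<le> u \<and> u \<le> t \<longrightarrow> (\<forall>z\<in>ball 0 1. \<phi> s t z = \<phi> u t (\<phi> s u z))) \<and>
     (\<forall>z\<in>ball 0 1. \<forall>T>0. \<exists>k. mem_Lp d (lebesgue_on {0..T}) k \<and> (\<forall>\<xi>\<in>{0..T}. 0 \<le> k \<xi>) \<and>
        (\<forall>s u t. 0 \<le> s \<and> s \<le> u \<and> u \<le> t \<and> t \<le> T \<longrightarrow>
           norm (\<phi> s u z - \<phi> s t z) \<le> (LINT \<xi>:{u..t}|lebesgue. k \<xi>)))"

definition evolution_family :: "(real \<Rightarrow> real \<Rightarrow> complex \<Rightarrow> complex) \<Rightarrow> bool" where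
  "evolution_family \<phi> \<longleftrightarrow> (\<exists>d\<ge>1. evolution_family_of_order d \<phi>)"

definition family_boundary_regular_fixed_point ::
  "(real \<Rightarrow> real \<Rightarrow> complex \<Rightarrow> complex) \<Rightarrow> complex \<Rightarrow> bool" where
  "family_boundary_regular_fixed_point \<phi> \<sigma> \<longleftrightarrow>
     (\<forall>s t. 0 \<le> s \<and> s \<le> t \<longrightarrow> boundary_regular_fixed_point (\<phi> s t) \<sigma>)"

definition spectral_function ::
  "(real \<Rightarrow> real \<Rightarrow> complex \<Rightarrow> complex) \<Rightarrow> complex \<Rightarrow> real \<Rightarrow> real" where
  "spectral_function \<phi> \<sigma> t = - ln (norm (angular_deriv (\<phi> 0 t) \<sigma>))"

section \<open>Local absolute continuity\<close>

definition absolutely_continuous_on_interval :: "real \<Rightarrow> real \<Rightarrow> (real \<Rightarrow> real) \<Rightarrow> bool" where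
  "absolutely_continuous_on_interval a b f \<longleftrightarrow>
     (\<forall>\<epsilon>>0. \<exists>\<delta>>0. \<forall>(n::nat) x y.
        (\<forall>i<n. a \<le> x i \<and> x i \<le> y i \<and> y i \<le> b) \<and>
        disjoint_family_on (\<lambda>i. {x i<..<y i}) {..<n} \<and>
        (\<Sum>i<n. y i - x i) < \<delta> \<longrightarrow>
        (\<Sum>i<n. \<bar>f (y i) - f (x i)\<bar>) < \<epsilon>)"

definition locally_absolutely_continuous :: "(real \<Rightarrow> real) \<Rightarrow> bool" where
  "locally_absolutely_continuous f \<longleftrightarrow> (\<forall>T>0. absolutely_continuous_on_interval 0 T f)"

end

theory Submission
  imports Defs "HOL-Complex_Analysis.Complex_Analysis"
begin

text \<open>The Cayley transform moves the disc to the right half-plane and \<open>\<sigma>\<close> to infinity.  A holomorphic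
  self-map \<open>g\<close> of the half-plane has a boundary regular fixed point at infinity iff its slope
  \<open>inf Re g / Re\<close> is positive, and the angular derivative is then the reciprocal of the slope.
  If \<open>g\<close> also fixes 1, the Harnack type estimate for \<open>g z - slope g * z\<close> bounds \<open>g z - z\<close> by a multiple
  of \<open>1 - slope g\<close>, so the slope alone can serve as the time parameter of an evolution family.

  After composition with an affine map, \<open>\<phi>\<close> becomes a univalent map \<open>f\<close> fixing 1.  Take a maximal chain
  among the univalent left factors \<open>g\<close> of \<open>f\<close> that fix 1 and have positive slope, ordered by \<open>g \<le> h\<close> iff
  \<open>g = h \<circ> k\<close> for such a map \<open>k\<close>.  Its set of slopes is closed: locally uniform limits can only increase
  the slope, and the slope is multiplicative, so for \<open>f = g \<circ> h\<close> no factor can gain any.  It has no gaps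
  either: a simply connected domain strictly between the image of \<open>k\<close> and the half-plane yields, by the
  Riemann mapping theorem and Julia's lemma, a nontrivial factorization of \<open>k\<close>.  Hence all slopes between
  that of \<open>f\<close> and 1 occur, which is an evolution family from the identity to \<open>f\<close>.  Conjugating it
  with affine automorphisms depending on time realizes any prescribed spectral function.\<close>

section \<open>Self-maps of the half-plane and their slope at infinity\<close>

text \<open>Univalence is what makes left factors the right objects: in
  \<open>K r = K r' \<circ> k\<close> the inner map is unique on the half-plane, so the transition
  maps along a chain obey the composition law by themselves. Time follows the growing images, from
  \<open>f\<close> at time 0 to the identity at time \<open>t0\<close>, and nothing moves
  afterwards.

  Fixing 1 excludes translations, which move points while keeping slope 1. The price is
  \<open>slope g \<le> 1\<close>, so the family built from the chain has a non-increasing spectral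
  function. Since \<Lambda> may oscillate, the affine maps must both undo the normalization of
  \<phi> and correct the slope at every time; the common interior fixed point is given up there.

  A separate obstacle is that \<Lambda> is absolutely continuous in the epsilon-delta sense, whereas
  an evolution family asks for an integrable majorant of increments. The variation function of
  \<Lambda>, its Lebesgue-Stieltjes measure and the Radon-Nikodym density of that measure supply
  one.\<close>

definition halfplane :: "complex set" where
  "halfplane = {z. 0 < Re z}"

lemma open_halfplane: "open halfplane"
  by (simp add: halfplane_def open_halfspace_Re_gt)

lemma convex_halfplane: "convex halfplane"
  by (simp add: halfplane_def convex_halfspace_Re_gt)

lemma connected_halfplane: "connected halfplane"
  by (simp add: convex_connected convex_halfplane)

lemma one_in_halfplane: "1 \<in> halfplane"
  by (simp add: halfplane_def)

text \<open>Shows that the pseudo-hyperbolic distance \<open>cmod (z - w) / cmod (z + cnj w)\<close>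
  of the half-plane is below 1, and later converts Schwarz-Pick into inequalities between real
  parts.\<close>

lemma cmod_add_cnj_diff:
  "(cmod (z + cnj w))\<^sup>2 - (cmod (z - w))\<^sup>2 = 4 * Re z * Re w"
  unfolding cmod_power2 by (simp add: algebra_simps power2_eq_square)

text \<open>Schwarz's lemma after Cayley maps that send \<open>w\<close> and \<open>p w\<close> to
  0; \<open>m\<close> is the inverse of the first one. Clearing the denominators leaves a form that
  can be squared directly.\<close>

lemma halfplane_Schwarz_Pick:
  assumes holp: "p holomorphic_on halfplane" and p: "p ` halfplane \<subseteq> halfplane"
    and z: "z \<in> halfplane" and w: "w \<in> halfplane"
  shows "cmod (p z - p w) * cmod (z + cnj w) \<le> cmod (z - w) * cmod (p z + cnj (p w))"
proof -
  define m where "m \<zeta> = (w + cnj w * \<zeta>) / (1 - \<zeta>)" for \<zeta>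
  define g where "g \<zeta> = (p (m \<zeta>) - p w) / (p (m \<zeta>) + cnj (p w))" for \<zeta>
  have Rw: "Re w > 0" and Rz: "Re z > 0" and Rpw: "Re (p w) > 0"
    using z w p by (auto simp: halfplane_def)
  have m_in: "m \<zeta> \<in> halfplane" if "norm \<zeta> < 1" for \<zeta>
  proof -
    have ne: "1 - \<zeta> \<noteq> 0" using that by auto
    have "Re (m \<zeta>) = Re ((w + cnj w * \<zeta>) * cnj (1 - \<zeta>)) / (cmod (1 - \<zeta>))\<^sup>2"
      unfolding m_def by (metis Re_complex_of_real Re_divide_of_real complex_div_cnj of_real_power)
    also have "Re ((w + cnj w * \<zeta>) * cnj (1 - \<zeta>)) = Re w * (1 - (cmod \<zeta>)\<^sup>2)"
      unfolding cmod_power2 by (simp add: algebra_simps power2_eq_square)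
    finally show ?thesis
      using that ne Rw by (simp add: halfplane_def abs_square_less_1)
  qed
  have ne: "a + cnj b \<noteq> 0" if "Re a > 0" "Re b > 0" for a b
    using that by (metis add_pos_pos complex_cnj_cnj complex_cnj_zero_iff cnj.simps(1) plus_complex.sel(1) zero_complex.sel(1) order_less_irrefl)
  have lt: "cmod ((a - b) / (a + cnj b)) < 1" if "Re a > 0" "Re b > 0" for a b
  proof -
    have "(cmod (a - b))\<^sup>2 < (cmod (a + cnj b))\<^sup>2"
      using cmod_add_cnj_diff[of a b] that by (smt (verit) mult_pos_pos)
    then have "cmod (a - b) < cmod (a + cnj b)"
      by (simp add: power_less_imp_less_base)
    then show ?thesis using ne[OF that] by (simp add: norm_divide)
  qed
  have g_lt: "norm (g \<zeta>) < 1" if "norm \<zeta> < 1" for \<zeta>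
  proof -
    have "Re (p (m \<zeta>)) > 0" using m_in[OF that] p by (auto simp: halfplane_def)
    then show ?thesis unfolding g_def by (rule lt[OF _ Rpw])
  qed
  have hm: "m holomorphic_on ball 0 1"
    unfolding m_def by (intro holomorphic_intros) auto
  have "(p \<circ> m) holomorphic_on ball 0 1"
    by (rule holomorphic_on_compose_gen[OF hm holp]) (use m_in in auto)
  then have hpm: "(\<lambda>\<zeta>. p (m \<zeta>)) holomorphic_on ball 0 1" by (simp add: o_def)
  have hg: "g holomorphic_on ball 0 1"
    unfolding g_def
  proof (intro holomorphic_intros hpm)
    fix \<zeta> :: complex assume "\<zeta> \<in> ball 0 1"
    then have "Re (p (m \<zeta>)) > 0" using m_in p by (auto simp: halfplane_def)
    then show "p (m \<zeta>) + cnj (p w) \<noteq> 0" by (rule ne[OF _ Rpw])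
  qed
  have g0: "g 0 = 0" by (simp add: g_def m_def)
  define \<zeta> where "\<zeta> = (z - w) / (z + cnj w)"
  have nz: "z + cnj w \<noteq> 0" using ne Rz Rw by blast
  have \<zeta>1: "norm \<zeta> < 1" unfolding \<zeta>_def using lt Rz Rw by blast
  have "w + cnj w \<noteq> 0" using ne Rw by blast
  moreover have "1 - \<zeta> = (w + cnj w) / (z + cnj w)" using nz by (simp add: \<zeta>_def field_simps)
  moreover have "w + cnj w * \<zeta> = z * (w + cnj w) / (z + cnj w)"
    using nz by (simp add: \<zeta>_def field_simps)
  ultimately have m\<zeta>: "m \<zeta> = z" using nz by (simp add: m_def)
  have "norm (g \<zeta>) \<le> norm \<zeta>"
    by (rule Schwarz_Lemma[OF hg g0]) (use g_lt \<zeta>1 in auto)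
  moreover have "Re (p z) > 0" using p z by (auto simp: halfplane_def)
  then have "p z + cnj (p w) \<noteq> 0" using ne Rpw by blast
  ultimately show ?thesis
    unfolding g_def m\<zeta> using nz
    by (simp add: \<zeta>_def norm_divide divide_simps mult.commute)
qed

lemma halfplane_Borel_Caratheodory_strict:
  assumes holp: "p holomorphic_on halfplane" and p: "p ` halfplane \<subseteq> halfplane"
    and z: "z \<in> halfplane" and w: "w \<in> halfplane"
  shows "cmod (p z - \<i> * Im (p w)) \<le> Re (p w) * (cmod (z + cnj w))\<^sup>2 / (Re z * Re w)"
proof -
  define A where "A = p z - \<i> * Im (p w)"
  define b where "b = Re (p w)"
  define N where "N = cmod (z + cnj w)"
  define n where "n = cmod (z - w)"
  have pos: "Re z > 0" "Re w > 0" "b > 0" using z w p by (auto simp: halfplane_def b_def)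
  have Nn: "N\<^sup>2 - n\<^sup>2 = 4 * Re z * Re w" unfolding N_def n_def by (rule cmod_add_cnj_diff)
  have "N \<ge> 0" "n \<ge> 0" by (auto simp: N_def n_def)
  have "n\<^sup>2 < N\<^sup>2" using Nn pos by (smt (verit) mult_pos_pos)
  then have nN: "n < N" using \<open>N \<ge> 0\<close> power_less_imp_less_base by blast
  have e1: "p z - p w = A - of_real b" and e2: "p z + cnj (p w) = A + of_real b"
    by (auto simp: A_def b_def complex_eq_iff)
  have "cmod (A - of_real b) * N \<le> n * cmod (A + of_real b)"
    using halfplane_Schwarz_Pick[OF assms] unfolding e1 e2 N_def n_def .
  moreover have "cmod A - b \<le> cmod (A - of_real b)"
    using norm_triangle_ineq2[of A "of_real b"] pos by simp
  moreover have "cmod (A + of_real b) \<le> cmod A + b"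
    using norm_triangle_ineq[of A "of_real b"] pos by simp
  ultimately have "(cmod A - b) * N \<le> n * (cmod A + b)"
    using \<open>N \<ge> 0\<close> \<open>n \<ge> 0\<close> by (meson mult_left_mono mult_right_mono order_trans)
  then have "cmod A * (N - n) \<le> b * (N + n)" by (simp add: algebra_simps)
  \<comment> \<open>The factor \<open>N + n\<close> turns \<open>N - n\<close> into
    \<open>N\<^sup>2 - n\<^sup>2\<close>, which is 4 times the product of the real parts; the 4
    cancels the one lost by bounding \<open>N + n\<close> by \<open>2 * N\<close>.\<close>
  then have "cmod A * (N - n) * (N + n) \<le> b * (N + n) * (N + n)"
    using \<open>N \<ge> 0\<close> \<open>n \<ge> 0\<close> by (intro mult_right_mono) auto
  also have "\<dots> \<le> b * (2 * N) * (2 * N)"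
    using \<open>N \<ge> 0\<close> \<open>n \<ge> 0\<close> nN pos by (intro mult_mono) auto
  finally have "cmod A * (N\<^sup>2 - n\<^sup>2) \<le> 4 * b * N\<^sup>2"
    by (simp add: algebra_simps power2_eq_square)
  then have "cmod A * (Re z * Re w) \<le> b * N\<^sup>2" unfolding Nn by simp
  then show ?thesis
    using pos by (simp add: A_def b_def N_def pos_le_divide_eq mult_pos_pos)
qed

text \<open>Real part zero must be allowed, since the intended \<open>p\<close> is
  \<open>g z - slope g * z\<close>, which vanishes for the identity. Adding a small positive
  constant reduces to the strict case.\<close>

lemma halfplane_Borel_Caratheodory:
  assumes holp: "p holomorphic_on halfplane" and p: "\<And>z. z \<in> halfplane \<Longrightarrow> 0 \<le> Re (p z)"
    and z: "z \<in> halfplane" and w: "w \<in> halfplane"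
  shows "cmod (p z - \<i> * Im (p w)) \<le> Re (p w) * (cmod (z + cnj w))\<^sup>2 / (Re z * Re w)"
proof -
  define K where "K = (cmod (z + cnj w))\<^sup>2 / (Re z * Re w)"
  have K0: "0 \<le> K" using z w by (auto simp: K_def halfplane_def)
  have "cmod (p z - \<i> * Im (p w)) \<le> Re (p w) * K + e" if "e > 0" for e
  proof -
    define \<delta> where "\<delta> = e / (K + 1)"
    have \<delta>: "\<delta> > 0" "\<delta> * (K + 1) = e" using that K0 by (auto simp: \<delta>_def)
    have "cmod ((p z + of_real \<delta>) - \<i> * Im (p w + of_real \<delta>)) \<le>
        Re (p w + of_real \<delta>) * (cmod (z + cnj w))\<^sup>2 / (Re z * Re w)"
    proof (rule halfplane_Borel_Caratheodory_strict[OF _ _ z w, of "\<lambda>z. p z + of_real \<delta>"])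
      show "(\<lambda>z. p z + of_real \<delta>) holomorphic_on halfplane"
        by (intro holomorphic_intros holp)
      show "(\<lambda>z. p z + of_real \<delta>) ` halfplane \<subseteq> halfplane"
      proof (clarsimp simp: halfplane_def)
        fix u assume "0 < Re u"
        then have "0 \<le> Re (p u)" using p by (simp add: halfplane_def)
        then show "0 < Re (p u) + \<delta>" using \<delta> by simp
      qed
    qed
    then have "cmod ((p z - \<i> * Im (p w)) + of_real \<delta>) \<le> (Re (p w) + \<delta>) * K"
      by (simp add: K_def add.commute add_diff_eq)
    moreover have "cmod (p z - \<i> * Im (p w)) \<le> cmod ((p z - \<i> * Im (p w)) + of_real \<delta>) + \<delta>"
      using norm_triangle_ineq4[of "(p z - \<i> * Im (p w)) + of_real \<delta>" "of_real \<delta>"] \<delta> by simp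
    ultimately show ?thesis using \<delta> by (simp add: algebra_simps)
  qed
  then have "cmod (p z - \<i> * Im (p w)) \<le> Re (p w) * K" by (rule field_le_epsilon)
  then show ?thesis by (simp add: K_def)
qed

text \<open>By the Julia-Wolff-Caratheodory theorem below, this is the angular limit of \<open>g z / z\<close> at infinity.\<close>

definition slope :: "(complex \<Rightarrow> complex) \<Rightarrow> real" where
  "slope g = (INF z\<in>halfplane. Re (g z) / Re z)"

lemma slope_mult_le:
  assumes "\<And>z. z \<in> halfplane \<Longrightarrow> 0 \<le> Re (g z)" and "z \<in> halfplane"
  shows "slope g * Re z \<le> Re (g z)"
proof -
  have "slope g \<le> Re (g z) / Re z"
    unfolding slope_def
  proof (rule cINF_lower[OF _ assms(2)])
    show "bdd_below ((\<lambda>z. Re (g z) / Re z) ` halfplane)"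
      by (rule bdd_belowI2[of _ 0]) (use assms(1) in \<open>auto simp: halfplane_def\<close>)
  qed
  then show ?thesis using assms(2) by (simp add: halfplane_def pos_le_divide_eq)
qed

lemma le_slope:
  assumes "\<And>z. z \<in> halfplane \<Longrightarrow> c * Re z \<le> Re (g z)"
  shows "c \<le> slope g"
  unfolding slope_def
proof (rule cINF_greatest)
  show "halfplane \<noteq> {}" using one_in_halfplane by auto
  show "c \<le> Re (g z) / Re z" if "z \<in> halfplane" for z
    using assms[OF that] that by (simp add: halfplane_def pos_le_divide_eq)
qed

lemma slope_nonneg:
  assumes "\<And>z. z \<in> halfplane \<Longrightarrow> 0 \<le> Re (g z)"
  shows "0 \<le> slope g"
  by (rule le_slope) (use assms in auto)

lemma slope_cong:
  assumes "\<And>z. z \<in> halfplane \<Longrightarrow> g z = h z"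
  shows "slope g = slope h"
  unfolding slope_def by (rule INF_cong) (use assms in auto)

lemma slope_near:
  assumes "\<And>z. z \<in> halfplane \<Longrightarrow> 0 \<le> Re (g z)" and "e > 0"
  obtains w where "w \<in> halfplane" "Re (g w) \<le> (slope g + e) * Re w"
proof -
  have "\<exists>w\<in>halfplane. Re (g w) / Re w < slope g + e"
  proof (rule ccontr)
    assume "\<not> ?thesis"
    then have *: "slope g + e \<le> Re (g w) / Re w" if "w \<in> halfplane" for w
      using that by (auto simp: not_less)
    have "slope g + e \<le> slope g"
    proof (rule le_slope)
      show "(slope g + e) * Re w \<le> Re (g w)" if "w \<in> halfplane" for w
        using *[OF that] that by (simp add: halfplane_def pos_le_divide_eq)
    qed
    with \<open>e > 0\<close> show False by simp
  qed
  then show ?thesis using that by (auto simp: halfplane_def pos_divide_less_eq intro: less_imp_le)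
qed

text \<open>The remainder \<open>p\<close> is estimated from a base point \<open>w\<close> where the
  infimum is nearly attained, so \<open>Re (p w)\<close> is small relative to \<open>Re w\<close>.
  In a sector \<open>(cmod (z + cnj w))\<^sup>2 / Re z\<close> grows only like
  \<open>cmod z\<close>, hence \<open>p z / z\<close> tends to 0. The general filter serves
  sequences and Stolz regions alike.\<close>

lemma Julia_Wolff_Caratheodory:
  assumes holg: "g holomorphic_on halfplane" and g: "\<And>z. z \<in> halfplane \<Longrightarrow> 0 \<le> Re (g z)"
    and X: "filterlim X at_infinity F"
    and sector: "\<forall>\<^sub>F x in F. X x \<in> halfplane \<and> cmod (X x) \<le> M * Re (X x)"
  shows "((\<lambda>x. g (X x) / X x) \<longlongrightarrow> complex_of_real (slope g)) F"
proof (rule tendstoI)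
  fix e :: real assume "e > 0"
  define c where "c = slope g"
  define p where "p z = g z - of_real c * z" for z
  define M' where "M' = max M 1"
  have M': "M' \<ge> 1" "M' \<ge> M" by (auto simp: M'_def)
  \<comment> \<open>The remainder will be at most \<open>\<epsilon> * M' * 4 * cmod z\<close>; the 8
    leaves half of \<open>e\<close> for the constant \<open>\<bar>Im (p w)\<bar>\<close>.\<close>
  define \<epsilon> where "\<epsilon> = e / (8 * M')"
  have \<epsilon>: "\<epsilon> > 0" "\<epsilon> * M' * 4 < e" using M' \<open>e > 0\<close> by (auto simp: \<epsilon>_def)
  have holp: "p holomorphic_on halfplane" unfolding p_def by (intro holomorphic_intros holg)
  have p0: "0 \<le> Re (p z)" if "z \<in> halfplane" for z
    using slope_mult_le[OF g that] by (simp add: p_def c_def)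
  obtain w where w: "w \<in> halfplane" "Re (g w) \<le> (c + \<epsilon>) * Re w"
    unfolding c_def by (rule slope_near[OF g \<open>\<epsilon> > 0\<close>])
  then have pw: "Re (p w) \<le> \<epsilon> * Re w" by (simp add: p_def algebra_simps)
  define R where "R = max (cmod w) (2 * \<bar>Im (p w)\<bar> / e) + 1"
  have "\<forall>\<^sub>F x in F. R \<le> cmod (X x)"
    using filterlim_at_infinity_imp_norm_at_top[OF X] by (simp add: filterlim_at_top)
  with sector show "\<forall>\<^sub>F x in F. dist (g (X x) / X x) (complex_of_real (slope g)) < e"
  proof eventually_elim
    case (elim x)
    define z where "z = X x"
    have z: "z \<in> halfplane" "cmod z \<le> M * Re z" "R \<le> cmod z" using elim by (auto simp: z_def)
    have Rz: "0 < Re z" and Rw: "0 < Re w" using z w by (auto simp: halfplane_def)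
    then have z0: "0 < cmod z" by auto
    have zM: "cmod z \<le> M' * Re z" using z(2) M' Rz by (meson mult_right_mono less_imp_le order_trans)
    have "cmod (p z) \<le> cmod (p z - \<i> * Im (p w)) + \<bar>Im (p w)\<bar>"
      using norm_triangle_ineq[of "p z - \<i> * Im (p w)" "\<i> * Im (p w)"] by (simp add: norm_mult)
    also have "cmod (p z - \<i> * Im (p w)) \<le> Re (p w) * (cmod (z + cnj w))\<^sup>2 / (Re z * Re w)"
      by (rule halfplane_Borel_Caratheodory[OF holp p0 z(1) w(1)])
    also have "\<dots> \<le> (\<epsilon> * Re w) * (2 * cmod z)\<^sup>2 / (Re z * Re w)"
    proof (intro divide_right_mono mult_mono power_mono pw)
      have "cmod (z + cnj w) \<le> cmod z + cmod w" using norm_triangle_ineq[of z "cnj w"] by simp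
      also have "\<dots> \<le> 2 * cmod z" using z(3) by (simp add: R_def)
      finally show "cmod (z + cnj w) \<le> 2 * cmod z" .
    qed (use Rz Rw \<epsilon> in auto)
    also have "\<dots> = \<epsilon> * 4 * cmod z * (cmod z / Re z)"
      using Rz Rw by (simp add: field_simps power2_eq_square)
    also have "\<dots> \<le> \<epsilon> * 4 * cmod z * M'"
      using zM Rz z0 \<epsilon> by (intro mult_left_mono) (auto simp: pos_divide_le_eq)
    also have "\<dots> = (\<epsilon> * M' * 4) * cmod z" by simp
    finally have b: "cmod (p z) \<le> (\<epsilon> * M' * 4) * cmod z + \<bar>Im (p w)\<bar>" by simp
    have "2 * \<bar>Im (p w)\<bar> / e < cmod z" using z(3) by (simp add: R_def)
    then have "\<bar>Im (p w)\<bar> < e / 2 * cmod z" using \<open>e > 0\<close> by (simp add: field_simps)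
    moreover have "\<epsilon> * M' * 4 = e / 2" using M' by (simp add: \<epsilon>_def)
    then have "cmod (p z) \<le> e / 2 * cmod z + \<bar>Im (p w)\<bar>" using b by (simp only:)
    ultimately have "cmod (p z) < e * cmod z" by simp
    moreover have "g z / z - of_real c = p z / z" using z0 by (simp add: p_def field_simps)
    ultimately have "dist (g z / z) (of_real c) < e"
      using z0 by (simp add: dist_norm norm_divide pos_divide_less_eq)
    then show ?case by (simp add: z_def c_def)
  qed
qed

section \<open>Normalized univalent maps\<close>

text \<open>Along the positive reals \<open>g (h x) / x\<close> splits into
  \<open>g (h x) / h x\<close> times \<open>h x / x\<close>. Positivity of \<open>slope h\<close>
  drives \<open>h x\<close> to infinity inside a sector, which is what allows the limit theorem to
  be applied to \<open>g\<close> there.\<close>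

lemma slope_comp:
  assumes holg: "g holomorphic_on halfplane" and g: "\<And>z. z \<in> halfplane \<Longrightarrow> 0 \<le> Re (g z)"
    and holh: "h holomorphic_on halfplane" and h: "h ` halfplane \<subseteq> halfplane"
    and pos: "0 < slope h"
  shows "slope (\<lambda>z. g (h z)) = slope g * slope h"
proof -
  define X :: "nat \<Rightarrow> complex" where "X n = of_real (real n + 1)" for n
  define c where "c = slope h"
  have X: "X n \<in> halfplane" "cmod (X n) = real n + 1" "Re (X n) = real n + 1" for n
    using norm_of_real[of "real n + 1", where 'a = complex]
    by (simp_all only: X_def halfplane_def) auto
  have Xne: "X n \<noteq> 0" for n using X(3)[of n] by auto
  have Xinf: "filterlim X at_infinity sequentially"
    unfolding filterlim_at_infinity_conv_norm_at_top X(2)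
    by (rule filterlim_at_top_mono[OF filterlim_real_sequentially]) simp
  have h0: "0 \<le> Re (h z)" "h z \<in> halfplane" "h z \<noteq> 0" if "z \<in> halfplane" for z
    using h that by (auto simp: halfplane_def less_imp_le image_subset_iff)
  have gh0: "0 \<le> Re (g (h z))" if "z \<in> halfplane" for z using g h0 that by blast
  have holgh: "(\<lambda>z. g (h z)) holomorphic_on halfplane"
    using holomorphic_on_compose_gen[OF holh holg h] by (simp add: o_def)
  have Xsec: "\<forall>\<^sub>F n in sequentially. X n \<in> halfplane \<and> cmod (X n) \<le> 1 * Re (X n)"
    using X by simp
  have lh: "(\<lambda>n. h (X n) / X n) \<longlonglongrightarrow> of_real c"
    unfolding c_def by (rule Julia_Wolff_Caratheodory[OF holh h0(1) Xinf Xsec])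
  have lgh: "(\<lambda>n. g (h (X n)) / X n) \<longlonglongrightarrow> of_real (slope (\<lambda>z. g (h z)))"
    by (rule Julia_Wolff_Caratheodory[OF holgh gh0 Xinf Xsec])
  have Reh: "c * (real n + 1) \<le> Re (h (X n))" for n
    using slope_mult_le[OF h0(1) X(1)] X(3) by (simp add: c_def)
  have hinf: "filterlim (\<lambda>n. h (X n)) at_infinity sequentially"
    unfolding filterlim_at_infinity_conv_norm_at_top
  proof (rule filterlim_at_top_mono)
    show "filterlim (\<lambda>n. c * (real n + 1)) at_top sequentially"
      by (rule filterlim_tendsto_pos_mult_at_top[OF tendsto_const])
         (use pos filterlim_at_top_mono[OF filterlim_real_sequentially, of "\<lambda>n. real n + 1"]
          in \<open>auto simp: c_def\<close>)
    show "\<forall>\<^sub>F n in sequentially. c * (real n + 1) \<le> cmod (h (X n))"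
      using Reh complex_Re_le_cmod order_trans by (intro always_eventually) blast
  qed
  have "\<forall>\<^sub>F n in sequentially. dist (h (X n) / X n) (of_real c) < 1"
    using lh by (rule tendstoD) simp
  then have hsec: "\<forall>\<^sub>F n in sequentially. h (X n) \<in> halfplane \<and>
      cmod (h (X n)) \<le> ((c + 1) / c) * Re (h (X n))"
  proof eventually_elim
    case (elim n)
    have "cmod (h (X n) / X n) \<le> c + 1"
      using elim norm_triangle_ineq[of "h (X n) / X n - of_real c" "of_real c"] pos
      by (simp add: dist_norm c_def)
    then have "cmod (h (X n)) \<le> (c + 1) * (real n + 1)"
      by (simp add: norm_divide X(2) pos_divide_le_eq)
    also have "\<dots> = (c + 1) / c * (c * (real n + 1))" using pos by (simp add: c_def)
    also have "\<dots> \<le> (c + 1) / c * Re (h (X n))"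
      using Reh pos by (intro mult_left_mono) (auto simp: c_def)
    finally show ?case using h0 X by blast
  qed
  have "(\<lambda>n. g (h (X n)) / h (X n)) \<longlonglongrightarrow> of_real (slope g)"
    by (rule Julia_Wolff_Caratheodory[OF holg g hinf hsec])
  from tendsto_mult[OF this lh]
  have "(\<lambda>n. g (h (X n)) / X n) \<longlonglongrightarrow> of_real (slope g) * of_real c"
    by (rule tendsto_cong[THEN iffD1, rotated]) (use h0(3)[OF X(1)] Xne in auto)
  from LIMSEQ_unique[OF this lgh] show ?thesis
    by (metis c_def of_real_eq_iff of_real_mult)
qed

text \<open>An infimum of evaluations is upper semicontinuous under pointwise limits. The slope may
  still jump up, which the chain argument has to rule out.\<close>

lemma slope_ge_lim:
  fixes X :: "nat \<Rightarrow> complex \<Rightarrow> complex"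
  assumes "\<And>n z. z \<in> halfplane \<Longrightarrow> 0 \<le> Re (X n z)"
    and "\<And>z. z \<in> halfplane \<Longrightarrow> (\<lambda>n. X n z) \<longlonglongrightarrow> g z"
    and "\<And>n. a n \<le> slope (X n)" and "a \<longlonglongrightarrow> b"
  shows "b \<le> slope g"
proof (rule le_slope)
  fix z assume z: "z \<in> halfplane"
  have "a n * Re z \<le> Re (X n z)" for n
  proof -
    have "a n * Re z \<le> slope (X n) * Re z"
      using assms(3)[of n] z by (intro mult_right_mono) (auto simp: halfplane_def)
    also have "\<dots> \<le> Re (X n z)" by (rule slope_mult_le[OF assms(1) z])
    finally show ?thesis .
  qed
  then show "b * Re z \<le> Re (g z)"
    by (intro LIMSEQ_le[OF tendsto_mult_right[OF assms(4)] tendsto_Re[OF assms(2)[OF z]]]) auto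
qed

text \<open>Positive slope encodes the boundary regular fixed point at infinity; the value at 1
  leaves the identity as the only affine automorphism in the class.\<close>

definition normalized_univalent :: "(complex \<Rightarrow> complex) set" where
  "normalized_univalent = {g. g holomorphic_on halfplane \<and> g ` halfplane \<subseteq> halfplane \<and>
     inj_on g halfplane \<and> g 1 = 1 \<and> 0 < slope g}"

lemma normalized_univalentD:
  assumes "g \<in> normalized_univalent"
  shows "g holomorphic_on halfplane" "g ` halfplane \<subseteq> halfplane" "inj_on g halfplane" "g 1 = 1"
    "0 < slope g" "\<And>z. z \<in> halfplane \<Longrightarrow> g z \<in> halfplane" "\<And>z. z \<in> halfplane \<Longrightarrow> 0 \<le> Re (g z)"
  using assms by (auto simp: normalized_univalent_def halfplane_def image_subset_iff less_imp_le)

lemma slope_id: "slope (\<lambda>z. z) = 1"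
proof -
  have "slope (\<lambda>z. z) = (INF z\<in>halfplane. 1)"
    unfolding slope_def by (rule INF_cong) (auto simp: halfplane_def)
  also have "\<dots> = 1" using one_in_halfplane by (intro cINF_const) auto
  finally show ?thesis .
qed

lemma id_normalized_univalent: "(\<lambda>z. z) \<in> normalized_univalent"
  by (simp add: normalized_univalent_def slope_id)

lemma comp_normalized_univalent:
  assumes g: "g \<in> normalized_univalent" and h: "h \<in> normalized_univalent"
  shows "(\<lambda>z. g (h z)) \<in> normalized_univalent" "slope (\<lambda>z. g (h z)) = slope g * slope h"
proof -
  note G = normalized_univalentD[OF g] and H = normalized_univalentD[OF h]
  show s: "slope (\<lambda>z. g (h z)) = slope g * slope h"
    by (rule slope_comp[OF G(1,7) H(1,2,5)])
  have "(\<lambda>z. g (h z)) holomorphic_on halfplane"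
    using holomorphic_on_compose_gen[OF H(1) G(1) H(2)] by (simp add: o_def)
  moreover have "inj_on (\<lambda>z. g (h z)) halfplane"
    using comp_inj_on[OF H(3) inj_on_subset[OF G(3) H(2)]] by (simp add: o_def)
  ultimately show "(\<lambda>z. g (h z)) \<in> normalized_univalent"
    using G H s by (auto simp: normalized_univalent_def)
qed

lemma slope_le_one:
  assumes "g \<in> normalized_univalent"
  shows "slope g \<le> 1"
  using slope_mult_le[of g, OF normalized_univalentD(7)[OF assms] one_in_halfplane]
    normalized_univalentD(4)[OF assms] by simp

lemma normalized_univalent_growth:
  assumes g: "g \<in> normalized_univalent" and z: "z \<in> halfplane"
  shows "cmod (g z) \<le> (cmod (z + 1))\<^sup>2 / Re z"
  using halfplane_Borel_Caratheodory[OF normalized_univalentD(1,7)[OF g] z one_in_halfplane]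
    normalized_univalentD(4)[OF g] by simp

text \<open>At 1 the remainder \<open>p\<close> is the real number \<open>1 - slope g\<close>, so
  Borel-Caratheodory with base point 1 has no imaginary correction and its whole right side carries
  this factor.\<close>

lemma normalized_univalent_displacement:
  assumes g: "g \<in> normalized_univalent" and z: "z \<in> halfplane"
  shows "cmod (g z - z) \<le> (1 - slope g) * (cmod z + (cmod (z + 1))\<^sup>2 / Re z)"
proof -
  define p where "p u = g u - of_real (slope g) * u" for u
  have "p holomorphic_on halfplane"
    unfolding p_def by (intro holomorphic_intros normalized_univalentD(1)[OF g])
  moreover have "0 \<le> Re (p u)" if "u \<in> halfplane" for u
    using slope_mult_le[OF normalized_univalentD(7)[OF g] that] by (simp add: p_def)
  ultimately have "cmod (p z - \<i> * Im (p 1)) \<le> Re (p 1) * (cmod (z + cnj 1))\<^sup>2 / (Re z * Re 1)"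
    using z one_in_halfplane by (rule halfplane_Borel_Caratheodory)
  then have "cmod (p z) \<le> (1 - slope g) * ((cmod (z + 1))\<^sup>2 / Re z)"
    by (simp add: p_def normalized_univalentD(4)[OF g])
  moreover have "g z - z = p z - of_real (1 - slope g) * z"
    by (simp add: p_def algebra_simps)
  then have "cmod (g z - z) \<le> cmod (p z) + (1 - slope g) * cmod z"
    using norm_triangle_ineq4[of "p z" "of_real (1 - slope g) * z"] slope_le_one[OF g]
    by (simp only: norm_mult norm_of_real abs_of_nonneg[of "1 - slope g"])
  ultimately show ?thesis by (simp add: algebra_simps)
qed

lemma slope_one_imp_id:
  assumes "g \<in> normalized_univalent" and "slope g = 1" and "z \<in> halfplane"
  shows "g z = z"
  using normalized_univalent_displacement[OF assms(1,3)] assms(2) by simp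

lemma normalized_univalent_locally_bounded:
  assumes "compact K" and "K \<subseteq> halfplane"
  shows "\<exists>B. \<forall>g\<in>normalized_univalent. \<forall>z\<in>K. cmod (g z) \<le> B"
proof -
  have "continuous_on K (\<lambda>z. (cmod (z + 1))\<^sup>2 / Re z)"
    using assms(2) by (intro continuous_intros) (auto simp: halfplane_def)
  then have "bounded ((\<lambda>z. (cmod (z + 1))\<^sup>2 / Re z) ` K)"
    using assms(1) compact_continuous_image compact_imp_bounded by blast
  then obtain B where B: "\<And>z. z \<in> K \<Longrightarrow> \<bar>(cmod (z + 1))\<^sup>2 / Re z\<bar> \<le> B"
    by (auto simp: bounded_iff)
  have "cmod (g z) \<le> B" if "g \<in> normalized_univalent" "z \<in> K" for g z
    using normalized_univalent_growth[OF that(1), of z] B[OF that(2)] that(2) assms(2)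
    by (meson abs_le_D1 order_trans subsetD)
  then show ?thesis by blast
qed

text \<open>The lower bound on the slopes prevents degeneration: it survives in the limit as
  \<open>\<epsilon> * Re z \<le> Re (g z)\<close>, which keeps the limit inside the half-plane and
  makes it nonconstant, so Hurwitz gives injectivity.\<close>

lemma normalized_univalent_compact:
  fixes X :: "nat \<Rightarrow> complex \<Rightarrow> complex"
  assumes X: "\<And>n. X n \<in> normalized_univalent" and "0 < \<epsilon>" and slope: "\<And>n. \<epsilon> \<le> slope (X n)"
  obtains g r where "g \<in> normalized_univalent" "strict_mono (r :: nat \<Rightarrow> nat)"
    "\<And>z. z \<in> halfplane \<Longrightarrow> (\<lambda>n. X (r n) z) \<longlonglongrightarrow> g z"
    "\<And>K. compact K \<Longrightarrow> K \<subseteq> halfplane \<Longrightarrow> uniform_limit K (\<lambda>n. X (r n)) g sequentially"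
proof -
  obtain g r where g: "g holomorphic_on halfplane" and r: "strict_mono (r :: nat \<Rightarrow> nat)"
    and lim: "\<And>z. z \<in> halfplane \<Longrightarrow> (\<lambda>n. X (r n) z) \<longlonglongrightarrow> g z"
    and ul: "\<And>K. \<lbrakk>compact K; K \<subseteq> halfplane\<rbrakk> \<Longrightarrow> uniform_limit K (X \<circ> r) g sequentially"
  proof (rule Montel[OF open_halfplane, of normalized_univalent X])
    show "\<And>h. h \<in> normalized_univalent \<Longrightarrow> h holomorphic_on halfplane"
      by (rule normalized_univalentD)
  qed (use normalized_univalent_locally_bounded X in auto)
  have s: "\<epsilon> \<le> slope g"
    by (rule slope_ge_lim[where X = "\<lambda>n. X (r n)" and a = "\<lambda>_. \<epsilon>"])
       (use lim slope normalized_univalentD(7)[OF X] in auto)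
  have Re0: "0 \<le> Re (g z)" if "z \<in> halfplane" for z
    by (rule LIMSEQ_le_const[OF tendsto_Re[OF lim[OF that]]])
       (use normalized_univalentD(7)[OF X that] in auto)
  have Re_ge: "\<epsilon> * Re z \<le> Re (g z)" if "z \<in> halfplane" for z
  proof -
    have "\<epsilon> * Re z \<le> slope g * Re z"
      using s that by (intro mult_right_mono) (auto simp: halfplane_def)
    also have "\<dots> \<le> Re (g z)" by (rule slope_mult_le[OF Re0 that])
    finally show ?thesis .
  qed
  have g1: "g 1 = 1"
    using lim[OF one_in_halfplane] normalized_univalentD(4)[OF X]
    by (simp add: LIMSEQ_const_iff)
  have maps: "g ` halfplane \<subseteq> halfplane"
    using Re_ge \<open>0 < \<epsilon>\<close> by (force simp: halfplane_def intro: less_le_trans[OF mult_pos_pos])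
  have "\<not> g constant_on halfplane"
  proof
    assume "g constant_on halfplane"
    then obtain a where "\<And>z. z \<in> halfplane \<Longrightarrow> g z = a" by (auto simp: constant_on_def)
    then have *: "g z = 1" if "z \<in> halfplane" for z using g1 one_in_halfplane that by metis
    \<comment> \<open>At this point the slope bound forces real part at least 2, while a constant
      limit would have to be 1.\<close>
    have "complex_of_real (2 / \<epsilon>) \<in> halfplane" using \<open>0 < \<epsilon>\<close> by (simp add: halfplane_def)
    from Re_ge[OF this] *[OF this] show False using \<open>0 < \<epsilon>\<close> by simp
  qed
  then have "inj_on g halfplane"
    using Hurwitz_injective[OF open_halfplane connected_halfplane, of "X \<circ> r" g]
      normalized_univalentD(1,3)[OF X] g ul by simp
  then have "g \<in> normalized_univalent"
    using g maps g1 s \<open>0 < \<epsilon>\<close> by (simp add: normalized_univalent_def)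
  then show ?thesis using that r lim ul by (simp add: o_def)
qed

lemma tendsto_compose_uniform_on_compact:
  fixes X :: "nat \<Rightarrow> complex \<Rightarrow> complex"
  assumes "open S" and ul: "\<And>K. compact K \<Longrightarrow> K \<subseteq> S \<Longrightarrow> uniform_limit K X g sequentially"
    and cont: "continuous_on S g" and y: "y \<longlonglongrightarrow> w" and w: "w \<in> S"
  shows "(\<lambda>n. X n (y n)) \<longlonglongrightarrow> g w"
proof (rule tendstoI)
  fix e :: real assume "e > 0"
  obtain d where d: "d > 0" "cball w d \<subseteq> S" using \<open>open S\<close> w open_contains_cball by blast
  have "(\<lambda>n. g (y n)) \<longlonglongrightarrow> g w"
    using cont \<open>open S\<close> w by (intro isCont_tendsto_compose[OF _ y]) (simp add: continuous_on_eq_continuous_at)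
  then have "\<forall>\<^sub>F n in sequentially. dist (g (y n)) (g w) < e / 2"
    using \<open>e > 0\<close> by (intro tendstoD) auto
  moreover have "\<forall>\<^sub>F n in sequentially. \<forall>z\<in>cball w d. dist (X n z) (g z) < e / 2"
    using ul[OF compact_cball d(2)] \<open>e > 0\<close> by (intro uniform_limitD) auto
  moreover have "\<forall>\<^sub>F n in sequentially. dist (y n) w < d" using y d(1) by (rule tendstoD)
  ultimately show "\<forall>\<^sub>F n in sequentially. dist (X n (y n)) (g w) < e"
  proof eventually_elim
    case (elim n)
    then have "dist (X n (y n)) (g (y n)) < e / 2" by (simp add: dist_commute)
    with elim show ?case by (metis dist_commute dist_triangle_half_l)
  qed
qed

section \<open>Factorization of normalized univalent maps\<close>

text \<open>By boundary bumping, the continuum \<open>- D\<close> contains a smaller continuum \<open>C\<close> that avoids a disc around 0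
  meeting \<open>- D\<close>, but still reaches into the unit disc.\<close>

lemma intermediate_simply_connected:
  fixes D :: "complex set"
  assumes D: "open D" "simply_connected D" "0 \<in> D" "D \<subset> ball 0 1"
  obtains D' where "open D'" "simply_connected D'" "D \<subset> D'" "D' \<subset> ball 0 1"
proof -
  let ?E = "- ball 0 1 :: complex set"
  obtain q where "q \<in> ball 0 1" "q \<notin> D" using D(4) by blast
  then have q: "q \<notin> D" "cmod q < 1" by auto
  \<comment> \<open>The disc of radius \<open>\<rho>\<close> contains the omitted point
    \<open>q\<close>, so any domain containing \<open>D\<close> and this disc is strictly larger
    than \<open>D\<close>.\<close>
  define \<rho> where "\<rho> = (1 + cmod q) / 2"
  have \<rho>: "cmod q < \<rho>" "\<rho> < 1" "0 < \<rho>" using q norm_ge_zero[of q] by (auto simp: \<rho>_def simp del: norm_ge_zero)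
  have conD: "connected D" using D simply_connected_imp_connected by blast
  have conX: "connected (- D)"
    using simply_connected_iff_simple[OF D(1)] D bounded_subset[OF bounded_ball] by blast
  define Y where "Y = - (D \<union> ball 0 \<rho>)"
  have clY: "closed Y" using D by (auto simp: Y_def)
  have E: "connected ?E" by (rule connected_complement_bounded_convex) auto
  have EY: "?E \<subseteq> Y" using D \<rho> by (auto simp: Y_def)
  define C where "C = connected_component_set Y 2"
  have two: "2 \<in> ?E" by simp
  have EC: "?E \<subseteq> C" unfolding C_def by (rule connected_component_maximal[OF two E EY])
  have CY: "C \<subseteq> Y" by (simp add: C_def connected_component_subset)
  have conC: "connected C" by (simp add: C_def)
  have clC: "closed C" unfolding C_def using clY by (rule closed_connected_component)
  \<comment> \<open>A component of the complement of a connected set has connected complement; for a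
    bounded connected open set this is simple connectivity.\<close>
  define D' where "D' = connected_component_set (- C) 0"
  have conDb: "connected (D \<union> ball 0 \<rho>)"
    by (rule connected_Un) (use conD D \<rho> in auto)
  have sub: "D \<union> ball 0 \<rho> \<subseteq> D'"
    unfolding D'_def
    by (rule connected_component_maximal) (use conDb CY D in \<open>auto simp: Y_def\<close>)
  have D'C: "D' \<subseteq> - C" by (simp add: D'_def connected_component_subset)
  have opD': "open D'" unfolding D'_def using clC by (intro open_connected_component) auto
  have conD': "connected D'" by (simp add: D'_def)
  have "0 \<in> - C" using CY D by (auto simp: Y_def)
  then have "D' \<in> components (- C)" by (simp add: D'_def componentsI)
  then have con_compl: "connected (- D')" using component_complement_connected conC by blast
  have D'b: "D' \<subseteq> ball 0 1" using D'C EC by auto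
  have sc: "simply_connected D'"
    using simply_connected_iff_simple[OF opD' bounded_subset[OF bounded_ball D'b]] conD' con_compl
    by blast
  have "C \<inter> ball 0 1 \<noteq> {}"
  proof
    assume disj: "C \<inter> ball 0 1 = {}"
    \<comment> \<open>If \<open>C\<close> stopped at the unit circle, the component of the compact
      set \<open>Y'\<close> through 1 would avoid \<open>cball 0 \<rho>\<close>. Sura-Bura then
      isolates it by a relatively clopen set that still avoids this disc.\<close>
    define Y' where "Y' = Y \<inter> cball 0 1"
    have cY': "compact Y'" unfolding Y'_def using clY by (simp add: closed_Int_compact)
    have "sphere 0 1 \<subseteq> Y'" using EY by (auto simp: Y'_def)
    have cons: "connected (sphere (0::complex) 1)" by (rule connected_sphere) simp
    define C' where "C' = connected_component_set Y' 1"
    have sC': "sphere 0 1 \<subseteq> C'"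
      unfolding C'_def using cons \<open>sphere 0 1 \<subseteq> Y'\<close> by (intro connected_component_maximal) auto
    have "C' \<subseteq> Y'" by (simp add: C'_def connected_component_subset)
    have "1 \<in> Y'" using \<open>sphere 0 1 \<subseteq> Y'\<close> by auto
    have "C' \<subseteq> C"
    proof -
      have "connected (C' \<union> ?E)"
      proof (rule connected_Un)
        have "1 \<in> C' \<inter> ?E" using sC' by auto
        then show "C' \<inter> ?E \<noteq> {}" by blast
      qed (use E in \<open>auto simp: C'_def\<close>)
      then show ?thesis
        using connected_component_maximal[of 2 "C' \<union> ?E" Y] \<open>C' \<subseteq> Y'\<close> EY two
        unfolding C_def Y'_def by blast
    qed
    then have "C' \<subseteq> - cball 0 \<rho>" using disj \<rho> by fastforce
    moreover have "C' \<in> components Y'" using \<open>1 \<in> Y'\<close> by (simp add: C'_def componentsI)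
    moreover have "compact C'"
      using cY' compact_components \<open>C' \<in> components Y'\<close> by blast
    ultimately obtain U where U: "openin (top_of_set Y') U" "compact U" "C' \<subseteq> U" "U \<subseteq> - cball 0 \<rho>"
      using Sura_Bura_clopen_subset[of Y' C' "- cball 0 \<rho>"] closed_cball open_Compl
        closed_imp_locally_compact[OF compact_imp_closed[OF cY']] by blast
    have "closed (Y' - U)"
    proof -
      obtain W where "open W" "U = Y' \<inter> W" using U(1) by (auto simp: openin_open)
      then have "Y' - U = Y' \<inter> - W" by auto
      then show ?thesis using \<open>open W\<close> compact_imp_closed[OF cY'] by auto
    qed
    \<comment> \<open>Two disjoint closed sets covering \<open>- D\<close>: \<open>A\<close>
      contains 2 and \<open>B\<close> contains \<open>q\<close>, against the connectedness of
      \<open>- D\<close>.\<close>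
    define A where "A = U \<union> ?E"
    define B where "B = (Y' - U) \<union> (- D \<inter> cball 0 \<rho>)"
    have "closed A" using compact_imp_closed[OF U(2)] closed_Compl[OF open_ball] by (auto simp: A_def intro: closed_Un)
    moreover have "closed B" using \<open>closed (Y' - U)\<close> D by (auto simp: B_def closed_Un closed_Int)
    moreover have "- D \<subseteq> A \<union> B" by (auto simp: A_def B_def Y'_def Y_def)
    moreover have "A \<inter> B = {}"
      using U(4) sC' U(3) \<rho> by (auto simp: A_def B_def Y'_def)
    moreover have "2 \<in> A \<inter> - D" "q \<in> B \<inter> - D" using q \<rho> D by (auto simp: A_def B_def)
    ultimately show False using conX unfolding connected_closed by blast
  qed
  then have "D' \<noteq> ball 0 1" using D'C by blast
  moreover have "D \<noteq> D'" using sub q \<rho> by auto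
  ultimately show ?thesis using that opD' sc sub D'b by blast
qed

section \<open>The Cayley transform taking infinity to \<sigma>, and Julia's lemma\<close>

definition disc_of :: "complex \<Rightarrow> complex \<Rightarrow> complex" where
  "disc_of \<sigma> w = \<sigma> * (w - 1) / (w + 1)"

definition half_of :: "complex \<Rightarrow> complex \<Rightarrow> complex" where
  "half_of \<sigma> z = (\<sigma> + z) / (\<sigma> - z)"

lemma halfplane_add_one: "w \<in> halfplane \<Longrightarrow> w + 1 \<noteq> 0"
  by (auto simp: halfplane_def complex_eq_iff)

lemma one_minus_disc_of:
  assumes "norm \<sigma> = 1" "w \<in> halfplane"
  shows "1 - (cmod (disc_of \<sigma> w))\<^sup>2 = 4 * Re w / (cmod (w + 1))\<^sup>2"
proof -
  have "(cmod (disc_of \<sigma> w))\<^sup>2 = (cmod (w - 1))\<^sup>2 / (cmod (w + 1))\<^sup>2"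
    using assms by (simp add: disc_of_def norm_divide norm_mult power_divide)
  moreover have "(cmod (w + 1))\<^sup>2 \<noteq> 0" using halfplane_add_one[OF assms(2)] by simp
  moreover have "(cmod (w - 1))\<^sup>2 = (cmod (w + 1))\<^sup>2 - 4 * Re w"
    using cmod_add_cnj_diff[of w 1] by simp
  ultimately show ?thesis by (simp add: diff_divide_distrib)
qed

lemma disc_of_in_ball:
  assumes "norm \<sigma> = 1" "w \<in> halfplane"
  shows "disc_of \<sigma> w \<in> ball 0 1"
proof -
  have "0 < 4 * Re w / (cmod (w + 1))\<^sup>2"
    using assms halfplane_add_one[OF assms(2)] by (simp add: halfplane_def)
  then show ?thesis
    using one_minus_disc_of[OF assms] abs_square_less_1[of "cmod (disc_of \<sigma> w)"] by simp
qed

lemma Re_half_of: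
  "Re (half_of \<sigma> z) = ((cmod \<sigma>)\<^sup>2 - (cmod z)\<^sup>2) / (cmod (\<sigma> - z))\<^sup>2"
proof -
  have "half_of \<sigma> z = (\<sigma> + z) * cnj (\<sigma> - z) / of_real ((cmod (\<sigma> - z))\<^sup>2)"
    unfolding half_of_def by (metis complex_div_cnj of_real_power)
  then have "Re (half_of \<sigma> z) = Re ((\<sigma> + z) * cnj (\<sigma> - z)) / (cmod (\<sigma> - z))\<^sup>2"
    by (metis Re_divide_of_real)
  also have "Re ((\<sigma> + z) * cnj (\<sigma> - z)) = (cmod \<sigma>)\<^sup>2 - (cmod z)\<^sup>2"
    unfolding cmod_power2 by (simp add: algebra_simps power2_eq_square)
  finally show ?thesis .
qed

lemma half_of_in_halfplane:
  assumes "norm \<sigma> = 1" "z \<in> ball 0 1"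
  shows "half_of \<sigma> z \<in> halfplane"
proof -
  have "\<sigma> - z \<noteq> 0" using assms by auto
  moreover have "(cmod z)\<^sup>2 < 1" using assms by (simp add: abs_square_less_1)
  ultimately show ?thesis using assms by (simp add: halfplane_def Re_half_of)
qed

lemma disc_of_half_of:
  assumes "norm \<sigma> = 1" "z \<in> ball 0 1"
  shows "disc_of \<sigma> (half_of \<sigma> z) = z"
proof -
  have ne: "\<sigma> - z \<noteq> 0" "\<sigma> \<noteq> 0" using assms by auto
  have "half_of \<sigma> z - 1 = 2 * z / (\<sigma> - z)" "half_of \<sigma> z + 1 = 2 * \<sigma> / (\<sigma> - z)"
    using ne by (auto simp: half_of_def field_simps)
  then show ?thesis using ne by (simp add: disc_of_def)
qed

lemma half_of_disc_of:
  assumes "norm \<sigma> = 1" "w \<in> halfplane"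
  shows "half_of \<sigma> (disc_of \<sigma> w) = w"
proof -
  have ne: "w + 1 \<noteq> 0" "\<sigma> \<noteq> 0" using assms halfplane_add_one by auto
  have "\<sigma> + disc_of \<sigma> w = 2 * \<sigma> * w / (w + 1)" "\<sigma> - disc_of \<sigma> w = 2 * \<sigma> / (w + 1)"
    using ne by (auto simp: disc_of_def field_simps)
  then show ?thesis using ne by (simp add: half_of_def)
qed

lemma holomorphic_disc_of: "disc_of \<sigma> holomorphic_on halfplane"
  unfolding disc_of_def using halfplane_add_one by (intro holomorphic_intros) auto

lemma holomorphic_half_of:
  assumes "norm \<sigma> = 1"
  shows "half_of \<sigma> holomorphic_on ball 0 1"
  unfolding half_of_def using assms by (intro holomorphic_intros) auto

lemma inj_on_disc_of: "norm \<sigma> = 1 \<Longrightarrow> inj_on (disc_of \<sigma>) halfplane"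
  by (rule inj_on_inverseI[of _ "half_of \<sigma>"]) (simp add: half_of_disc_of)

lemma inj_on_half_of: "norm \<sigma> = 1 \<Longrightarrow> inj_on (half_of \<sigma>) (ball 0 1)"
  by (rule inj_on_inverseI[of _ "disc_of \<sigma>"]) (simp add: disc_of_half_of)

lemma disc_of_one: "disc_of \<sigma> 1 = 0" and half_of_zero: "\<sigma> \<noteq> 0 \<Longrightarrow> half_of \<sigma> 0 = 1"
  by (simp_all add: disc_of_def half_of_def)

text \<open>After squaring, the product of the two squared moduli of sums cancels. The remaining
  inequality can be normalized by \<open>Re w\<close> and \<open>(cmod (w + 1))\<^sup>2\<close> and
  passed to the limit as \<open>w\<close> goes to infinity.\<close>

lemma halfplane_Schwarz_Pick_Re:
  assumes holp: "p holomorphic_on halfplane" and p: "p ` halfplane \<subseteq> halfplane"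
    and z: "z \<in> halfplane" and w: "w \<in> halfplane"
  shows "Re z * Re w * (cmod (p z + cnj (p w)))\<^sup>2 \<le> Re (p z) * Re (p w) * (cmod (z + cnj w))\<^sup>2"
proof -
  have "(cmod (p z - p w) * cmod (z + cnj w))\<^sup>2 \<le> (cmod (z - w) * cmod (p z + cnj (p w)))\<^sup>2"
    by (rule power_mono[OF halfplane_Schwarz_Pick[OF assms]]) auto
  then have "((cmod (p z + cnj (p w)))\<^sup>2 - 4 * Re (p z) * Re (p w)) * (cmod (z + cnj w))\<^sup>2 \<le>
      ((cmod (z + cnj w))\<^sup>2 - 4 * Re z * Re w) * (cmod (p z + cnj (p w)))\<^sup>2"
    using cmod_add_cnj_diff[of z w] cmod_add_cnj_diff[of "p z" "p w"]
    by (simp add: power_mult_distrib algebra_simps)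
  then show ?thesis by (simp add: algebra_simps)
qed

text \<open>The quotient \<open>Re w / \<bar>w + 1\<bar>\<^sup>2\<close> is a quarter of one minus the squared modulus
  of the corresponding point of the disc.\<close>

lemma Julia_slope_pos:
  fixes w :: "nat \<Rightarrow> complex"
  assumes holp: "p holomorphic_on halfplane" and p: "p ` halfplane \<subseteq> halfplane"
    and w: "\<And>n. w n \<in> halfplane" and winf: "filterlim w at_infinity sequentially"
    and pinf: "filterlim (\<lambda>n. p (w n)) at_infinity sequentially"
    and C: "0 < C"
    and le: "\<And>n. Re (p (w n)) / (cmod (p (w n) + 1))\<^sup>2 \<le> C * (Re (w n) / (cmod (w n + 1))\<^sup>2)"
  shows "0 < slope p"
proof -
  \<comment> \<open>At infinity the base point 1 may be exchanged for any fixed point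
    \<open>a\<close> without changing the limit.\<close>
  have lim: "(\<lambda>n. ((cmod (a + cnj (y n))) / cmod (y n + 1))\<^sup>2) \<longlonglongrightarrow> 1"
    if "filterlim y at_infinity sequentially" for y :: "nat \<Rightarrow> complex" and a
  proof -
    have i: "(\<lambda>n. inverse (y n)) \<longlonglongrightarrow> 0"
      using that tendsto_inverse_0 by (rule filterlim_compose[rotated])
    have "(\<lambda>n. (cmod (a * cnj (inverse (y n)) + 1) / cmod (1 + inverse (y n)))\<^sup>2)
        \<longlonglongrightarrow> (cmod (a * cnj 0 + 1) / cmod (1 + 0))\<^sup>2"
      by (intro tendsto_intros i) auto
    moreover have "\<forall>\<^sub>F n in sequentially. (cmod (cnj a * inverse (y n) + 1) / cmod (1 + inverse (y n)))\<^sup>2 =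
        ((cmod (a + cnj (y n))) / cmod (y n + 1))\<^sup>2"
    proof -
      have "\<forall>\<^sub>F n in sequentially. 1 \<le> cmod (y n)"
        using filterlim_at_infinity_imp_norm_at_top[OF that] by (simp add: filterlim_at_top)
      then show ?thesis
      proof eventually_elim
        case (elim n)
        then have y0: "y n \<noteq> 0" by auto
        have "cnj a * inverse (y n) + 1 = cnj (a + cnj (y n)) / y n"
          "1 + inverse (y n) = (y n + 1) / y n" using y0 by (simp_all add: field_simps)
        then show ?case using y0 by (simp only: norm_divide complex_mod_cnj) simp
      qed
    qed
    moreover have "cmod (a * cnj (inverse (y n)) + 1) = cmod (cnj a * inverse (y n) + 1)" for n
      by (metis complex_cnj_add complex_cnj_cnj complex_cnj_mult complex_cnj_one complex_mod_cnj)
    ultimately show ?thesis by (auto elim: Lim_transform_eventually)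
  qed
  have "1 / C \<le> slope p"
  proof (rule le_slope)
    fix z assume z: "z \<in> halfplane"
    have pz: "p z \<in> halfplane" using p z by blast
    have ineq: "Re z * ((cmod (p z + cnj (p (w n)))) / cmod (p (w n) + 1))\<^sup>2 \<le>
        C * Re (p z) * ((cmod (z + cnj (w n))) / cmod (w n + 1))\<^sup>2" for n
    proof -
      define P where "P = (cmod (p (w n) + 1))\<^sup>2"
      define W where "W = (cmod (w n + 1))\<^sup>2"
      define r where "r = Re (w n)"
      define s where "s = Re (p (w n))"
      define A where "A = (cmod (p z + cnj (p (w n))))\<^sup>2"
      define B where "B = (cmod (z + cnj (w n)))\<^sup>2"
      have pos: "P > 0" "W > 0" "r > 0" "s > 0" "B \<ge> 0" "Re (p z) > 0"
        using p w[of n] pz halfplane_add_one[of "w n"] halfplane_add_one[of "p (w n)"]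
        by (auto simp: P_def W_def r_def s_def B_def halfplane_def)
      have "Re z * r * A \<le> Re (p z) * s * B"
        using halfplane_Schwarz_Pick_Re[OF holp p z w[of n]] by (simp add: A_def B_def r_def s_def)
      moreover have "s \<le> C * r / W * P"
        using le[of n] pos unfolding P_def[symmetric] W_def[symmetric] r_def[symmetric] s_def[symmetric]
        by (simp add: pos_divide_le_eq)
      then have "Re (p z) * s * B \<le> Re (p z) * (C * r / W * P) * B"
        using pos by (intro mult_right_mono mult_left_mono) auto
      ultimately have "Re z * r * A \<le> Re (p z) * (C * r / W * P) * B" by linarith
      then have "r * (Re z * A) \<le> r * (C * Re (p z) * B / W * P)" by (simp add: field_simps)
      then have "Re z * A \<le> C * Re (p z) * B / W * P" by (rule mult_left_le_imp_le[OF _ pos(3)])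
      then have "Re z * (A / P) \<le> C * Re (p z) * (B / W)" using pos by (simp add: field_simps)
      then show ?thesis by (simp add: A_def B_def P_def W_def power_divide)
    qed
    \<comment> \<open>The dependence on \<open>w n\<close> disappears in the limit and a bound for
      the slope from below remains, with constant \<open>1 / C\<close>.\<close>
    have "Re z * 1 \<le> C * Re (p z) * 1"
      by (rule LIMSEQ_le[OF tendsto_mult_left[OF lim[OF pinf]] tendsto_mult_left[OF lim[OF winf]]])
         (use ineq in blast)
    then show "1 / C * Re z \<le> Re (p z)" using C by (simp add: field_simps)
  qed
  moreover have "0 < 1 / C" using C by simp
  ultimately show ?thesis by linarith
qed

lemma filterlim_half_of_at_infinity:
  assumes "norm \<sigma> = 1" and "(z \<longlongrightarrow> \<sigma>) F" and "\<forall>\<^sub>F x in F. z x \<noteq> \<sigma>"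
  shows "filterlim (\<lambda>x. half_of \<sigma> (z x)) at_infinity F"
proof -
  have "((\<lambda>x. \<sigma> - z x) \<longlongrightarrow> \<sigma> - \<sigma>) F" by (intro tendsto_intros assms)
  then have "filterlim (\<lambda>x. \<sigma> - z x) (at 0) F"
    using assms(3) by (auto simp: filterlim_at elim: eventually_mono)
  then have "filterlim (\<lambda>x. inverse (\<sigma> - z x)) at_infinity F"
    by (rule filterlim_compose[OF filterlim_inverse_at_infinity])
  moreover have "((\<lambda>x. \<sigma> + z x) \<longlongrightarrow> \<sigma> + \<sigma>) F" by (intro tendsto_intros assms)
  moreover have "\<sigma> + \<sigma> \<noteq> 0" using assms(1) by auto
  ultimately have "filterlim (\<lambda>x. (\<sigma> + z x) * inverse (\<sigma> - z x)) at_infinity F"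
    by (intro tendsto_mult_filterlim_at_infinity)
  then show ?thesis by (simp add: half_of_def divide_inverse)
qed

text \<open>The inverse also fixes 1, so its slope is at most 1 too, while the two slopes multiply
  to 1.\<close>

lemma surj_normalized_univalent_imp_slope_one:
  assumes k: "k \<in> normalized_univalent" and surj: "halfplane \<subseteq> k ` halfplane"
  shows "slope k = 1"
proof -
  note K = normalized_univalentD[OF k]
  have im: "k ` halfplane = halfplane" using K(2) surj by blast
  obtain j where j: "j holomorphic_on k ` halfplane" "\<And>z. z \<in> halfplane \<Longrightarrow> j (k z) = z"
    using holomorphic_has_inverse[OF K(1) open_halfplane K(3)] by metis
  have jH: "j z \<in> halfplane" if "z \<in> halfplane" for z using that im j(2) by (metis imageE)
  have j1: "j 1 = 1" using j(2)[OF one_in_halfplane] K(4) by simp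
  have "slope (\<lambda>z. j (k z)) = slope j * slope k"
    by (rule slope_comp) (use j(1) im K jH in \<open>auto simp: halfplane_def less_imp_le\<close>)
  moreover have "slope (\<lambda>z. j (k z)) = 1"
    using slope_cong[of "\<lambda>z. j (k z)" "\<lambda>z. z"] j(2) slope_id by simp
  ultimately have eq: "slope j * slope k = 1" by simp
  have j0: "0 \<le> Re (j z)" if "z \<in> halfplane" for z using jH[OF that] by (simp add: halfplane_def)
  have "slope j \<le> 1" using slope_mult_le[of j, OF j0 one_in_halfplane] j1 by simp
  then have "1 \<le> slope k" using eq K(5) by (metis mult_right_mono less_imp_le mult_1)
  then show ?thesis using slope_le_one[OF k] by simp
qed

text \<open>Schwarz's lemma for a self-map of the disc fixing the centre, the point 1 being the
  centre. It traps the quotient of the inner factor between those of the identity and of the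
  composition.\<close>

lemma Re_quotient_mono:
  assumes p: "p holomorphic_on halfplane" "p ` halfplane \<subseteq> halfplane" "p 1 = 1"
    and z: "z \<in> halfplane"
  shows "Re z / (cmod (z + 1))\<^sup>2 \<le> Re (p z) / (cmod (p z + 1))\<^sup>2"
proof -
  have pz: "p z \<in> halfplane" using p z by blast
  have "Re z * (cmod (p z + 1))\<^sup>2 \<le> Re (p z) * (cmod (z + 1))\<^sup>2"
    using halfplane_Schwarz_Pick_Re[OF p(1,2) z one_in_halfplane] p(3) by simp
  then show ?thesis
    using halfplane_add_one[OF z] halfplane_add_one[OF pz] by (simp add: divide_simps mult.commute)
qed

section \<open>Nontrivial factorization through an intermediate domain\<close>

lemma Riemann_map_at_zero:
  assumes "open S" "simply_connected S" "0 \<in> S" "S \<noteq> UNIV"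
  obtains f g where "f holomorphic_on S" "g holomorphic_on ball 0 1"
    "\<And>z. z \<in> S \<Longrightarrow> f z \<in> ball 0 1" "\<And>z. z \<in> S \<Longrightarrow> g (f z) = z"
    "\<And>z. z \<in> ball 0 1 \<Longrightarrow> g z \<in> S" "\<And>z. z \<in> ball 0 1 \<Longrightarrow> f (g z) = z"
    "f 0 = 0" "g (0::complex) = 0"
proof -
  obtain f g where fg: "f holomorphic_on S" "g holomorphic_on ball 0 1"
    "\<forall>z\<in>S. f z \<in> ball 0 1 \<and> g (f z) = z" "\<forall>z\<in>ball 0 1. g z \<in> S \<and> f (g z) = z"
    using assms(2,3,4) unfolding simply_connected_eq_biholomorphic_to_disc[OF assms(1)] by blast
  have "f 0 \<in> ball 0 1" using fg(3) assms(3) by blast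
  then obtain F G where FG: "F (f 0) = 0" "F holomorphic_on ball 0 1" "G holomorphic_on ball 0 1"
    "F ` ball 0 1 \<subseteq> ball 0 1" "G ` ball 0 1 \<subseteq> ball 0 1"
    "\<And>z. z \<in> ball 0 1 \<Longrightarrow> G (F z) = z" "\<And>z. z \<in> ball 0 1 \<Longrightarrow> F (G z) = z"
    by (rule ball_biholomorphism_exists) (rule that)
  have "(F \<circ> f) holomorphic_on S" "(g \<circ> G) holomorphic_on ball 0 1"
    using fg FG by (auto intro!: holomorphic_on_compose_gen[where t = "ball 0 1"])
  moreover have "(g \<circ> G) 0 = 0"
    using FG(1,6) fg(3) assms(3) \<open>f 0 \<in> ball 0 1\<close> by (metis comp_apply)
  moreover have "(F \<circ> f) 0 = 0" using FG(1) by simp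
  ultimately show ?thesis
    using that[of "F \<circ> f" "g \<circ> G"] fg(3,4) FG(4-7) unfolding image_subset_iff by simp
qed

text \<open>The Riemann map \<open>f\<close> of the intermediate domain \<open>D'\<close> cuts
  \<open>F\<close> into \<open>v0 = f \<circ> F\<close> followed by the inverse \<open>g\<close>.
  Nothing is known about the boundary behaviour of \<open>f\<close>, so the boundary point \<tau>
  that becomes infinity is obtained by compactness. Both factors then have positive slope by Julia's
  lemma, and neither is the identity because \<open>D'\<close> lies strictly between
  \<open>D\<close> and the disc.\<close>

lemma normalized_univalent_factor:
  assumes k: "k \<in> normalized_univalent" and "slope k < 1"
  obtains u v where "u \<in> normalized_univalent" "v \<in> normalized_univalent"
    "slope u < 1" "slope v < 1" "\<And>z. z \<in> halfplane \<Longrightarrow> k z = u (v z)"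
proof -
  note K = normalized_univalentD[OF k]
  define c where "c = slope k"
  have c: "c > 0" using K(5) by (simp add: c_def)
  define F where "F z = disc_of 1 (k z)" for z
  define D where "D = F ` halfplane"
  have holF: "F holomorphic_on halfplane"
    using holomorphic_on_compose_gen[OF K(1) holomorphic_disc_of[of 1] K(2)]
    by (simp add: F_def[abs_def] o_def)
  have injF: "inj_on F halfplane"
    using comp_inj_on[OF K(3) inj_on_subset[OF inj_on_disc_of K(2)]]
    by (simp add: F_def[abs_def] o_def)
  have Fball: "F z \<in> ball 0 1" if "z \<in> halfplane" for z
    unfolding F_def using disc_of_in_ball[OF _ K(6)[OF that]] by simp
  have F1: "F 1 = 0" by (simp add: F_def K(4) disc_of_one)
  have opD: "open D"
    unfolding D_def using open_mapping_thm3[OF holF open_halfplane injF] .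
  have "halfplane homeomorphic D"
    unfolding D_def using invariance_of_domain_homeomorphic[OF open_halfplane _ _ injF] holF
    by (simp add: holomorphic_on_imp_continuous_on)
  then have scD: "simply_connected D"
    using convex_imp_simply_connected[OF convex_halfplane] homeomorphic_simply_connected_eq by blast
  have zD: "0 \<in> D" unfolding D_def using F1 one_in_halfplane by force
  have "D \<noteq> ball 0 1"
  proof
    assume *: "D = ball 0 1"
    have "halfplane \<subseteq> k ` halfplane"
    proof
      fix w assume w: "w \<in> halfplane"
      then have "disc_of 1 w \<in> D" using disc_of_in_ball[of 1 w] * by simp
      then obtain z where z: "z \<in> halfplane" "disc_of 1 w = disc_of 1 (k z)"
        by (auto simp: D_def F_def)
      then have "w = k z" using inj_onD[OF inj_on_disc_of[of 1]] w K(6) by simp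
      then show "w \<in> k ` halfplane" using z by blast
    qed
    then show False
      using surj_normalized_univalent_imp_slope_one[OF k] \<open>slope k < 1\<close> by simp
  qed
  then have "D \<subset> ball 0 1" using Fball by (auto simp: D_def)
  then obtain D' where D': "open D'" "simply_connected D'" "D \<subset> D'" "D' \<subset> ball 0 1"
    using intermediate_simply_connected[OF opD scD zD] by blast
  have D'_ne: "D' \<noteq> UNIV" using D'(4) by auto
  obtain f g where f: "f holomorphic_on D'" "\<And>z. z \<in> D' \<Longrightarrow> f z \<in> ball 0 1"
      "\<And>z. z \<in> D' \<Longrightarrow> g (f z) = z" "f 0 = 0"
    and g: "g holomorphic_on ball 0 1" "\<And>z. z \<in> ball 0 1 \<Longrightarrow> g z \<in> D'"
      "\<And>z. z \<in> ball 0 1 \<Longrightarrow> f (g z) = z" "g 0 = 0"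
    by (rule Riemann_map_at_zero[OF D'(1,2) subsetD[OF psubset_imp_subset[OF D'(3)] zD] D'_ne])
      (rule that)
  have FD': "F z \<in> D'" if "z \<in> halfplane" for z using that D'(3) by (auto simp: D_def)
  define v0 where "v0 z = f (F z)" for z
  have holv0: "v0 holomorphic_on halfplane"
    using holomorphic_on_compose_gen[OF holF f(1)] FD' by (auto simp: v0_def[abs_def] o_def)
  have v0b: "v0 z \<in> ball 0 1" if "z \<in> halfplane" for z
    unfolding v0_def using f(2) FD' that by blast
  \<comment> \<open>Schwarz's lemma for \<open>g\<close>, which fixes 0 and maps the disc into
    itself.\<close>
  have F_le: "cmod (F z) \<le> cmod (v0 z)" if "z \<in> halfplane" for z
  proof -
    have gb: "cmod (g y) < 1" if "cmod y < 1" for y using g(2)[of y] D'(4) that by auto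
    have "cmod (g (v0 z)) \<le> cmod (v0 z)"
      by (rule Schwarz_Lemma(1)[OF g(1,4) gb]) (use v0b[OF that] in auto)
    then show ?thesis using f(3) FD'[OF that] by (simp add: v0_def)
  qed
  define x :: "nat \<Rightarrow> complex" where "x n = of_real (real n + 1)" for n
  have x: "x n \<in> halfplane" "Re (x n) = real n + 1" "cmod (x n) = real n + 1"
     "cmod (x n + 1) = real n + 2" for n
    using norm_of_real[of "real n + 1", where 'a = complex]
      norm_of_real[of "real n + 2", where 'a = complex]
    by (simp_all only: x_def halfplane_def) (auto simp: add.assoc)
  have xinf: "filterlim x at_infinity sequentially"
    unfolding filterlim_at_infinity_conv_norm_at_top x
    by (rule filterlim_at_top_mono[OF filterlim_real_sequentially]) simp
  have Rek: "c * (real n + 1) \<le> Re (k (x n))" for n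
    using slope_mult_le[OF K(7) x(1)] x(2) by (simp add: c_def)
  have kinf: "filterlim (\<lambda>n. k (x n)) at_infinity sequentially"
    unfolding filterlim_at_infinity_conv_norm_at_top
  proof (rule filterlim_at_top_mono)
    show "filterlim (\<lambda>n. c * (real n + 1)) at_top sequentially"
      by (rule filterlim_tendsto_pos_mult_at_top[OF tendsto_const])
         (use c filterlim_at_top_mono[OF filterlim_real_sequentially, of "\<lambda>n. real n + 1"]
          in auto)
    show "\<forall>\<^sub>F n in sequentially. c * (real n + 1) \<le> cmod (k (x n))"
      using Rek complex_Re_le_cmod order_trans by (intro always_eventually) blast
  qed
  \<comment> \<open>The quotient is at most \<open>1 / Re (k (x n))\<close>, and the positive slope
    of \<open>k\<close> makes this of order \<open>1 / n\<close>.\<close>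
  have qk: "Re (k (x n)) / (cmod (k (x n) + 1))\<^sup>2 \<le> 1 / (c * (real n + 1))" for n
  proof -
    define s where "s = Re (k (x n))"
    have s: "0 < s" using K(6)[OF x(1)] by (simp add: s_def halfplane_def)
    have "s \<le> cmod (k (x n) + 1)"
      using complex_Re_le_cmod[of "k (x n) + 1"] by (simp add: s_def)
    then have "s / (cmod (k (x n) + 1))\<^sup>2 \<le> s / s\<^sup>2"
      using s by (intro divide_left_mono power_mono mult_pos_pos) auto
    also have "\<dots> = 1 / s" by (simp add: power2_eq_square)
    also have "\<dots> \<le> 1 / (c * (real n + 1))"
      using Rek[of n] c s by (intro divide_left_mono mult_pos_pos) (auto simp: s_def)
    finally show ?thesis by (simp add: s_def)
  qed
  \<comment> \<open>The quotient at \<open>x n\<close> itself is of order \<open>1 / n\<close> as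
    well; the 4 comes from \<open>real n + 2 \<le> 2 * (real n + 1)\<close>.\<close>
  have qx: "1 / (c * (real n + 1)) \<le> 4 / c * (Re (x n) / (cmod (x n + 1))\<^sup>2)" for n
  proof -
    have "(real n + 2)\<^sup>2 \<le> 4 * (real n + 1)\<^sup>2" by (simp add: power2_eq_square algebra_simps)
    then have "1 / (real n + 1) \<le> 4 * ((real n + 1) / (real n + 2)\<^sup>2)"
      by (simp add: divide_simps) (simp add: power2_eq_square algebra_simps)
    then have "1 / c * (1 / (real n + 1)) \<le> 1 / c * (4 * ((real n + 1) / (real n + 2)\<^sup>2))"
      using c by (intro mult_left_mono) auto
    then show ?thesis by (simp add: x)
  qed
  obtain \<tau> r where r: "strict_mono (r :: nat \<Rightarrow> nat)" and \<tau>: "(\<lambda>n. v0 (x (r n))) \<longlonglongrightarrow> \<tau>"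
  proof -
    have "\<forall>n. v0 (x n) \<in> cball 0 1" using v0b[OF x(1)] by (simp add: less_imp_le)
    then obtain l r where "strict_mono (r :: nat \<Rightarrow> nat)" "((\<lambda>n. v0 (x n)) \<circ> r) \<longlonglongrightarrow> l"
      using compact_cball[of "0::complex" 1] unfolding compact_def by meson
    then show ?thesis using that by (simp add: o_def)
  qed
  \<comment> \<open>The values \<open>F (x n)\<close> approach the circle because the quotients of
    \<open>k (x n)\<close> tend to 0, and \<open>v0 (x n)\<close> has at least the same
    modulus.\<close>
  have \<tau>1: "norm \<tau> = 1"
  proof -
    have lim1: "(\<lambda>n. (cmod (v0 (x n)))\<^sup>2) \<longlonglongrightarrow> 1"
    proof (rule tendsto_sandwich)
      show "\<forall>\<^sub>F n in sequentially. 1 - 4 * (1 / (c * (real n + 1))) \<le> (cmod (v0 (x n)))\<^sup>2"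
      proof (rule always_eventually, rule allI)
        fix n
        have "1 - (cmod (F (x n)))\<^sup>2 = 4 * (Re (k (x n)) / (cmod (k (x n) + 1))\<^sup>2)"
          unfolding F_def using one_minus_disc_of[of 1 "k (x n)"] K(6) x(1) by simp
        moreover have "(cmod (F (x n)))\<^sup>2 \<le> (cmod (v0 (x n)))\<^sup>2"
          using F_le[OF x(1)] by (intro power_mono) auto
        ultimately show "1 - 4 * (1 / (c * (real n + 1))) \<le> (cmod (v0 (x n)))\<^sup>2"
          using qk[of n] by linarith
      qed
      show "\<forall>\<^sub>F n in sequentially. (cmod (v0 (x n)))\<^sup>2 \<le> 1"
        using v0b[OF x(1)] by (intro always_eventually allI) (simp add: abs_square_le_1 less_imp_le)
      have "(\<lambda>n. 1 - 4 / c * inverse (real (Suc n))) \<longlonglongrightarrow> 1 - 4 / c * 0"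
        by (intro tendsto_intros LIMSEQ_inverse_real_of_nat)
      then show "(\<lambda>n. 1 - 4 * (1 / (c * (real n + 1)))) \<longlonglongrightarrow> 1"
        by (simp add: field_simps)
    qed simp
    have "(\<lambda>n. (cmod (v0 (x (r n))))\<^sup>2) \<longlonglongrightarrow> (cmod \<tau>)\<^sup>2"
      by (intro tendsto_intros \<tau>)
    moreover have "(\<lambda>n. (cmod (v0 (x (r n))))\<^sup>2) \<longlonglongrightarrow> 1"
      using LIMSEQ_subseq_LIMSEQ[OF lim1 r] by (simp add: o_def)
    ultimately have "(cmod \<tau>)\<^sup>2 = 1" by (rule LIMSEQ_unique)
    then show ?thesis by (metis norm_ge_zero one_power2 power2_eq_imp_eq zero_le_one)
  qed
  define V where "V z = half_of \<tau> (v0 z)" for z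
  define U where "U w = half_of 1 (g (disc_of \<tau> w))" for w
  have holV: "V holomorphic_on halfplane"
    using holomorphic_on_compose_gen[OF holv0 holomorphic_half_of[OF \<tau>1]] image_subsetI[of halfplane v0, OF v0b]
    by (simp add: V_def[abs_def] o_def)
  have VH: "V z \<in> halfplane" if "z \<in> halfplane" for z
    unfolding V_def using half_of_in_halfplane[OF \<tau>1 v0b[OF that]] .
  have V1: "V 1 = 1"
    using \<tau>1 by (simp add: V_def v0_def F1 f(4)) (metis half_of_zero norm_zero zero_neq_one)
  have gdb: "g (disc_of \<tau> w) \<in> D'" "g (disc_of \<tau> w) \<in> ball 0 1" if "w \<in> halfplane" for w
    using g(2)[OF disc_of_in_ball[OF \<tau>1 that]] D'(4) by auto
  have holgd: "(\<lambda>w. g (disc_of \<tau> w)) holomorphic_on halfplane"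
    using holomorphic_on_compose_gen[OF holomorphic_disc_of[of \<tau>] g(1)]
      image_subsetI[of halfplane "disc_of \<tau>", OF disc_of_in_ball[OF \<tau>1]]
    by (simp add: o_def)
  have holU: "U holomorphic_on halfplane"
    using holomorphic_on_compose_gen[OF holgd holomorphic_half_of[of 1]]
      image_subsetI[of halfplane "\<lambda>w. g (disc_of \<tau> w)", OF gdb(2)]
    by (simp add: U_def[abs_def] o_def)
  have UH: "U w \<in> halfplane" if "w \<in> halfplane" for w
    unfolding U_def using half_of_in_halfplane[OF _ gdb(2)[OF that]] by simp
  have U1: "U 1 = 1" by (simp add: U_def disc_of_one g(4) half_of_zero)
  have UV: "U (V z) = k z" if "z \<in> halfplane" for z
  proof -
    have "disc_of \<tau> (V z) = v0 z"
      unfolding V_def using disc_of_half_of[OF \<tau>1 v0b[OF that]] .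
    then have "U (V z) = half_of 1 (F z)" using f(3)[OF FD'[OF that]] by (simp add: U_def v0_def)
    also have "\<dots> = k z" unfolding F_def using half_of_disc_of[of 1 "k z"] K(6)[OF that] by simp
    finally show ?thesis .
  qed
  have injf: "inj_on f D'" by (rule inj_on_inverseI[of _ g]) (rule f(3))
  have injg: "inj_on g (ball 0 1)" by (rule inj_on_inverseI[of _ f]) (rule g(3))
  have injV: "inj_on V halfplane"
  proof (rule inj_onI)
    fix a b assume ab: "a \<in> halfplane" "b \<in> halfplane" "V a = V b"
    then have "k a = k b" using UV by metis
    then show "a = b" using K(3) ab by (meson inj_onD)
  qed
  have injU: "inj_on U halfplane"
  proof (rule inj_onI)
    fix a b assume ab: "a \<in> halfplane" "b \<in> halfplane" "U a = U b"
    then have "g (disc_of \<tau> a) = g (disc_of \<tau> b)"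
      unfolding U_def using inj_onD[OF inj_on_half_of[of 1]] gdb by simp
    then have "disc_of \<tau> a = disc_of \<tau> b" using inj_onD[OF injg] disc_of_in_ball[OF \<tau>1] ab by blast
    then show "a = b" using inj_onD[OF inj_on_disc_of[OF \<tau>1]] ab by blast
  qed
  have xrinf: "filterlim (\<lambda>n. x (r n)) at_infinity sequentially"
    using filterlim_compose[OF xinf filterlim_subseq[OF r]] .
  have krinf: "filterlim (\<lambda>n. U (V (x (r n)))) at_infinity sequentially"
    using filterlim_compose[OF kinf filterlim_subseq[OF r]] UV[OF x(1)] by simp
  have Vrinf: "filterlim (\<lambda>n. V (x (r n))) at_infinity sequentially"
    unfolding V_def
  proof (rule filterlim_half_of_at_infinity[OF \<tau>1 \<tau>], rule always_eventually, rule allI)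
    fix n show "v0 (x (r n)) \<noteq> \<tau>" using v0b[OF x(1), of "r n"] \<tau>1 by auto
  qed
  \<comment> \<open>Together with \<open>qxV\<close> and \<open>qkx\<close> this makes the quotients
    at \<open>x n\<close>, \<open>V (x n)\<close> and \<open>k (x n)\<close> comparable up to
    \<open>4 / c\<close>, so each of the two factors satisfies the hypothesis of Julia's
    lemma.\<close>
  have qVk: "Re (V (x n)) / (cmod (V (x n) + 1))\<^sup>2 \<le> Re (k (x n)) / (cmod (k (x n) + 1))\<^sup>2" for n
    using Re_quotient_mono[OF holU _ U1 VH[OF x(1)]] UH UV[OF x(1)] by auto
  have qxV: "Re (x n) / (cmod (x n + 1))\<^sup>2 \<le> Re (V (x n)) / (cmod (V (x n) + 1))\<^sup>2" for n
    using Re_quotient_mono[OF holV _ V1 x(1)] VH by auto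
  have qkx: "Re (k (x n)) / (cmod (k (x n) + 1))\<^sup>2 \<le> 4 / c * (Re (x n) / (cmod (x n + 1))\<^sup>2)" for n
    using qk[of n] qx[of n] by linarith
  have "0 < slope V"
  proof (rule Julia_slope_pos[OF holV _ x(1) xrinf Vrinf])
    show "V ` halfplane \<subseteq> halfplane" using VH by blast
    show "0 < 4 / c" using c by simp
    show "Re (V (x (r n))) / (cmod (V (x (r n)) + 1))\<^sup>2
        \<le> 4 / c * (Re (x (r n)) / (cmod (x (r n) + 1))\<^sup>2)" for n
      using qVk[of "r n"] qkx[of "r n"] by linarith
  qed
  then have V: "V \<in> normalized_univalent"
    using holV VH injV V1 by (auto simp: normalized_univalent_def)
  have "0 < slope U"
  proof (rule Julia_slope_pos[OF holU _ VH[OF x(1)] Vrinf krinf])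
    show "U ` halfplane \<subseteq> halfplane" using UH by blast
    show "0 < 4 / c" using c by simp
    show "Re (U (V (x (r n)))) / (cmod (U (V (x (r n))) + 1))\<^sup>2
        \<le> 4 / c * (Re (V (x (r n))) / (cmod (V (x (r n)) + 1))\<^sup>2)" for n
      using mult_left_mono[OF qxV[of "r n"], of "4 / c"] qkx[of "r n"] c UV[OF x(1)] by simp
  qed
  then have U: "U \<in> normalized_univalent"
    using holU UH injU U1 by (auto simp: normalized_univalent_def)
  \<comment> \<open>Slope 1 would make \<open>U\<close> the identity and hence \<open>g\<close> onto
    the disc, yet \<open>g\<close> takes values in \<open>D'\<close> only.\<close>
  have "slope U \<noteq> 1"
  proof
    assume "slope U = 1"
    obtain q where q: "q \<in> ball 0 1" "q \<notin> D'" using D'(4) by blast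
    have qH: "half_of 1 q \<in> halfplane" using half_of_in_halfplane q by simp
    have "half_of 1 (g (disc_of \<tau> (half_of 1 q))) = half_of 1 q"
      using slope_one_imp_id[OF U \<open>slope U = 1\<close> qH] by (simp add: U_def)
    then have "g (disc_of \<tau> (half_of 1 q)) = q"
      using inj_onD[OF inj_on_half_of[of 1]] gdb[OF qH] q(1) by simp
    then show False using gdb[OF qH] q(2) by simp
  qed
  \<comment> \<open>If \<open>V\<close> were the identity, \<open>v0\<close> would reach every point
    \<open>f q\<close> with \<open>q\<close> in \<open>D'\<close>, and injectivity of
    \<open>f\<close> would put \<open>q\<close> into \<open>D\<close>.\<close>
  moreover have "slope V \<noteq> 1"
  proof
    assume "slope V = 1"
    obtain q where q: "q \<in> D'" "q \<notin> D" using D'(3) by blast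
    have qH: "half_of \<tau> (f q) \<in> halfplane" using half_of_in_halfplane[OF \<tau>1] f(2)[OF q(1)] by simp
    define z where "z = half_of \<tau> (f q)"
    have "half_of \<tau> (v0 z) = half_of \<tau> (f q)"
      using slope_one_imp_id[OF V \<open>slope V = 1\<close> qH] by (simp add: V_def z_def)
    then have "v0 z = f q"
      using inj_onD[OF inj_on_half_of[OF \<tau>1]] v0b[OF qH] f(2)[OF q(1)] z_def by simp
    then have "F z = q" using inj_onD[OF injf] FD'[OF qH] q(1) by (simp add: v0_def z_def)
    then have "q \<in> D" unfolding D_def using imageI[OF qH, of F] by (simp add: z_def)
    then show False using q(2) by simp
  qed
  ultimately show ?thesis
    using that[OF U V] slope_le_one[OF U] slope_le_one[OF V] UV by simp
qed

section \<open>Chains of normalized univalent maps\<close>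

text \<open>Classical subordination of univalent maps: the image of \<open>g\<close> shrinks inside
  that of \<open>h\<close>. Values off the half-plane are ignored, so the relation is only a
  preorder on functions; mutual subordination in the class means agreement on the
  half-plane.\<close>

definition subordinate :: "(complex \<Rightarrow> complex) \<Rightarrow> (complex \<Rightarrow> complex) \<Rightarrow> bool" where
  "subordinate g h \<longleftrightarrow> (\<exists>k\<in>normalized_univalent. \<forall>z\<in>halfplane. g z = h (k z))"

lemma subordinateE:
  assumes "subordinate g h" and "h \<in> normalized_univalent"
  obtains k where "k \<in> normalized_univalent" "\<And>z. z \<in> halfplane \<Longrightarrow> g z = h (k z)"
    "slope g = slope h * slope k"
proof -
  obtain k where k: "k \<in> normalized_univalent" "\<And>z. z \<in> halfplane \<Longrightarrow> g z = h (k z)"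
    using assms(1) by (auto simp: subordinate_def)
  then show ?thesis
    using that[OF k] slope_cong[of g "\<lambda>z. h (k z)"] comp_normalized_univalent(2)[OF assms(2) k(1)]
    by simp
qed

lemma subordinate_trans:
  assumes "subordinate g h" "subordinate h k"
  shows "subordinate g k"
proof -
  obtain a b where a: "a \<in> normalized_univalent" "\<And>z. z \<in> halfplane \<Longrightarrow> g z = h (a z)"
    and b: "b \<in> normalized_univalent" "\<And>z. z \<in> halfplane \<Longrightarrow> h z = k (b z)"
    using assms by (auto simp: subordinate_def)
  have "\<forall>z\<in>halfplane. g z = k (b (a z))"
    using a b normalized_univalentD(6)[OF a(1)] by simp
  then show ?thesis
    using comp_normalized_univalent(1)[OF b(1) a(1)] unfolding subordinate_def
    by (intro bexI[of _ "\<lambda>z. b (a z)"]) auto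
qed

lemma subordinate_cong: "(\<And>z. z \<in> halfplane \<Longrightarrow> g z = h z) \<Longrightarrow> subordinate g h"
  unfolding subordinate_def using id_normalized_univalent by (intro bexI[of _ "\<lambda>z. z"]) auto

lemma subordinate_refl: "subordinate g g"
  by (rule subordinate_cong) simp

lemma subordinate_slope_le:
  assumes "subordinate g h" and "h \<in> normalized_univalent"
  shows "slope g \<le> slope h"
  by (rule subordinateE[OF assms])
     (metis slope_le_one normalized_univalentD(5)[OF assms(2)] less_imp_le mult_left_le)

text \<open>Antisymmetry measured by the slope: the inner map has slope 1 and is therefore the
  identity.\<close>

lemma subordinate_slope_ge_imp_eq:
  assumes "subordinate g h" and h: "h \<in> normalized_univalent" and "slope h \<le> slope g"
    and "z \<in> halfplane"
  shows "g z = h z"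
proof (rule subordinateE[OF assms(1,2)])
  fix k assume k: "k \<in> normalized_univalent" "\<And>z. z \<in> halfplane \<Longrightarrow> g z = h (k z)"
    "slope g = slope h * slope k"
  then have "slope h * 1 \<le> slope h * slope k" using assms(3) by simp
  then have "1 \<le> slope k" using normalized_univalentD(5)[OF h] by (simp only: mult_le_cancel_left_pos)
  then have "slope k = 1" using slope_le_one[OF k(1)] by simp
  then show ?thesis using slope_one_imp_id[OF k(1) _ assms(4)] k(2)[OF assms(4)] by simp
qed

text \<open>Since \<open>slope h \<le> 1\<close>, the inner maps inherit the lower slope bound, so
  compactness yields a limit of them; the outer map stays fixed and continuity suffices.\<close>

lemma subordinate_limit_left:
  fixes Y :: "nat \<Rightarrow> complex \<Rightarrow> complex"
  assumes Y: "\<And>n. Y n \<in> normalized_univalent" and \<epsilon>: "0 < \<epsilon>" "\<And>n. \<epsilon> \<le> slope (Y n)"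
    and lim: "\<And>z. z \<in> halfplane \<Longrightarrow> (\<lambda>n. Y n z) \<longlonglongrightarrow> g z"
    and h: "h \<in> normalized_univalent" and sub: "\<And>n. subordinate (Y n) h"
  shows "subordinate g h"
proof -
  have "\<exists>k\<in>normalized_univalent. (\<forall>z\<in>halfplane. Y n z = h (k z)) \<and> \<epsilon> \<le> slope k" for n
  proof (rule subordinateE[OF sub[of n] h])
    fix k assume k: "k \<in> normalized_univalent" "\<And>z. z \<in> halfplane \<Longrightarrow> Y n z = h (k z)"
      "slope (Y n) = slope h * slope k"
    have "slope h * slope k \<le> slope k"
      using slope_le_one[OF h] normalized_univalentD(5)[OF k(1)] by simp
    then have "\<epsilon> \<le> slope k" using \<epsilon>(2)[of n] k(3) by simp
    then show ?thesis using k by blast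
  qed
  then obtain k where k: "\<And>n. k n \<in> normalized_univalent"
    "\<And>n z. z \<in> halfplane \<Longrightarrow> Y n z = h (k n z)" "\<And>n. \<epsilon> \<le> slope (k n)"
    by metis
  obtain l r where l: "l \<in> normalized_univalent" "strict_mono (r :: nat \<Rightarrow> nat)"
    "\<And>z. z \<in> halfplane \<Longrightarrow> (\<lambda>n. k (r n) z) \<longlonglongrightarrow> l z"
    using normalized_univalent_compact[of k, OF k(1) \<epsilon>(1) k(3)] by metis
  have "g z = h (l z)" if z: "z \<in> halfplane" for z
  proof -
    have "isCont h (l z)"
      using normalized_univalentD(1)[OF h] normalized_univalentD(6)[OF l(1) z] open_halfplane
      by (meson continuous_on_eq_continuous_at holomorphic_on_imp_continuous_on)
    then have "(\<lambda>n. h (k (r n) z)) \<longlonglongrightarrow> h (l z)" using l(3)[OF z] by (rule isCont_tendsto_compose)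
    moreover have "(\<lambda>n. h (k (r n) z)) \<longlonglongrightarrow> g z"
      using LIMSEQ_subseq_LIMSEQ[OF lim[OF z] l(2)] k(2)[OF z] by (simp add: o_def)
    ultimately show ?thesis by (metis LIMSEQ_unique)
  qed
  then show ?thesis using l(1) by (auto simp: subordinate_def)
qed

text \<open>Now the outer maps vary, so locally uniform convergence is needed to pass to the limit
  in \<open>Y n (k n z)\<close>. The bound on \<open>slope k\<close> says that the inner factor
  loses nothing in the limit, which forbids the outer factor to gain.\<close>

lemma subordinate_limit_right:
  fixes Y :: "nat \<Rightarrow> complex \<Rightarrow> complex"
  assumes Y: "\<And>n. Y n \<in> normalized_univalent"
    and ul: "\<And>K. compact K \<Longrightarrow> K \<subseteq> halfplane \<Longrightarrow> uniform_limit K Y g sequentially"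
    and g: "g \<in> normalized_univalent" and h: "h \<in> normalized_univalent"
    and sub: "\<And>n. subordinate h (Y n)" and c: "(\<lambda>n. slope (Y n)) \<longlonglongrightarrow> c" "0 < c"
  obtains k where "k \<in> normalized_univalent" "\<And>z. z \<in> halfplane \<Longrightarrow> h z = g (k z)"
    "slope h / c \<le> slope k"
proof -
  note pos = normalized_univalentD(5)
  have "\<exists>k\<in>normalized_univalent. (\<forall>z\<in>halfplane. h z = Y n (k z)) \<and> slope h / slope (Y n) = slope k" for n
    by (rule subordinateE[OF sub[of n] Y]) (use pos[OF Y[of n]] in auto)
  then obtain k where k: "\<And>n. k n \<in> normalized_univalent"
    "\<And>n z. z \<in> halfplane \<Longrightarrow> h z = Y n (k n z)" "\<And>n. slope h / slope (Y n) = slope (k n)"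
    by metis
  have "slope h \<le> slope (k n)" for n
    unfolding k(3)[of n, symmetric] using slope_le_one[OF Y[of n]] pos[OF Y[of n]] pos[OF h]
    by (simp add: pos_le_divide_eq)
  then obtain l r where l: "l \<in> normalized_univalent" and r: "strict_mono (r :: nat \<Rightarrow> nat)"
    and llim: "\<And>z. z \<in> halfplane \<Longrightarrow> (\<lambda>n. k (r n) z) \<longlonglongrightarrow> l z"
    using normalized_univalent_compact[of k, OF k(1) pos[OF h]] by metis
  have "h z = g (l z)" if z: "z \<in> halfplane" for z
  proof -
    have "(\<lambda>n. Y (r n) (k (r n) z)) \<longlonglongrightarrow> g (l z)"
    proof (rule tendsto_compose_uniform_on_compact[OF open_halfplane _ _ llim[OF z]])
      show "uniform_limit K (\<lambda>n. Y (r n)) g sequentially" if "compact K" "K \<subseteq> halfplane" for K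
        using filterlim_compose[OF ul[OF that] filterlim_subseq[OF r]] .
      show "continuous_on halfplane g"
        using normalized_univalentD(1)[OF g] by (rule holomorphic_on_imp_continuous_on)
      show "l z \<in> halfplane" by (rule normalized_univalentD(6)[OF l z])
    qed
    then show ?thesis using k(2)[OF z] by (simp add: LIMSEQ_const_iff)
  qed
  moreover have "slope h / c \<le> slope l"
  proof (rule slope_ge_lim[where X = "\<lambda>n. k (r n)" and a = "\<lambda>n. slope h / slope (Y (r n))"])
    show "(\<lambda>n. slope h / slope (Y (r n))) \<longlonglongrightarrow> slope h / c"
      using LIMSEQ_subseq_LIMSEQ[OF c(1) r] c(2) by (intro tendsto_intros) (auto simp: o_def)
  qed (use k llim normalized_univalentD(7)[OF k(1)] in auto)
  ultimately show ?thesis using that[OF l] by blast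
qed

lemma exists_subordination_chain:
  assumes f: "f \<in> normalized_univalent"
  obtains G where "\<And>c. c \<in> {slope f..1} \<Longrightarrow> G c \<in> normalized_univalent"
    "\<And>c. c \<in> {slope f..1} \<Longrightarrow> slope (G c) = c"
    "\<And>c d. slope f \<le> c \<Longrightarrow> c \<le> d \<Longrightarrow> d \<le> 1 \<Longrightarrow> subordinate (G c) (G d)"
    "\<And>z. z \<in> halfplane \<Longrightarrow> G (slope f) z = f z"
proof -
  note pos = normalized_univalentD(5)
  define A where "A = {g \<in> normalized_univalent. subordinate f g}"
  obtain C where C: "pred_on.maxchain A subordinate C"
    using pred_on.Hausdorff by blast
  then have chain: "pred_on.chain A subordinate C" by (rule pred_on.maxchain_imp_chain)
  have CN: "g \<in> normalized_univalent" and fsub: "subordinate f g" if "g \<in> C" for g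
    using chain that by (auto simp: pred_on.chain_def A_def)
  have total: "subordinate g h \<or> subordinate h g" if "g \<in> C" "h \<in> C" for g h
    using chain that subordinate_refl unfolding pred_on.chain_def by fastforce
  \<comment> \<open>The usable form of maximality: whatever is comparable with every member of the
    chain already belongs to it.\<close>
  have maximal: "g \<in> C" if g: "g \<in> normalized_univalent" "subordinate f g"
    "\<And>e. e \<in> C \<Longrightarrow> subordinate e g \<or> subordinate g e" for g
  proof (rule ccontr)
    assume "g \<notin> C"
    have "pred_on.chain A subordinate (insert g C)"
      using chain g subordinate_refl unfolding pred_on.chain_def A_def by auto
    with C \<open>g \<notin> C\<close> show False unfolding pred_on.maxchain_def by blast
  qed
  have sub: "subordinate g h" if "g \<in> C" "h \<in> C" "slope g \<le> slope h" for g h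
  proof (cases "subordinate g h")
    case False
    then have "subordinate h g" using total that by blast
    then have "g z = h z" if "z \<in> halfplane" for z
      using subordinate_slope_ge_imp_eq[OF _ CN[OF \<open>g \<in> C\<close>]] that \<open>slope g \<le> slope h\<close> by simp
    then show ?thesis by (rule subordinate_cong)
  qed
  have fC: "f \<in> C" by (rule maximal[OF f subordinate_refl]) (use fsub in blast)
  have sub_id: "subordinate g (\<lambda>z. z)" if "g \<in> normalized_univalent" for g
    using that by (auto simp: subordinate_def)
  have idC: "(\<lambda>z. z) \<in> C"
    by (rule maximal[OF id_normalized_univalent sub_id[OF f]]) (use sub_id CN in blast)
  have range: "slope f \<le> slope g" "slope g \<le> 1" if "g \<in> C" for g
    using subordinate_slope_le[OF fsub CN] slope_le_one[OF CN] that by auto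
  have closed: "c \<in> slope ` C" if X: "\<And>n. X n \<in> C" "(\<lambda>n. slope (X n)) \<longlonglongrightarrow> c" for c and X :: "nat \<Rightarrow> complex \<Rightarrow> complex"
  proof (rule ccontr)
    assume notin: "c \<notin> slope ` C"
    have c: "0 < c"
      using LIMSEQ_le_const[OF X(2), of "slope f"] range(1)[OF X(1)] pos[OF f] by force
    obtain g r where g: "g \<in> normalized_univalent" and r: "strict_mono (r :: nat \<Rightarrow> nat)"
      and lim: "\<And>z. z \<in> halfplane \<Longrightarrow> (\<lambda>n. X (r n) z) \<longlonglongrightarrow> g z"
      and ul: "\<And>K. compact K \<Longrightarrow> K \<subseteq> halfplane \<Longrightarrow> uniform_limit K (\<lambda>n. X (r n)) g sequentially"
      using normalized_univalent_compact[of X, OF CN[OF X(1)] pos[OF f] range(1)[OF X(1)]] by metis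
    have rlim: "(\<lambda>n. slope (X (r n))) \<longlonglongrightarrow> c"
      using LIMSEQ_subseq_LIMSEQ[OF X(2) r] by (simp add: o_def)
    have "c \<le> slope g"
      by (rule slope_ge_lim[where X = "\<lambda>n. X (r n)", OF _ lim order_refl rlim])
         (use normalized_univalentD(7)[OF CN[OF X(1)]] in auto)
    obtain k where k: "k \<in> normalized_univalent" "\<And>z. z \<in> halfplane \<Longrightarrow> f z = g (k z)"
      "slope f / c \<le> slope k"
      using subordinate_limit_right[of "\<lambda>n. X (r n)", OF CN[OF X(1)] ul g f fsub[OF X(1)] rlim c]
      by metis
    have "slope f = slope g * slope k"
      using slope_cong[of f "\<lambda>z. g (k z)"] k comp_normalized_univalent(2)[OF g k(1)] by simp
    moreover have "slope g * (slope f / c) \<le> slope g * slope k"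
      using k(3) pos[OF g] by (intro mult_left_mono) auto
    ultimately have "slope g * slope f \<le> c * slope f" using c by (simp add: field_simps)
    then have "slope g \<le> c" using pos[OF f] by simp
    then have sg: "slope g = c" using \<open>c \<le> slope g\<close> by simp
    have "subordinate e g \<or> subordinate g e" if e: "e \<in> C" for e
    proof -
      \<comment> \<open>No member has slope \<open>c\<close>, so a tail of the approximating
        sequence lies strictly on one side of \<open>e\<close>, and subordination passes to the
        limit on that side.\<close>
      consider "slope e < c" | "c < slope e" using e notin by (metis imageI linorder_neqE)
      then show ?thesis
      proof cases
        case 1
        then obtain N where N: "\<And>n. n \<ge> N \<Longrightarrow> slope e < slope (X (r n))"
          using order_tendstoD(1)[OF rlim] unfolding eventually_sequentially by blast
        have "subordinate e (X (r (n + N)))" for n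
          using sub[OF e X(1)] N[of "n + N"] by simp
        moreover have "uniform_limit K (\<lambda>n. X (r (n + N))) g sequentially"
          if "compact K" "K \<subseteq> halfplane" for K
          using filterlim_compose[OF ul[OF that] filterlim_add_const_nat_at_top[of N]] .
        ultimately have "subordinate e g"
          using subordinate_limit_right[of "\<lambda>n. X (r (n + N))" g e c] CN[OF X(1)] g CN[OF e]
            LIMSEQ_ignore_initial_segment[OF rlim, of N] c
          unfolding subordinate_def by metis
        then show ?thesis by blast
      next
        case 2
        then obtain N where N: "\<And>n. n \<ge> N \<Longrightarrow> slope (X (r n)) < slope e"
          using order_tendstoD(2)[OF rlim] unfolding eventually_sequentially by blast
        have "subordinate (X (r (n + N))) e" for n
          using sub[OF X(1) e] N[of "n + N"] by simp
        then have "subordinate g e"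
          using subordinate_limit_left[of "\<lambda>n. X (r (n + N))" "slope f" g e] CN[OF X(1)] CN[OF e]
            LIMSEQ_ignore_initial_segment[OF lim, of _ N] pos[OF f] range(1)[OF X(1)] by blast
        then show ?thesis by blast
      qed
    qed
    then have "g \<in> C" by (intro maximal[OF g]) (use k in \<open>auto simp: subordinate_def\<close>)
    then show False using sg notin by blast
  qed
  have closedS: "closed (slope ` C)"
    unfolding closed_sequential_limits
  proof (intro allI impI, elim conjE)
    fix x l assume x: "\<forall>n. x n \<in> slope ` C" "x \<longlonglongrightarrow> l"
    then have "\<forall>n. \<exists>g. g \<in> C \<and> x n = slope g" by blast
    then obtain X where X: "\<And>n. X n \<in> C" "\<And>n. x n = slope (X n)"
      using choice[of "\<lambda>n g. g \<in> C \<and> x n = slope g"] by blast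
    show "l \<in> slope ` C"
      by (rule closed[of X]) (use x(2) X(1) in \<open>simp_all flip: X(2)\<close>)
  qed
  have full: "c \<in> slope ` C" if c: "slope f \<le> c" "c \<le> 1" for c
  proof (rule ccontr)
    assume notin: "c \<notin> slope ` C"
    \<comment> \<open>The gap around \<open>c\<close>; its endpoints are slopes of members because
      the set of slopes is closed.\<close>
    define lo where "lo = Sup (slope ` C \<inter> {..c})"
    define hi where "hi = Inf (slope ` C \<inter> {c..})"
    have "slope f \<in> slope ` C \<inter> {..c}" using imageI[OF fC, of slope] c by simp
    then have "slope ` C \<inter> {..c} \<noteq> {}" by (metis emptyE)
    then have lo: "lo \<in> slope ` C \<inter> {..c}"
      unfolding lo_def
      by (rule closed_contains_Sup[OF _ bdd_above_Int2[OF bdd_above_Iic] closed_Int[OF closedS closed_atMost]])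
    have "1 \<in> slope ` C \<inter> {c..}" using imageI[OF idC, of slope] c slope_id by simp
    then have "slope ` C \<inter> {c..} \<noteq> {}" by (metis emptyE)
    then have hi: "hi \<in> slope ` C \<inter> {c..}"
      unfolding hi_def
      by (rule closed_contains_Inf[OF _ bdd_below_Int2[OF bdd_below_Ici] closed_Int[OF closedS closed_atLeast]])
    obtain g1 g2 where g: "g1 \<in> C" "g2 \<in> C" "slope g1 = lo" "slope g2 = hi"
      using lo hi by fast
    have le: "lo \<le> c" "c \<le> hi" using lo hi by auto
    have lt: "lo < c" "c < hi" using notin g le by (metis imageI less_le)+
    have gap: "s \<le> lo \<or> hi \<le> s" if "s \<in> slope ` C" for s
    proof (cases "s \<le> c")
      case True
      then have "s \<le> lo" unfolding lo_def using that by (intro cSup_upper bdd_aboveI[of _ c]) auto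
      then show ?thesis ..
    next
      case False
      then have "hi \<le> s" unfolding hi_def using that by (intro cInf_lower bdd_belowI[of _ c]) auto
      then show ?thesis ..
    qed
    note N1 = CN[OF g(1)] and N2 = CN[OF g(2)]
    obtain k where k: "k \<in> normalized_univalent" "\<And>z. z \<in> halfplane \<Longrightarrow> g1 z = g2 (k z)"
      "slope g1 = slope g2 * slope k"
    proof (rule subordinateE[OF sub[OF g(1,2)] N2])
      show "slope g1 \<le> slope g2" using g lt by simp
    qed (rule that)
    have "slope k < 1"
    proof -
      have "slope g2 * slope k < slope g2 * 1" using k(3) lt g by simp
      then show ?thesis by (simp only: mult_less_cancel_left_pos[OF pos[OF N2]])
    qed
    then obtain u v where u: "u \<in> normalized_univalent" "slope u < 1"
      and v: "v \<in> normalized_univalent" "slope v < 1"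
      and uv: "\<And>z. z \<in> halfplane \<Longrightarrow> k z = u (v z)"
      using normalized_univalent_factor[OF k(1)] by metis
    \<comment> \<open>Splitting the map across the gap as \<open>k = u \<circ> v\<close> inserts
      \<open>g2 \<circ> u\<close> strictly between \<open>g1\<close> and \<open>g2\<close>.\<close>
    define w where "w z = g2 (u z)" for z
    have w: "w \<in> normalized_univalent" "slope w = hi * slope u"
      using comp_normalized_univalent[OF N2 u(1)] g(4) by (simp_all add: w_def[abs_def])
    have w2: "subordinate w g2" using u(1) by (auto simp: subordinate_def w_def)
    have w1: "subordinate g1 w" using v(1) uv k(2) by (auto simp: subordinate_def w_def)
    have "slope g1 = slope w * slope v"
      using slope_cong[of g1 "\<lambda>z. w (v z)"] k(2) uv comp_normalized_univalent(2)[OF w(1) v(1)]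
      by (simp add: w_def)
    then have "lo < slope w" using g(3) v(2) pos[OF w(1)] by simp
    moreover have "slope w < hi" using w(2) u(2) pos[OF N2] g(4) by simp
    moreover have "w \<in> C"
    proof (rule maximal[OF w(1) subordinate_trans[OF fsub[OF g(1)] w1]])
      fix e assume e: "e \<in> C"
      then consider "slope e \<le> lo" | "hi \<le> slope e" using gap by blast
      then show "subordinate e w \<or> subordinate w e"
      proof cases
        case 1
        then show ?thesis using subordinate_trans[OF sub[OF e g(1)] w1] g(3) by simp
      next
        case 2
        then show ?thesis using subordinate_trans[OF w2 sub[OF g(2) e]] g(4) by simp
      qed
    qed
    ultimately show False using gap[of "slope w"] by (simp add: leD)
  qed
  define G where "G c = (SOME g. g \<in> C \<and> slope g = c)" for c
  have G: "G c \<in> C" "slope (G c) = c" if "slope f \<le> c" "c \<le> 1" for c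
  proof -
    have "\<exists>g. g \<in> C \<and> slope g = c" using full[OF that] by blast
    then have "G c \<in> C \<and> slope (G c) = c" unfolding G_def by (rule someI_ex)
    then show "G c \<in> C" "slope (G c) = c" by blast+
  qed
  show ?thesis
  proof (rule that[of G])
    show "subordinate (G c) (G d)" if "slope f \<le> c" "c \<le> d" "d \<le> 1" for c d
      using that G by (intro sub) auto
    show "G (slope f) z = f z" if "z \<in> halfplane" for z
      using subordinate_slope_ge_imp_eq[OF fsub CN _ that, of "G (slope f)"] G[OF order_refl]
        slope_le_one[OF f] by simp
  qed (use G CN in auto)
qed

section \<open>Absolutely continuous functions\<close>

text \<open>Frees the index set from initial segments of the naturals: grid cells will be indexed by
  integers, and merged families by pairs.\<close>

lemma absolutely_continuous_on_interval_finite: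
  assumes "absolutely_continuous_on_interval a b f" and "\<epsilon> > 0"
  obtains \<delta> where "\<delta> > 0"
    "\<And>(I::'i set) x y. \<lbrakk>finite I; \<And>i. i \<in> I \<Longrightarrow> a \<le> x i \<and> x i \<le> y i \<and> y i \<le> b;
        disjoint_family_on (\<lambda>i. {x i<..<y i}) I; (\<Sum>i\<in>I. y i - x i) < \<delta>\<rbrakk>
      \<Longrightarrow> (\<Sum>i\<in>I. \<bar>f (y i) - f (x i)\<bar>) < \<epsilon>"
proof -
  obtain \<delta> where \<delta>: "\<delta> > 0" and D: "\<And>(n::nat) x y. \<lbrakk>\<forall>i<n. a \<le> x i \<and> x i \<le> y i \<and> y i \<le> b;
      disjoint_family_on (\<lambda>i. {x i<..<y i}) {..<n}; (\<Sum>i<n. y i - x i) < \<delta>\<rbrakk>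
      \<Longrightarrow> (\<Sum>i<n. \<bar>f (y i) - f (x i)\<bar>) < \<epsilon>"
    using assms unfolding absolutely_continuous_on_interval_def by meson
  have "(\<Sum>i\<in>I. \<bar>f (y i) - f (x i)\<bar>) < \<epsilon>"
    if I: "finite I" "\<And>i. i \<in> I \<Longrightarrow> a \<le> x i \<and> x i \<le> y i \<and> y i \<le> b"
      "disjoint_family_on (\<lambda>i. {x i<..<y i}) I" "(\<Sum>i\<in>I. y i - x i) < \<delta>"
    for I :: "'i set" and x y
  proof -
    obtain h where h: "bij_betw h {..<card I} I"
      using ex_bij_betw_nat_finite[OF I(1)] by (auto simp: atLeast0LessThan)
    then have hI: "h i \<in> I" if "i < card I" for i using that by (auto simp: bij_betw_def)
    have sum_h: "(\<Sum>i<card I. w (h i)) = (\<Sum>i\<in>I. w i)" for w :: "'i \<Rightarrow> real"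
      by (rule sum.reindex_bij_betw[OF h])
    have "disjoint_family_on (\<lambda>i. {x (h i)<..<y (h i)}) {..<card I}"
      unfolding disjoint_family_on_def
    proof (intro ballI impI)
      fix i j assume ij: "i \<in> {..<card I}" "j \<in> {..<card I}" "i \<noteq> j"
      then have "h i \<noteq> h j" using h by (auto simp: bij_betw_def inj_on_def)
      then show "{x (h i)<..<y (h i)} \<inter> {x (h j)<..<y (h j)} = {}"
        using I(3) hI ij unfolding disjoint_family_on_def by blast
    qed
    then have "(\<Sum>i<card I. \<bar>f (y (h i)) - f (x (h i))\<bar>) < \<epsilon>"
      using I(2,4) hI sum_h[of "\<lambda>i. y i - x i"] by (intro D) auto
    then show ?thesis using sum_h[of "\<lambda>i. \<bar>f (y i) - f (x i)\<bar>"] by simp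
  qed
  with \<delta> show ?thesis by (rule that)
qed

section \<open>The variation of an absolutely continuous function\<close>

definition interval_family :: "real \<Rightarrow> real \<Rightarrow> nat \<Rightarrow> (nat \<Rightarrow> real) \<Rightarrow> (nat \<Rightarrow> real) \<Rightarrow> bool" where
  "interval_family a b n x y \<longleftrightarrow> (\<forall>i<n. a \<le> x i \<and> x i \<le> y i \<and> y i \<le> b) \<and>
     disjoint_family_on (\<lambda>i. {x i<..<y i}) {..<n}"

definition variation_sums :: "(real \<Rightarrow> real) \<Rightarrow> real \<Rightarrow> real \<Rightarrow> real set" where
  "variation_sums f a b = {(\<Sum>i<n. \<bar>f (y i) - f (x i)\<bar>) |n x y. interval_family a b n x y}"

definition variation :: "(real \<Rightarrow> real) \<Rightarrow> real \<Rightarrow> real \<Rightarrow> real" where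
  "variation f a b = Sup (variation_sums f a b)"

lemma fmeasurable_lborel_intervals:
  "{x<..<y::real} \<in> fmeasurable lborel" "{x..y::real} \<in> fmeasurable lborel"
  by (cases "x \<le> y"; auto simp: fmeasurable_def less_top[symmetric])+

lemma total_length_le:
  fixes x y :: "'i \<Rightarrow> real"
  assumes "finite I" "\<And>i. i \<in> I \<Longrightarrow> x i \<le> y i \<and> {x i<..<y i} \<subseteq> S"
    "disjoint_family_on (\<lambda>i. {x i<..<y i}) I" "S \<in> fmeasurable lborel"
  shows "(\<Sum>i\<in>I. y i - x i) \<le> measure lborel S"
proof -
  have "(\<Sum>i\<in>I. y i - x i) = (\<Sum>i\<in>I. measure lborel {x i<..<y i})"
    using assms(2) by (intro sum.cong) auto
  also have "\<dots> = measure lborel (\<Union>i\<in>I. {x i<..<y i})"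
    using assms(1,3) by (intro measure_UNION'[symmetric])
      (simp_all add: disjoint_family_on_def pairwise_def disjnt_def fmeasurable_lborel_intervals)
  also have "\<dots> \<le> measure lborel S"
    using assms by (intro measure_mono_fmeasurable) (auto intro!: borel_open)
  finally show ?thesis .
qed

lemma interval_family_length:
  assumes "interval_family a b n x y" "a \<le> b"
  shows "(\<Sum>i<n. y i - x i) \<le> b - a"
proof -
  have "(\<Sum>i<n. y i - x i) \<le> measure lborel {a..b}"
  proof (rule total_length_le)
    show "x i \<le> y i \<and> {x i<..<y i} \<subseteq> {a..b}" if "i \<in> {..<n}" for i
      using assms(1) that by (force simp: interval_family_def)
    show "disjoint_family_on (\<lambda>i. {x i<..<y i}) {..<n}"
      using assms(1) by (simp add: interval_family_def)
  qed (simp_all add: fmeasurable_lborel_intervals)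
  then show ?thesis using assms(2) by simp
qed

text \<open>Clipping with \<open>min\<close> and \<open>max\<close> keeps the index set. Intervals
  on the wrong side of \<open>c\<close> collapse to points, which is why
  \<open>interval_family\<close> admits \<open>x i = y i\<close>.\<close>

lemma interval_family_split:
  assumes "interval_family a b n x y" and "a \<le> c" "c \<le> b"
  shows "interval_family a c n (\<lambda>i. min (x i) c) (\<lambda>i. min (y i) c)"
    and "interval_family c b n (\<lambda>i. max (x i) c) (\<lambda>i. max (y i) c)"
proof -
  have fam: "a \<le> x i" "x i \<le> y i" "y i \<le> b" if "i < n" for i
    using assms(1) that by (auto simp: interval_family_def)
  have disj: "disjoint_family_on (\<lambda>i. {x i<..<y i}) {..<n}"
    using assms(1) by (simp add: interval_family_def)
  have "disjoint_family_on (\<lambda>i. {min (x i) c<..<min (y i) c}) {..<n}"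
    by (rule disjoint_family_on_bisimulation[OF disj]) (fastforce simp: disjoint_iff)
  then show "interval_family a c n (\<lambda>i. min (x i) c) (\<lambda>i. min (y i) c)"
    using fam assms(2,3) by (simp add: interval_family_def min.coboundedI1 min.mono)
  have "disjoint_family_on (\<lambda>i. {max (x i) c<..<max (y i) c}) {..<n}"
    by (rule disjoint_family_on_bisimulation[OF disj]) (fastforce simp: disjoint_iff)
  then show "interval_family c b n (\<lambda>i. max (x i) c) (\<lambda>i. max (y i) c)"
    using fam assms(2,3) by (simp add: interval_family_def max.coboundedI1 max.mono)
qed

lemma sum_split_le:
  fixes f :: "real \<Rightarrow> real"
  assumes "interval_family a b n x y"
  shows "(\<Sum>i<n. \<bar>f (y i) - f (x i)\<bar>) \<le>
    (\<Sum>i<n. \<bar>f (min (y i) c) - f (min (x i) c)\<bar>) + (\<Sum>i<n. \<bar>f (max (y i) c) - f (max (x i) c)\<bar>)"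
  unfolding sum.distrib[symmetric]
  using assms by (intro sum_mono) (auto simp: interval_family_def min_def max_def)

text \<open>With \<delta> belonging to the bound 1, each of \<open>N\<close> pieces shorter than
  \<delta> contributes less than 1 to any variation sum. The induction splits off the last
  piece.\<close>

lemma bounded_variation_of_absolutely_continuous:
  assumes ac: "absolutely_continuous_on_interval 0 T f" and "T > 0"
  shows "\<exists>B. \<forall>n x y. interval_family 0 T n x y \<longrightarrow> (\<Sum>i<n. \<bar>f (y i) - f (x i)\<bar>) \<le> B"
proof -
  obtain \<delta> where \<delta>: "\<delta> > 0" "\<And>(I::nat set) x y. \<lbrakk>finite I; \<And>i. i \<in> I \<Longrightarrow> 0 \<le> x i \<and> x i \<le> y i \<and> y i \<le> T;
        disjoint_family_on (\<lambda>i. {x i<..<y i}) I; (\<Sum>i\<in>I. y i - x i) < \<delta>\<rbrakk>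
      \<Longrightarrow> (\<Sum>i\<in>I. \<bar>f (y i) - f (x i)\<bar>) < 1"
    by (rule absolutely_continuous_on_interval_finite[OF ac zero_less_one]) (rule that, assumption, blast)
  obtain N :: nat where N: "T / \<delta> < real N" using reals_Archimedean2 by blast
  define h where "h = T / real N"
  have N0: "N > 0" using N \<delta> \<open>T > 0\<close> by (cases N) (auto simp: divide_less_0_iff)
  have h: "0 < h" "h < \<delta>" "real N * h = T"
    using N N0 \<delta> \<open>T > 0\<close> by (auto simp: h_def field_simps)
  have "(\<Sum>i<n. \<bar>f (y i) - f (x i)\<bar>) \<le> real m" if "m \<le> N" "interval_family 0 (real m * h) n x y" for m n x y
    using that
  proof (induction m arbitrary: n x y)
    case 0
    then have "\<bar>f (y i) - f (x i)\<bar> = 0" if "i < n" for i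
    proof -
      have "0 \<le> x i" "x i \<le> y i" "y i \<le> 0" using 0 that by (auto simp: interval_family_def)
      then have "x i = y i" by linarith
      then show ?thesis by simp
    qed
    then show ?case by simp
  next
    case (Suc m)
    let ?c = "real m * h"
    have c: "0 \<le> ?c" "?c \<le> real (Suc m) * h" using h by (auto simp: algebra_simps)
    note split = interval_family_split[OF Suc.prems(2) c]
    have le: "real (Suc m) * h \<le> T" using Suc.prems(1) h by (metis mult_right_mono less_imp_le of_nat_le_iff)
    have "(\<Sum>i<n. max (y i) ?c - max (x i) ?c) \<le> h"
      using interval_family_length[OF split(2) c(2)] by (simp add: algebra_simps)
    then have "(\<Sum>i<n. \<bar>f (max (y i) ?c) - f (max (x i) ?c)\<bar>) < 1"
    proof (intro \<delta>(2))
      fix i assume "i \<in> {..<n}"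
      then have "?c \<le> max (x i) ?c" "max (x i) ?c \<le> max (y i) ?c" "max (y i) ?c \<le> real (Suc m) * h"
        using split(2) by (auto simp: interval_family_def)
      then show "0 \<le> max (x i) ?c \<and> max (x i) ?c \<le> max (y i) ?c \<and> max (y i) ?c \<le> T"
        using c le by linarith
    qed (use split(2) h in \<open>auto simp: interval_family_def\<close>)
    moreover have "(\<Sum>i<n. \<bar>f (min (y i) ?c) - f (min (x i) ?c)\<bar>) \<le> real m"
      using Suc.IH[OF _ split(1)] Suc.prems(1) by simp
    ultimately show ?case using sum_split_le[OF Suc.prems(2), of f ?c] by simp
  qed
  from this[OF order_refl] show ?thesis using h(3) by auto
qed

text \<open>The clamping extends the variation on \<open>{0..T}\<close> to a monotone function on
  the whole line, as needed for a Lebesgue-Stieltjes measure; no mass lies outside.\<close>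

definition cumulative_variation :: "(real \<Rightarrow> real) \<Rightarrow> real \<Rightarrow> real \<Rightarrow> real" where
  "cumulative_variation f T t = variation f 0 (max 0 (min T t))"

context
  fixes f :: "real \<Rightarrow> real" and T :: real
  assumes ac: "absolutely_continuous_on_interval 0 T f" and T: "T > 0"
begin

lemma bdd_variation_sums:
  assumes "0 \<le> a" "b \<le> T"
  shows "bdd_above (variation_sums f a b)"
proof -
  obtain B where B: "\<And>n x y. interval_family 0 T n x y \<Longrightarrow> (\<Sum>i<n. \<bar>f (y i) - f (x i)\<bar>) \<le> B"
    using bounded_variation_of_absolutely_continuous[OF ac T] by blast
  have "interval_family 0 T n x y" if "interval_family a b n x y" for n x y
    using that assms by (force simp: interval_family_def)
  then show ?thesis by (intro bdd_aboveI[of _ B]) (auto simp: variation_sums_def intro: B)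
qed

lemma variation_sums_nonempty: "variation_sums f a b \<noteq> {}"
  unfolding variation_sums_def interval_family_def
  by (auto simp: disjoint_family_on_def intro!: exI[of _ 0])

lemma le_variation:
  assumes "0 \<le> a" "b \<le> T" "interval_family a b n x y"
  shows "(\<Sum>i<n. \<bar>f (y i) - f (x i)\<bar>) \<le> variation f a b"
  unfolding variation_def using assms
  by (intro cSup_upper bdd_variation_sums) (auto simp: variation_sums_def)

lemma variation_le:
  assumes "\<And>n x y. interval_family a b n x y \<Longrightarrow> (\<Sum>i<n. \<bar>f (y i) - f (x i)\<bar>) \<le> B"
  shows "variation f a b \<le> B"
  unfolding variation_def using assms
  by (intro cSup_least variation_sums_nonempty) (auto simp: variation_sums_def)

lemma variation_subadditive:
  assumes "0 \<le> u" "u \<le> t" "t \<le> T"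
  shows "variation f 0 t \<le> variation f 0 u + variation f u t"
proof (rule variation_le)
  fix n x y assume fam: "interval_family 0 t n x y"
  note split = interval_family_split[OF fam assms(1,2)]
  show "(\<Sum>i<n. \<bar>f (y i) - f (x i)\<bar>) \<le> variation f 0 u + variation f u t"
    using sum_split_le[OF fam, of f u] le_variation[OF _ _ split(1)] le_variation[OF _ _ split(2)] assms
    by simp
qed

text \<open>The interval from \<open>u\<close> to \<open>t\<close> can be appended to every family
  in \<open>{0..u}\<close>, adding \<open>\<bar>f t - f u\<bar>\<close> to its sum.\<close>

lemma variation_increment:
  assumes "0 \<le> u" "u \<le> t" "t \<le> T"
  shows "\<bar>f t - f u\<bar> \<le> variation f 0 t - variation f 0 u"
proof -
  have "variation f 0 u \<le> variation f 0 t - \<bar>f t - f u\<bar>"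
  proof (rule variation_le)
    fix n x y assume fam: "interval_family 0 u n x y"
    have "interval_family 0 t (Suc n) (x(n := u)) (y(n := t))"
      unfolding interval_family_def
    proof (intro conjI allI impI)
      fix i assume "i < Suc n"
      then show "0 \<le> (x(n := u)) i" "(x(n := u)) i \<le> (y(n := t)) i" "(y(n := t)) i \<le> t"
        using fam assms by (auto simp: interval_family_def less_Suc_eq)
    next
      have "y i \<le> u" if "i < n" for i
        using fam that unfolding interval_family_def by blast
      then have 1: "{u<..<t} \<inter> {x i<..<y i} = {}" if "i < n" for i
        using that by fastforce
      have 2: "{x i<..<y i} \<inter> {x j<..<y j} = {}" if "i < n" "j < n" "i \<noteq> j" for i j
        using fam that unfolding interval_family_def disjoint_family_on_def by blast
      show "disjoint_family_on (\<lambda>i. {(x(n := u)) i<..<(y(n := t)) i}) {..<Suc n}"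
        unfolding disjoint_family_on_def
      proof (intro ballI impI)
        fix i j assume "i \<in> {..<Suc n}" "j \<in> {..<Suc n}" "i \<noteq> j"
        then consider "i < n" "j < n" | "i = n" "j < n" | "i < n" "j = n" by fastforce
        then show "{(x(n := u)) i<..<(y(n := t)) i} \<inter> {(x(n := u)) j<..<(y(n := t)) j} = {}"
          by cases (use 1 2 \<open>i \<noteq> j\<close> Int_commute in \<open>metis fun_upd_same fun_upd_other less_irrefl\<close>)+
      qed
    qed
    from le_variation[OF _ _ this] assms
    show "(\<Sum>i<n. \<bar>f (y i) - f (x i)\<bar>) \<le> variation f 0 t - \<bar>f t - f u\<bar>" by simp
  qed
  then show ?thesis by simp
qed

text \<open>Each increment of the variation is nearly attained by a family inside
  \<open>{x i..y i}\<close>. Merging these families over \<open>I\<close> does not increase the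
  total length, so absolute continuity of \<open>f\<close> applies to the merged one.\<close>

lemma variation_absolutely_continuous:
  assumes "\<epsilon> > 0"
  obtains \<delta> where "\<delta> > 0"
    "\<And>(I::int set) x y. \<lbrakk>finite I; \<And>i. i \<in> I \<Longrightarrow> 0 \<le> x i \<and> x i \<le> y i \<and> y i \<le> T;
        disjoint_family_on (\<lambda>i. {x i<..<y i}) I; (\<Sum>i\<in>I. y i - x i) < \<delta>\<rbrakk>
      \<Longrightarrow> (\<Sum>i\<in>I. variation f 0 (y i) - variation f 0 (x i)) \<le> \<epsilon>"
proof -
  obtain \<delta> where \<delta>: "\<delta> > 0" "\<And>(I::(int \<times> nat) set) x y. \<lbrakk>finite I; \<And>i. i \<in> I \<Longrightarrow> 0 \<le> x i \<and> x i \<le> y i \<and> y i \<le> T;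
        disjoint_family_on (\<lambda>i. {x i<..<y i}) I; (\<Sum>i\<in>I. y i - x i) < \<delta>\<rbrakk>
      \<Longrightarrow> (\<Sum>i\<in>I. \<bar>f (y i) - f (x i)\<bar>) < \<epsilon> / 2"
    by (rule absolutely_continuous_on_interval_finite[OF ac half_gt_zero[OF assms]])
       (rule that, assumption, blast)
  have "(\<Sum>i\<in>I. variation f 0 (y i) - variation f 0 (x i)) \<le> \<epsilon>"
    if I: "finite I" and xy: "\<And>i. i \<in> I \<Longrightarrow> 0 \<le> x i \<and> x i \<le> y i \<and> y i \<le> T"
      and disj: "disjoint_family_on (\<lambda>i. {x i<..<y i}) I" and len: "(\<Sum>i\<in>I. y i - x i) < \<delta>"
    for I :: "int set" and x y
  proof -
    \<comment> \<open>The errors over all of \<open>I\<close> add up to at most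
      \<open>\<epsilon> / 2\<close>; the summand 1 covers an empty \<open>I\<close>.\<close>
    define \<eta> where "\<eta> = \<epsilon> / (2 * (real (card I) + 1))"
    have \<eta>: "\<eta> > 0" "real (card I) * \<eta> \<le> \<epsilon> / 2"
      using assms by (auto simp: \<eta>_def field_simps)
    have "\<exists>n X Y. interval_family (x i) (y i) n X Y \<and>
        variation f (x i) (y i) - \<eta> < (\<Sum>j<n. \<bar>f (Y j) - f (X j)\<bar>)" for i
    proof -
      have "\<exists>s\<in>variation_sums f (x i) (y i). variation f (x i) (y i) - \<eta> < s"
        unfolding variation_def
        by (rule less_cSupD[OF variation_sums_nonempty]) (use \<eta> in simp)
      then show ?thesis by (auto simp: variation_sums_def)
    qed
    then obtain n X Y where fam: "\<And>i. interval_family (x i) (y i) (n i) (X i) (Y i)"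
      and near: "\<And>i. variation f (x i) (y i) - \<eta> < (\<Sum>j<n i. \<bar>f (Y i j) - f (X i j)\<bar>)"
      by metis
    have famD: "x i \<le> X i j" "X i j \<le> Y i j" "Y i j \<le> y i" if "j < n i" for i j
      using fam[of i] that by (auto simp: interval_family_def)
    define J where "J = (SIGMA i:I. {..<n i})"
    have sumJ: "(\<Sum>p\<in>J. w (fst p) (snd p)) = (\<Sum>i\<in>I. \<Sum>j<n i. w i j)" for w :: "int \<Rightarrow> nat \<Rightarrow> real"
      unfolding J_def using I by (subst sum.Sigma) (auto simp: case_prod_beta)
    have "(\<Sum>p\<in>J. \<bar>f (Y (fst p) (snd p)) - f (X (fst p) (snd p))\<bar>) < \<epsilon> / 2"
    proof (rule \<delta>(2))
      show "finite J" using I by (auto simp: J_def)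
      show "0 \<le> X (fst p) (snd p) \<and> X (fst p) (snd p) \<le> Y (fst p) (snd p) \<and> Y (fst p) (snd p) \<le> T"
        if "p \<in> J" for p
      proof -
        have "fst p \<in> I" "snd p < n (fst p)" using that by (auto simp: J_def)
        then show ?thesis using xy[of "fst p"] famD[of "snd p" "fst p"] by linarith
      qed
      show "disjoint_family_on (\<lambda>p. {X (fst p) (snd p)<..<Y (fst p) (snd p)}) J"
        unfolding disjoint_family_on_def
      proof (intro ballI impI)
        fix p q assume pq: "p \<in> J" "q \<in> J" "p \<noteq> q"
        obtain i j k l where [simp]: "p = (i, j)" "q = (k, l)" by fastforce
        have in': "i \<in> I" "k \<in> I" "j < n i" "l < n k" using pq by (auto simp: J_def)
        have "{X i j<..<Y i j} \<inter> {X k l<..<Y k l} = {}"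
        proof (cases "i = k")
          case True
          then have "j \<noteq> l" using pq by simp
          then show ?thesis using fam[of i] in' True
            unfolding interval_family_def disjoint_family_on_def by blast
        next
          case False
          have "{x i<..<y i} \<inter> {x k<..<y k} = {}"
            using disj in' False unfolding disjoint_family_on_def by blast
          moreover have "{X i j<..<Y i j} \<subseteq> {x i<..<y i}" "{X k l<..<Y k l} \<subseteq> {x k<..<y k}"
            using famD in' by (meson greaterThanLessThan_subseteq_greaterThanLessThan)+
          ultimately show ?thesis by blast
        qed
        then show "{X (fst p) (snd p)<..<Y (fst p) (snd p)} \<inter> {X (fst q) (snd q)<..<Y (fst q) (snd q)} = {}"
          by simp
      qed
      have "(\<Sum>i\<in>I. \<Sum>j<n i. Y i j - X i j) \<le> (\<Sum>i\<in>I. y i - x i)"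
        using interval_family_length[OF fam] xy by (intro sum_mono) blast
      then show "(\<Sum>p\<in>J. Y (fst p) (snd p) - X (fst p) (snd p)) < \<delta>"
        using len sumJ[of "\<lambda>i j. Y i j - X i j"] by simp
    qed
    then have small: "(\<Sum>i\<in>I. \<Sum>j<n i. \<bar>f (Y i j) - f (X i j)\<bar>) < \<epsilon> / 2"
      using sumJ[of "\<lambda>i j. \<bar>f (Y i j) - f (X i j)\<bar>"] by simp
    have "(\<Sum>i\<in>I. variation f 0 (y i) - variation f 0 (x i)) \<le>
        (\<Sum>i\<in>I. (\<Sum>j<n i. \<bar>f (Y i j) - f (X i j)\<bar>) + \<eta>)"
    proof (rule sum_mono)
      fix i assume "i \<in> I"
      then show "variation f 0 (y i) - variation f 0 (x i) \<le> (\<Sum>j<n i. \<bar>f (Y i j) - f (X i j)\<bar>) + \<eta>"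
        using variation_subadditive[of "x i" "y i"] xy[of i] near[of i] by linarith
    qed
    also have "\<dots> = (\<Sum>i\<in>I. \<Sum>j<n i. \<bar>f (Y i j) - f (X i j)\<bar>) + real (card I) * \<eta>"
      by (simp add: sum.distrib)
    finally show ?thesis using small \<eta> by linarith
  qed
  with \<delta>(1) show ?thesis by (rule that)
qed

lemma cumulative_variation_mono: "u \<le> t \<Longrightarrow> cumulative_variation f T u \<le> cumulative_variation f T t"
  using variation_increment[of "max 0 (min T u)" "max 0 (min T t)"] T
  by (auto simp: cumulative_variation_def max_def min_def split: if_splits)

lemma cumulative_variation_small:
  assumes "\<epsilon> > 0"
  obtains \<delta> where "\<delta> > 0"
    "\<And>(I::int set) x y. \<lbrakk>finite I; \<And>i. i \<in> I \<Longrightarrow> x i \<le> y i;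
        disjoint_family_on (\<lambda>i. {x i<..<y i}) I; (\<Sum>i\<in>I. y i - x i) < \<delta>\<rbrakk>
      \<Longrightarrow> (\<Sum>i\<in>I. cumulative_variation f T (y i) - cumulative_variation f T (x i)) \<le> \<epsilon>"
proof -
  let ?c = "\<lambda>t::real. max 0 (min T t)"
  obtain \<delta> where \<delta>: "\<delta> > 0" "\<And>(I::int set) x y. \<lbrakk>finite I; \<And>i. i \<in> I \<Longrightarrow> 0 \<le> x i \<and> x i \<le> y i \<and> y i \<le> T;
        disjoint_family_on (\<lambda>i. {x i<..<y i}) I; (\<Sum>i\<in>I. y i - x i) < \<delta>\<rbrakk>
      \<Longrightarrow> (\<Sum>i\<in>I. variation f 0 (y i) - variation f 0 (x i)) \<le> \<epsilon>"
    by (rule variation_absolutely_continuous[OF assms]) (rule that, assumption, blast)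
  have "(\<Sum>i\<in>I. cumulative_variation f T (y i) - cumulative_variation f T (x i)) \<le> \<epsilon>"
    if I: "finite I" and xy: "\<And>i. i \<in> I \<Longrightarrow> x i \<le> y i"
      and disj: "disjoint_family_on (\<lambda>i. {x i<..<y i}) I" and len: "(\<Sum>i\<in>I. y i - x i) < \<delta>"
    for I :: "int set" and x y
    unfolding cumulative_variation_def
  proof (rule \<delta>(2)[OF I])
    show "0 \<le> ?c (x i) \<and> ?c (x i) \<le> ?c (y i) \<and> ?c (y i) \<le> T" if "i \<in> I" for i
      using xy[OF that] T by linarith
    show "disjoint_family_on (\<lambda>i. {?c (x i)<..<?c (y i)}) I"
    proof (rule disjoint_family_on_bisimulation[OF disj])
      fix i j assume "{x i<..<y i} \<inter> {x j<..<y j} = {}"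
      moreover have "{?c a<..<?c b} \<subseteq> {a<..<b}" for a b by (auto simp: max_def min_def split: if_splits)
      ultimately show "{?c (x i)<..<?c (y i)} \<inter> {?c (x j)<..<?c (y j)} = {}" by blast
    qed
    have "(\<Sum>i\<in>I. ?c (y i) - ?c (x i)) \<le> (\<Sum>i\<in>I. y i - x i)"
    proof (rule sum_mono)
      fix i assume "i \<in> I"
      from xy[OF this] show "?c (y i) - ?c (x i) \<le> y i - x i" by linarith
    qed
    then show "(\<Sum>i\<in>I. ?c (y i) - ?c (x i)) < \<delta>" using len by linarith
  qed
  with \<delta>(1) show ?thesis by (rule that)
qed

lemma cumulative_variation_right_continuous: "continuous (at_right a) (cumulative_variation f T)"
  unfolding continuous_within
proof (rule tendstoI)
  fix e :: real assume "e > 0"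
  obtain \<delta> where \<delta>: "\<delta> > 0" "\<And>(I::int set) x y. \<lbrakk>finite I; \<And>i. i \<in> I \<Longrightarrow> x i \<le> y i;
        disjoint_family_on (\<lambda>i. {x i<..<y i}) I; (\<Sum>i\<in>I. y i - x i) < \<delta>\<rbrakk>
      \<Longrightarrow> (\<Sum>i\<in>I. cumulative_variation f T (y i) - cumulative_variation f T (x i)) \<le> e / 2"
    by (rule cumulative_variation_small[OF half_gt_zero[OF \<open>e > 0\<close>]]) (rule that, assumption, blast)
  have "dist (cumulative_variation f T t) (cumulative_variation f T a) < e" if "a < t" "t < a + \<delta>" for t
  proof -
    have "cumulative_variation f T t - cumulative_variation f T a \<le> e / 2"
      using \<delta>(2)[of "{0}" "\<lambda>_. a" "\<lambda>_. t"] that by (simp add: disjoint_family_on_def)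
    then show ?thesis using cumulative_variation_mono[of a t] that \<open>e > 0\<close> by (simp add: dist_real_def)
  qed
  then show "\<forall>\<^sub>F t in at_right a. dist (cumulative_variation f T t) (cumulative_variation f T a) < e"
    unfolding eventually_at_right_field using \<delta>(1) by (intro exI[of _ "a + \<delta>"]) auto
qed

end

section \<open>The Lebesgue-Stieltjes measure of the variation and its density\<close>

context
  fixes f :: "real \<Rightarrow> real" and T :: real
  assumes ac: "absolutely_continuous_on_interval 0 T f" and T: "T > 0"
begin

lemma variation_measure_Ioc: "u \<le> t \<Longrightarrow> emeasure (interval_measure (cumulative_variation f T)) {u<..t} = ennreal (cumulative_variation f T t - cumulative_variation f T u)"
  by (rule emeasure_interval_measure_Ioc[OF _ cumulative_variation_mono[OF ac T] cumulative_variation_right_continuous[OF ac T]])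

lemma variation_measure_finite: "emeasure (interval_measure (cumulative_variation f T)) UNIV \<noteq> \<infinity>"
proof -
  have "emeasure (interval_measure (cumulative_variation f T)) (\<Union>n. {- real n<..real n}) = (SUP n. emeasure (interval_measure (cumulative_variation f T)) {- real n<..real n})"
    by (rule SUP_emeasure_incseq[symmetric]) (auto simp: incseq_def)
  also have "\<dots> \<le> ennreal (cumulative_variation f T T - cumulative_variation f T 0)"
  proof (rule SUP_least)
    fix n :: nat
    have "cumulative_variation f T (real n) = cumulative_variation f T (min T (real n))"
      by (simp add: cumulative_variation_def)
    moreover have "cumulative_variation f T (- real n) = cumulative_variation f T 0"
      using T by (simp add: cumulative_variation_def)
    ultimately have "cumulative_variation f T (real n) \<le> cumulative_variation f T T"
        "cumulative_variation f T 0 \<le> cumulative_variation f T (- real n)"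
      using cumulative_variation_mono[OF ac T, of "min T (real n)" T] by simp_all
    then show "emeasure (interval_measure (cumulative_variation f T)) {- real n<..real n} \<le> ennreal (cumulative_variation f T T - cumulative_variation f T 0)"
      by (subst variation_measure_Ioc) (auto intro!: ennreal_leI)
  qed
  also have "(\<Union>n. {- real n<..real n}) = UNIV"
  proof (intro set_eqI iffI UNIV_I)
    fix x :: real
    obtain n :: nat where "\<bar>x\<bar> < real n" using reals_Archimedean2 by blast
    then show "x \<in> (\<Union>n. {- real n<..real n})" by (intro UN_I[of n]) auto
  qed
  finally show ?thesis by (auto simp: top_unique)
qed

text \<open>An open set of length below \<delta> around the compact set contains a uniform
  neighbourhood of it. Hence finitely many cells of one fine grid cover the set, with interiors
  inside the open set and so of total length below \<delta>.\<close>

lemma variation_measure_null_compact: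
  assumes K: "compact K" "emeasure lborel K = 0"
  shows "emeasure (interval_measure (cumulative_variation f T)) K = 0"
proof -
  have "emeasure (interval_measure (cumulative_variation f T)) K \<le> ennreal \<epsilon>" if eps: "\<epsilon> > 0" for \<epsilon>
  proof -
    obtain \<delta> where \<delta>: "\<delta> > 0" "\<And>(I::int set) x y. \<lbrakk>finite I; \<And>i. i \<in> I \<Longrightarrow> x i \<le> y i;
        disjoint_family_on (\<lambda>i. {x i<..<y i}) I; (\<Sum>i\<in>I. y i - x i) < \<delta>\<rbrakk>
      \<Longrightarrow> (\<Sum>i\<in>I. cumulative_variation f T (y i) - cumulative_variation f T (x i)) \<le> \<epsilon>"
      by (rule cumulative_variation_small[OF ac T eps]) (rule that, assumption, blast)
    have Kb: "K \<in> sets borel" using K(1) by (simp add: borel_compact)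
    then have "K \<in> sets lebesgue" by simp
    from sets_lebesgue_outer_open[OF this \<delta>(1)]
    obtain U where U: "open U" "K \<subseteq> U" "emeasure lebesgue (U - K) < ennreal \<delta>"
      by metis
    have "emeasure lborel U \<le> emeasure lborel (K \<union> (U - K))"
      using U Kb by (intro emeasure_mono) auto
    also have "\<dots> \<le> emeasure lborel K + emeasure lborel (U - K)"
      using U Kb by (intro emeasure_subadditive) auto
    also have "emeasure lborel (U - K) = emeasure lebesgue (U - K)"
      using sets.Diff[OF borel_open[OF U(1)] Kb] by simp
    finally have "emeasure lborel U \<le> emeasure lebesgue (U - K)" using K(2) by simp
    also note U(3)
    finally have eU: "emeasure lborel U < ennreal \<delta>" .
    then have fU: "U \<in> fmeasurable lborel"
      using U(1) less_trans[OF eU ennreal_less_top] by (simp add: fmeasurable_def borel_open)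
    have mU: "measure lborel U < \<delta>"
      using eU \<delta>(1) emeasure_eq_measure2[OF fU] by (simp add: ennreal_less_iff)
    obtain e where e: "e > 0" "(\<Union>x\<in>K. ball x e) \<subseteq> U"
      by (rule compact_subset_open_imp_ball_epsilon_subset[OF K(1) U(1,2)])
    define h where "h = e / 2"
    have h: "h > 0" "h < e" using e by (auto simp: h_def)
    define x where "x j = real_of_int j * h" for j
    define y where "y j = (real_of_int j + 1) * h" for j
    \<comment> \<open>Half-open cells tile the line and match the formula for the measure; the
      length estimate uses only their interiors.\<close>
    define J where "J = {j. {x j<..y j} \<inter> K \<noteq> {}}"
    have xy: "x j \<le> y j" for j using h by (simp add: x_def y_def algebra_simps)
    obtain B where B: "\<And>z. z \<in> K \<Longrightarrow> \<bar>z\<bar> \<le> B"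
      using compact_imp_bounded[OF K(1)] by (auto simp: bounded_iff)
    have "finite J"
    proof (rule finite_subset)
      show "J \<subseteq> {\<lfloor>- B / h\<rfloor> - 1..\<lceil>B / h\<rceil>}"
      proof
        fix j assume "j \<in> J"
        then obtain z where z: "z \<in> K" "x j < z" "z \<le> y j" by (auto simp: J_def)
        have "real_of_int j < B / h" using z B[OF z(1)] h by (simp add: x_def pos_less_divide_eq)
        moreover have "- B / h \<le> real_of_int j + 1"
          using z B[OF z(1)] by (subst pos_divide_le_eq[OF h(1)]) (auto simp: y_def)
        ultimately show "j \<in> {\<lfloor>- B / h\<rfloor> - 1..\<lceil>B / h\<rceil>}" by (simp; linarith)
      qed
    qed simp
    have cover: "K \<subseteq> (\<Union>j\<in>J. {x j<..y j})"
    proof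
      fix z assume z: "z \<in> K"
      define j where "j = \<lceil>z / h\<rceil> - 1"
      have "real_of_int j < z / h" "z / h \<le> real_of_int j + 1" unfolding j_def by linarith+
      then have "x j < z" "z \<le> y j"
        using h by (simp_all add: x_def y_def pos_less_divide_eq pos_divide_le_eq)
      then have "z \<in> {x j<..y j}" by simp
      moreover from this have "j \<in> J" using z unfolding J_def by blast
      ultimately show "z \<in> (\<Union>j\<in>J. {x j<..y j})" by blast
    qed
    have disj: "disjoint_family_on (\<lambda>j. {x j<..<y j}) J"
      unfolding disjoint_family_on_def
    proof (intro ballI impI)
      have *: "{x i<..<y i} \<inter> {x j<..<y j} = {}" if "i < j" for i j
      proof -
        have "real_of_int i + 1 \<le> real_of_int j" using that by linarith
        then have "y i \<le> x j" unfolding x_def y_def using h by (intro mult_right_mono) auto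
        then show ?thesis by (auto simp: disjoint_iff)
      qed
      fix i j :: int assume "i \<noteq> j"
      then show "{x i<..<y i} \<inter> {x j<..<y j} = {}"
        using *[of i j] *[of j i] by (metis Int_commute linorder_neqE)
    qed
    have "(\<Sum>j\<in>J. y j - x j) \<le> measure lborel U"
    proof (rule total_length_le[OF \<open>finite J\<close> _ disj fU])
      fix j assume "j \<in> J"
      then obtain z where z: "z \<in> K" "x j < z" "z \<le> y j" by (auto simp: J_def)
      have "{x j<..<y j} \<subseteq> ball z e"
        using z h by (auto simp: dist_real_def x_def y_def algebra_simps)
      then show "x j \<le> y j \<and> {x j<..<y j} \<subseteq> U" using z(1) e(2) xy by blast
    qed
    then have sum_le: "(\<Sum>j\<in>J. cumulative_variation f T (y j) - cumulative_variation f T (x j)) \<le> \<epsilon>"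
      using mU by (intro \<delta>(2)[OF \<open>finite J\<close> xy disj]) linarith
    have "emeasure (interval_measure (cumulative_variation f T)) K \<le> emeasure (interval_measure (cumulative_variation f T)) (\<Union>j\<in>J. {x j<..y j})"
      using cover \<open>finite J\<close> by (intro emeasure_mono) auto
    also have "\<dots> \<le> (\<Sum>j\<in>J. emeasure (interval_measure (cumulative_variation f T)) {x j<..y j})"
      using \<open>finite J\<close> by (intro emeasure_subadditive_finite) auto
    also have "\<dots> = (\<Sum>j\<in>J. ennreal (cumulative_variation f T (y j) - cumulative_variation f T (x j)))"
      using xy by (intro sum.cong variation_measure_Ioc) auto
    also have "\<dots> = ennreal (\<Sum>j\<in>J. cumulative_variation f T (y j) - cumulative_variation f T (x j))"
      using cumulative_variation_mono[OF ac T xy] by (intro sum_ennreal) auto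
    also have "\<dots> \<le> ennreal \<epsilon>" using sum_le by (rule ennreal_leI)
    finally show ?thesis .
  qed
  then have "emeasure (interval_measure (cumulative_variation f T)) K \<le> 0"
    by (intro ennreal_le_epsilon[of "0::ennreal"]) (simp add: zero_less_one)
  then show ?thesis by simp
qed

text \<open>The measure is finite, so inner regularity reduces a null set to its compact
  subsets.\<close>

lemma absolutely_continuous_variation_measure: "absolutely_continuous lborel (interval_measure (cumulative_variation f T))"
  unfolding absolutely_continuous_def
proof
  fix N :: "real set" assume "N \<in> null_sets lborel"
  then have N: "N \<in> sets borel" "emeasure lborel N = 0" by auto
  have "emeasure (interval_measure (cumulative_variation f T)) N = (SUP K\<in>{K. K \<subseteq> N \<and> compact K}. emeasure (interval_measure (cumulative_variation f T)) K)"
    using variation_measure_finite N by (intro inner_regular) auto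
  also have "\<dots> \<le> 0"
  proof (rule SUP_least)
    fix K :: "real set" assume "K \<in> {K. K \<subseteq> N \<and> compact K}"
    then have K: "K \<subseteq> N" "compact K" by auto
    have "emeasure lborel K \<le> emeasure lborel N" using K N by (intro emeasure_mono) auto
    then show "emeasure (interval_measure (cumulative_variation f T)) K \<le> 0"
      using variation_measure_null_compact[OF K(2)] N by simp
  qed
  finally show "N \<in> null_sets (interval_measure (cumulative_variation f T))" using N by (intro null_setsI) auto
qed

text \<open>The majorant is the Radon-Nikodym density of the variation measure. It is finite almost
  everywhere, so \<open>enn2real\<close> changes it on a null set only.\<close>

lemma absolutely_continuous_majorant:
  obtains k where "k \<in> borel_measurable borel" "\<And>\<xi>. 0 \<le> k \<xi>" "integrable lborel k"
    "\<And>u t. 0 \<le> u \<Longrightarrow> u \<le> t \<Longrightarrow> t \<le> T \<Longrightarrow> \<bar>f t - f u\<bar> \<le> (LINT \<xi>:{u..t}|lborel. k \<xi>)"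
proof -
  obtain g where g[measurable]: "g \<in> borel_measurable lborel" and dens: "density lborel g = interval_measure (cumulative_variation f T)"
    using sigma_finite_measure.Radon_Nikodym[OF sigma_finite_lborel absolutely_continuous_variation_measure] by auto
  have nn: "emeasure (interval_measure (cumulative_variation f T)) A = (\<integral>\<^sup>+x. g x * indicator A x \<partial>lborel)" if "A \<in> sets borel" for A
    unfolding dens[symmetric] using that by (simp add: emeasure_density)
  have fin: "(\<integral>\<^sup>+x. g x \<partial>lborel) < \<infinity>"
    using nn[of UNIV] variation_measure_finite by (simp add: less_top)
  have gfin: "AE x in lborel. g x \<noteq> \<infinity>"
    by (rule nn_integral_noteq_infinite) (use fin in auto)
  define k where "k x = enn2real (g x)" for x
  have k[measurable]: "k \<in> borel_measurable borel" using g by (simp add: k_def[abs_def])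
  have k0: "0 \<le> k x" for x by (simp add: k_def)
  have kg: "AE x in lborel. ennreal (k x) = g x"
    using gfin by eventually_elim (simp add: k_def less_top)
  have "(\<integral>\<^sup>+x. ennreal (k x) \<partial>lborel) = (\<integral>\<^sup>+x. g x \<partial>lborel)" by (rule nn_integral_cong_AE[OF kg])
  then have ik: "integrable lborel k"
    using fin k0 by (intro integrableI_nonneg) auto
  have "\<bar>f t - f u\<bar> \<le> (LINT \<xi>:{u..t}|lborel. k \<xi>)" if ut: "0 \<le> u" "u \<le> t" "t \<le> T" for u t
  proof -
    have "\<bar>f t - f u\<bar> \<le> cumulative_variation f T t - cumulative_variation f T u"
      using variation_increment[OF ac T ut] ut by (simp add: cumulative_variation_def)
    then have "ennreal \<bar>f t - f u\<bar> \<le> ennreal (cumulative_variation f T t - cumulative_variation f T u)" by (rule ennreal_leI)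
    also have "\<dots> = (\<integral>\<^sup>+x. g x * indicator {u<..t} x \<partial>lborel)"
      using variation_measure_Ioc[OF ut(2)] nn[of "{u<..t}"] by simp
    also have "\<dots> \<le> (\<integral>\<^sup>+x. ennreal (indicator {u..t} x *\<^sub>R k x) \<partial>lborel)"
      by (rule nn_integral_mono_AE) (use kg in eventually_elim, auto simp: indicator_def)
    also have "\<dots> = ennreal (LINT \<xi>:{u..t}|lborel. k \<xi>)"
      unfolding set_lebesgue_integral_def
      using ik k0 by (intro nn_integral_eq_integral integrable_mult_indicator) auto
    finally show ?thesis
      by (subst (asm) ennreal_le_iff) (auto simp: set_lebesgue_integral_def k0 intro!: integral_nonneg)
  qed
  then show ?thesis using that[OF k k0 ik] by blast
qed

end

section \<open>Evolution families with prescribed spectral function\<close>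

lemma half_of_sector:
  assumes \<sigma>: "norm \<sigma> = 1" and z: "z \<in> stolz_region \<sigma> M" and M: "M > 0"
  shows "cmod (half_of \<sigma> z) \<le> 2 * M * Re (half_of \<sigma> z)"
proof -
  have zb: "norm z < 1" and d: "cmod (\<sigma> - z) < M * (1 - norm z)"
    using z by (auto simp: stolz_region_def dist_norm norm_minus_commute)
  define r where "r = cmod (\<sigma> - z)"
  have r: "r > 0" using zb \<sigma> by (auto simp: r_def)
  have "(norm z)\<^sup>2 \<le> norm z" using zb by (simp add: power2_eq_square mult_left_le)
  then have "M * (1 - norm z) \<le> M * (1 - (norm z)\<^sup>2)" using M by (intro mult_left_mono) auto
  then have rM: "r \<le> M * (1 - (norm z)\<^sup>2)" using d by (simp add: r_def)
  \<comment> \<open>Source of the factor 2 in the aperture of the sector; the rest is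
    \<open>1 - norm z \<le> 1 - (norm z)\<^sup>2\<close> and the formula for the real part.\<close>
  have "cmod (\<sigma> + z) \<le> 2" using norm_triangle_ineq[of \<sigma> z] zb \<sigma> by simp
  then have "cmod (half_of \<sigma> z) \<le> 2 / r"
    using r by (simp add: half_of_def norm_divide r_def divide_right_mono)
  also have "\<dots> = 2 * r / r\<^sup>2" using r by (simp add: power2_eq_square)
  also have "\<dots> \<le> 2 * (M * (1 - (norm z)\<^sup>2)) / r\<^sup>2" using rM by (intro divide_right_mono) auto
  also have "\<dots> = 2 * M * Re (half_of \<sigma> z)" using \<sigma> by (simp add: Re_half_of r_def)
  finally show ?thesis .
qed

lemma disc_of_minus:
  assumes "w \<in> halfplane"
  shows "disc_of \<sigma> w - \<sigma> = - (2 * \<sigma>) / (w + 1)"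
  using halfplane_add_one[OF assms] by (simp add: disc_of_def field_simps)

lemma disc_of_quotient:
  assumes "norm \<sigma> = 1" "v \<in> halfplane" "w \<in> halfplane"
  shows "(disc_of \<sigma> v - \<sigma>) / (disc_of \<sigma> w - \<sigma>) = (w + 1) / (v + 1)"
proof -
  have "\<sigma> \<noteq> 0" using assms(1) by auto
  then show ?thesis
    using halfplane_add_one assms(2,3) by (simp add: disc_of_minus divide_simps)
qed

text \<open>With \<open>w = half_of \<sigma> z\<close> the difference quotient is
  \<open>(w + 1) / (G w + 1)\<close>, the reciprocal of \<open>G w / w\<close> up to terms in
  \<open>inverse w\<close>; Stolz regions correspond to sectors in \<open>w\<close>.\<close>

lemma angular_derivative_of_halfplane_map:
  assumes \<sigma>: "norm \<sigma> = 1" and G: "G holomorphic_on halfplane" "G ` halfplane \<subseteq> halfplane" "0 < slope G"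
    and f: "\<And>z. z \<in> ball 0 1 \<Longrightarrow> f z = disc_of \<sigma> (G (half_of \<sigma> z))"
  shows "has_angular_derivative f \<sigma> (of_real (1 / slope G))" "has_angular_limit f \<sigma> \<sigma>"
proof -
  define c where "c = slope G"
  have der: "((\<lambda>z. (f z - \<sigma>) / (z - \<sigma>)) \<longlongrightarrow> of_real (1 / c)) (at \<sigma> within stolz_region \<sigma> M)" if "M > 1" for M
  proof -
    let ?F = "at \<sigma> within stolz_region \<sigma> M"
    have ev: "\<forall>\<^sub>F z in ?F. z \<in> stolz_region \<sigma> M" by (simp add: eventually_at_filter)
    have inb: "z \<in> ball 0 1" if "z \<in> stolz_region \<sigma> M" for z
      using that by (simp add: stolz_region_def)
    have ne: "\<forall>\<^sub>F z in ?F. z \<noteq> \<sigma>" by (simp add: eventually_at_filter)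
    have inf: "filterlim (\<lambda>z. half_of \<sigma> z) at_infinity ?F"
      by (rule filterlim_half_of_at_infinity[OF \<sigma> tendsto_ident_at ne])
    have sector: "\<forall>\<^sub>F z in ?F. half_of \<sigma> z \<in> halfplane \<and>
        cmod (half_of \<sigma> z) \<le> 2 * M * Re (half_of \<sigma> z)"
      using ev by eventually_elim
        (use half_of_sector[OF \<sigma>] half_of_in_halfplane[OF \<sigma>] inb \<open>M > 1\<close> in auto)
    have G0: "0 \<le> Re (G z)" if "z \<in> halfplane" for z
      using G(2) that by (auto simp: halfplane_def less_imp_le)
    have lim: "((\<lambda>z. G (half_of \<sigma> z) / half_of \<sigma> z) \<longlongrightarrow> of_real c) ?F"
      unfolding c_def by (rule Julia_Wolff_Caratheodory[OF G(1) G0 inf sector])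
    have i: "((\<lambda>z. inverse (half_of \<sigma> z)) \<longlongrightarrow> 0) ?F"
      by (rule filterlim_compose[OF tendsto_inverse_0 inf])
    have "((\<lambda>z. (1 + inverse (half_of \<sigma> z)) / (G (half_of \<sigma> z) / half_of \<sigma> z + inverse (half_of \<sigma> z)))
        \<longlongrightarrow> (1 + 0) / (of_real c + 0)) ?F"
      using G(3) by (intro tendsto_intros lim i) (auto simp: c_def)
    moreover have "\<forall>\<^sub>F z in ?F. (1 + inverse (half_of \<sigma> z)) / (G (half_of \<sigma> z) / half_of \<sigma> z + inverse (half_of \<sigma> z))
        = (f z - \<sigma>) / (z - \<sigma>)"
      using ev
    proof eventually_elim
      case (elim z)
      define w where "w = half_of \<sigma> z"
      have w: "w \<in> halfplane" unfolding w_def by (rule half_of_in_halfplane[OF \<sigma> inb[OF elim]])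
      then have w0: "w \<noteq> 0" by (auto simp: halfplane_def)
      have Gw: "G w \<in> halfplane" using G(2) w by blast
      have "(f z - \<sigma>) / (z - \<sigma>) = (w + 1) / (G w + 1)"
        using disc_of_quotient[OF \<sigma> Gw w] f[OF inb[OF elim]] disc_of_half_of[OF \<sigma> inb[OF elim]]
        by (simp add: w_def)
      also have "\<dots> = ((w + 1) / w) / ((G w + 1) / w)" using w0 by simp
      also have "\<dots> = (1 + inverse w) / (G w / w + inverse w)"
        using w0 by (simp add: add_divide_distrib inverse_eq_divide)
      finally show ?case by (simp add: w_def)
    qed
    ultimately show ?thesis by (simp add: tendsto_cong divide_inverse)
  qed
  then show "has_angular_derivative f \<sigma> (of_real (1 / slope G))"
    by (simp add: has_angular_derivative_def has_angular_limit_def c_def)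
  show "has_angular_limit f \<sigma> \<sigma>"
    unfolding has_angular_limit_def
  proof (intro allI impI)
    fix M :: real assume M: "M > 1"
    let ?F = "at \<sigma> within stolz_region \<sigma> M"
    have "((\<lambda>z. (f z - \<sigma>) / (z - \<sigma>) * (z - \<sigma>) + \<sigma>) \<longlongrightarrow> of_real (1 / c) * (\<sigma> - \<sigma>) + \<sigma>) ?F"
      by (intro tendsto_intros der M)
    moreover have "\<forall>\<^sub>F z in ?F. (f z - \<sigma>) / (z - \<sigma>) * (z - \<sigma>) + \<sigma> = f z"
      by (simp add: eventually_at_filter)
    ultimately show "(f \<longlongrightarrow> \<sigma>) ?F" by (auto elim: Lim_transform_eventually)
  qed
qed

text \<open>The limit of \<open>G w / w\<close> along the positive reals exists even for slope 0,
  and there its product with the difference quotient tends to 1. So \<open>D * slope G = 1\<close>,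
  which excludes slope 0. The points \<open>z n\<close> approach \<sigma> radially, hence within the
  Stolz region of parameter 2.\<close>

lemma slope_of_angular_derivative:
  assumes \<sigma>: "norm \<sigma> = 1" and G: "G holomorphic_on halfplane" "G ` halfplane \<subseteq> halfplane"
    and f: "\<And>z. z \<in> ball 0 1 \<Longrightarrow> f z = disc_of \<sigma> (G (half_of \<sigma> z))"
    and D: "has_angular_derivative f \<sigma> D"
  shows "0 < slope G" "D = of_real (1 / slope G)"
proof -
  define w :: "nat \<Rightarrow> complex" where "w n = of_real (real n + 1)" for n
  have w: "w n \<in> halfplane" "cmod (w n) = real n + 1" "Re (w n) = real n + 1"
    "cmod (w n + 1) = real n + 2" for n
    using norm_of_real[of "real n + 1", where 'a = complex]
      norm_of_real[of "real n + 2", where 'a = complex]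
    by (simp_all only: w_def halfplane_def) (auto simp: add.assoc)
  have winf: "filterlim w at_infinity sequentially"
    unfolding filterlim_at_infinity_conv_norm_at_top w(2)
    by (rule filterlim_at_top_mono[OF filterlim_real_sequentially]) simp
  have i: "(\<lambda>n. inverse (w n)) \<longlonglongrightarrow> 0"
    by (rule filterlim_compose[OF tendsto_inverse_0 winf])
  have G0: "0 \<le> Re (G z)" if "z \<in> halfplane" for z
    using G(2) that by (auto simp: halfplane_def less_imp_le)
  have lim: "(\<lambda>n. G (w n) / w n) \<longlonglongrightarrow> of_real (slope G)"
    by (rule Julia_Wolff_Caratheodory[OF G(1) G0 winf, of 1]) (use w in auto)
  define z where "z n = disc_of \<sigma> (w n)" for n
  have zb: "z n \<in> ball 0 1" and wz: "half_of \<sigma> (z n) = w n" for n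
    unfolding z_def using disc_of_in_ball[OF \<sigma> w(1)] half_of_disc_of[OF \<sigma> w(1)] by auto
  have dz: "dist (z n) \<sigma> = 2 / (real n + 2)" for n
    using disc_of_minus[OF w(1), of \<sigma> n] \<sigma> w(4)[of n]
    by (simp add: z_def dist_norm norm_divide norm_mult)
  have nz: "norm (z n) = real n / (real n + 2)" for n
  proof -
    have "w n - 1 = of_real (real n)" by (simp add: w_def)
    then have "cmod (w n - 1) = real n" by (metis abs_of_nat norm_of_real)
    then show ?thesis using \<sigma> w(4)[of n] by (simp add: z_def disc_of_def norm_divide norm_mult)
  qed
  have "z n \<in> stolz_region \<sigma> 2" for n
  proof -
    have "1 - norm (z n) = 2 / (real n + 2)" by (simp add: nz field_simps)
    then show ?thesis using zb[of n] dz[of n] by (simp add: stolz_region_def)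
  qed
  moreover have "z n \<noteq> \<sigma>" for n using zb[of n] \<sigma> by auto
  moreover have "z \<longlonglongrightarrow> \<sigma>"
    unfolding tendsto_dist_iff[of z] dz
  proof (rule Lim_null_comparison)
    show "\<forall>\<^sub>F n in sequentially. norm (2 / (real n + 2)) \<le> 2 * inverse (real (Suc n))"
      by (intro always_eventually allI) (simp add: field_simps)
    show "(\<lambda>n. 2 * inverse (real (Suc n))) \<longlonglongrightarrow> 0"
      using tendsto_mult_left[OF LIMSEQ_inverse_real_of_nat, of 2] by simp
  qed
  ultimately have zlim: "filterlim z (at \<sigma> within stolz_region \<sigma> 2) sequentially"
    by (simp add: filterlim_at)
  have "((\<lambda>z. (f z - \<sigma>) / (z - \<sigma>)) \<longlongrightarrow> D) (at \<sigma> within stolz_region \<sigma> 2)"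
    using D by (simp add: has_angular_derivative_def has_angular_limit_def)
  then have limD: "(\<lambda>n. (f (z n) - \<sigma>) / (z n - \<sigma>)) \<longlonglongrightarrow> D"
    using zlim by (rule filterlim_compose)
  have "(\<lambda>n. (G (w n) / w n + inverse (w n)) / (1 + inverse (w n))) \<longlonglongrightarrow> (of_real (slope G) + 0) / (1 + 0)"
    by (intro tendsto_intros lim i) auto
  from tendsto_mult[OF limD this]
  have "(\<lambda>n. (f (z n) - \<sigma>) / (z n - \<sigma>) * ((G (w n) / w n + inverse (w n)) / (1 + inverse (w n))))
      \<longlonglongrightarrow> D * of_real (slope G)" by simp
  moreover have "(f (z n) - \<sigma>) / (z n - \<sigma>) * ((G (w n) / w n + inverse (w n)) / (1 + inverse (w n))) = 1" for n
  proof -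
    have w0: "w n \<noteq> 0" using w(1)[of n] by (auto simp: halfplane_def)
    have Gw: "G (w n) \<in> halfplane" using G(2) w(1) by blast
    note ne = halfplane_add_one[OF w(1)[of n]] halfplane_add_one[OF Gw]
    have "(f (z n) - \<sigma>) / (z n - \<sigma>) = (w n + 1) / (G (w n) + 1)"
      using disc_of_quotient[OF \<sigma> Gw w(1)[of n]] f[OF zb[of n]] wz[of n] by (simp add: z_def)
    moreover have "G (w n) / w n + inverse (w n) = (G (w n) + 1) / w n" "1 + inverse (w n) = (w n + 1) / w n"
      using w0 by (auto simp: field_simps)
    ultimately show ?thesis using w0 ne by simp
  qed
  ultimately have "D * of_real (slope G) = 1" by (simp add: LIMSEQ_const_iff)
  then have D1: "of_real (slope G) \<noteq> (0::complex)" "D = 1 / of_real (slope G)"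
    by (auto simp: eq_divide_eq)
  then show "0 < slope G" using slope_nonneg[OF G0] by (simp add: less_le)
  show "D = of_real (1 / slope G)" using D1 by simp
qed

section \<open>Transition maps in the half-plane and their affine conjugates\<close>

lemma slope_affine:
  assumes "0 < a"
  shows "slope (\<lambda>z. of_real a * z + \<i> * of_real b) = a"
proof -
  have "slope (\<lambda>z. of_real a * z + \<i> * of_real b) = (INF z\<in>halfplane. a)"
    unfolding slope_def by (rule INF_cong) (auto simp: halfplane_def)
  also have "\<dots> = a" using one_in_halfplane by (intro cINF_const) auto
  finally show ?thesis .
qed

lemma affine_in_halfplane:
  "0 < a \<Longrightarrow> z \<in> halfplane \<Longrightarrow> of_real a * z + \<i> * of_real b \<in> halfplane"
  by (simp add: halfplane_def)

lemma halfplane_evolution: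
  assumes f: "f \<in> normalized_univalent" and t0: "t0 > 0"
  obtains \<psi> \<kappa> L where
    "\<And>s t. 0 \<le> s \<Longrightarrow> s \<le> t \<Longrightarrow> \<psi> s t \<in> normalized_univalent"
    "\<And>s t. 0 \<le> s \<Longrightarrow> s \<le> t \<Longrightarrow> slope (\<psi> s t) = \<kappa> s / \<kappa> t"
    "\<And>s u t z. 0 \<le> s \<Longrightarrow> s \<le> u \<Longrightarrow> u \<le> t \<Longrightarrow> z \<in> halfplane \<Longrightarrow> \<psi> s t z = \<psi> u t (\<psi> s u z)"
    "\<And>z. z \<in> halfplane \<Longrightarrow> \<psi> 0 t0 z = f z"
    "\<kappa> 0 = slope f" "\<kappa> t0 = 1" "\<And>s t. 0 \<le> s \<Longrightarrow> s \<le> t \<Longrightarrow> \<kappa> s \<le> \<kappa> t" "\<And>t. 0 \<le> t \<Longrightarrow> \<kappa> t \<le> 1"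
    "0 \<le> L" "\<And>s t. 0 \<le> s \<Longrightarrow> s \<le> t \<Longrightarrow> \<kappa> t - \<kappa> s \<le> L * (t - s)"
proof -
  define c where "c = slope f"
  have c: "0 < c" "c \<le> 1" using normalized_univalentD(5)[OF f] slope_le_one[OF f] by (auto simp: c_def)
  have "\<exists>K. (\<forall>r\<in>{c..1}. K r \<in> normalized_univalent) \<and> (\<forall>r\<in>{c..1}. slope (K r) = r) \<and>
      (\<forall>r r'. c \<le> r \<and> r \<le> r' \<and> r' \<le> 1 \<longrightarrow> subordinate (K r) (K r')) \<and> (\<forall>z\<in>halfplane. K c z = f z)"
    unfolding c_def by (rule exists_subordination_chain[OF f]) blast
  then obtain K where K: "\<And>r. r \<in> {c..1} \<Longrightarrow> K r \<in> normalized_univalent"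
    and Ks: "\<And>r. r \<in> {c..1} \<Longrightarrow> slope (K r) = r"
    and Ksub: "\<And>r r'. c \<le> r \<Longrightarrow> r \<le> r' \<Longrightarrow> r' \<le> 1 \<Longrightarrow> subordinate (K r) (K r')"
    and Kf: "\<And>z. z \<in> halfplane \<Longrightarrow> K c z = f z"
    by blast
  define L where "L = (1 - c) / t0"
  \<comment> \<open>The slope grows linearly from that of \<open>f\<close> to 1 at \<open>t0\<close>
    and then stays, so the family is the identity after \<open>t0\<close> and \<kappa> is Lipschitz
    with constant \<open>L\<close>.\<close>
  define \<kappa> where "\<kappa> t = c + L * min t t0" for t
  have L: "0 \<le> L" "L * t0 = 1 - c" using c t0 by (auto simp: L_def)
  have \<kappa>0: "\<kappa> 0 = c" and \<kappa>1: "\<kappa> t0 = 1" using t0 L by (auto simp: \<kappa>_def)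
  have mono: "\<kappa> s \<le> \<kappa> t" if "s \<le> t" for s t
    using that L(1) by (auto simp: \<kappa>_def intro!: mult_left_mono)
  have lip: "\<kappa> t - \<kappa> s \<le> L * (t - s)" if "s \<le> t" for s t
  proof -
    have "\<kappa> t - \<kappa> s = L * (min t t0 - min s t0)" by (simp add: \<kappa>_def algebra_simps)
    also have "\<dots> \<le> L * (t - s)" using that L(1) by (intro mult_left_mono) auto
    finally show ?thesis .
  qed
  have range: "\<kappa> t \<in> {c..1}" if "0 \<le> t" for t
  proof -
    have "L * min t t0 \<le> L * t0" "0 \<le> L * min t t0" using L(1) that t0 by (auto intro!: mult_left_mono)
    then show ?thesis using L(2) by (simp add: \<kappa>_def)
  qed
  \<comment> \<open>The choices are independent for each pair of times, but injectivity of
    \<open>K (\<kappa> t)\<close> determines the map on the half-plane; the composition law follows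
    from this alone.\<close>
  define \<psi> where "\<psi> s t = (SOME k. k \<in> normalized_univalent \<and>
      (\<forall>z\<in>halfplane. K (\<kappa> s) z = K (\<kappa> t) (k z)) \<and> slope (K (\<kappa> s)) = slope (K (\<kappa> t)) * slope k)" for s t
  have \<psi>: "\<psi> s t \<in> normalized_univalent \<and> (\<forall>z\<in>halfplane. K (\<kappa> s) z = K (\<kappa> t) (\<psi> s t z)) \<and>
      slope (K (\<kappa> s)) = slope (K (\<kappa> t)) * slope (\<psi> s t)" if st: "0 \<le> s" "s \<le> t" for s t
  proof -
    have "subordinate (K (\<kappa> s)) (K (\<kappa> t))"
      using Ksub mono range st by auto
    moreover have "K (\<kappa> t) \<in> normalized_univalent" using K range[of t] st by simp
    ultimately have "\<exists>k. k \<in> normalized_univalent \<and>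
      (\<forall>z\<in>halfplane. K (\<kappa> s) z = K (\<kappa> t) (k z)) \<and> slope (K (\<kappa> s)) = slope (K (\<kappa> t)) * slope k"
      by (rule subordinateE) blast
    then show ?thesis unfolding \<psi>_def by (rule someI_ex)
  qed
  have inj: "x = y" if "K (\<kappa> t) x = K (\<kappa> t) y" "x \<in> halfplane" "y \<in> halfplane" "0 \<le> t" for x y t
    using inj_onD[OF normalized_univalentD(3)[OF K[OF range]]] that by blast
  have H: "\<psi> s t z \<in> halfplane" if "0 \<le> s" "s \<le> t" "z \<in> halfplane" for s t z
    using \<psi>[OF that(1,2)] normalized_univalentD(6) that(3) by blast
  show ?thesis
  proof (rule that[of \<psi> \<kappa> L])
    fix s t :: real assume st: "0 \<le> s" "s \<le> t"
    show "\<psi> s t \<in> normalized_univalent" using \<psi>[OF st] by blast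
    have "\<kappa> t > 0" using range[of t] st c by auto
    then show "slope (\<psi> s t) = \<kappa> s / \<kappa> t"
      using \<psi>[OF st] Ks[OF range[of s]] Ks[OF range[of t]] st by simp
    show "\<kappa> s \<le> \<kappa> t" "\<kappa> t - \<kappa> s \<le> L * (t - s)" using mono lip st by auto
  next
    fix s u t :: real and z assume s: "0 \<le> s" "s \<le> u" "u \<le> t" and z: "z \<in> halfplane"
    then have u: "0 \<le> u" "s \<le> t" by auto
    have st: "s \<le> t" using s by simp
    have "K (\<kappa> t) (\<psi> s t z) = K (\<kappa> s) z" using \<psi>[OF s(1) st] z by simp
    also have "\<dots> = K (\<kappa> u) (\<psi> s u z)" using \<psi>[OF s(1,2)] z by simp
    also have "\<dots> = K (\<kappa> t) (\<psi> u t (\<psi> s u z))" using \<psi>[OF u(1) s(3)] H[OF s(1,2) z] by simp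
    finally show "\<psi> s t z = \<psi> u t (\<psi> s u z)"
      by (rule inj[OF _ H[OF s(1) st z] H[OF u(1) s(3) H[OF s(1,2) z]]]) (use s in simp)
  next
    fix z assume z: "z \<in> halfplane"
    have one: "(1::real) \<in> {c..1}" using c by simp
    have "f z = K 1 (\<psi> 0 t0 z)" using \<psi>[of 0 t0] t0 z Kf \<kappa>0 \<kappa>1 by simp
    also have "\<dots> = \<psi> 0 t0 z"
      using slope_one_imp_id[OF K[OF one] Ks[OF one] H[OF _ _ z, of 0 t0]] t0 by simp
    finally show "\<psi> 0 t0 z = f z" by simp
  qed (use \<kappa>0 \<kappa>1 range L c_def in auto)
qed

lemma disc_of_lipschitz:
  assumes "norm \<sigma> = 1" "v \<in> halfplane" "w \<in> halfplane"
  shows "norm (disc_of \<sigma> v - disc_of \<sigma> w) \<le> 2 * norm (v - w)"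
proof -
  note ne = halfplane_add_one[OF assms(2)] halfplane_add_one[OF assms(3)]
  have ge: "1 \<le> cmod (y + 1)" if "y \<in> halfplane" for y
    using complex_Re_le_cmod[of "y + 1"] that by (simp add: halfplane_def)
  have "disc_of \<sigma> v - disc_of \<sigma> w = (disc_of \<sigma> v - \<sigma>) - (disc_of \<sigma> w - \<sigma>)" by simp
  also have "\<dots> = 2 * \<sigma> * (v - w) / ((v + 1) * (w + 1))"
    unfolding disc_of_minus[OF assms(2)] disc_of_minus[OF assms(3)] using ne by (simp add: divide_simps) (simp add: algebra_simps)
  finally have "norm (disc_of \<sigma> v - disc_of \<sigma> w) = 2 * norm (v - w) / (cmod (v + 1) * cmod (w + 1))"
    using assms(1) by (simp add: norm_divide norm_mult)
  also have "\<dots> \<le> 2 * norm (v - w) / 1"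
    using mult_mono[OF ge[OF assms(2)] ge[OF assms(3)]] by (intro divide_left_mono) auto
  finally show ?thesis by simp
qed

lemma exp_diff_le:
  fixes x y :: real
  assumes "x \<le> B" "y \<le> B"
  shows "\<bar>exp x - exp y\<bar> \<le> exp B * \<bar>x - y\<bar>"
proof -
  have *: "exp v - exp u \<le> exp B * (v - u)" if "u \<le> v" "v \<le> B" for u v :: real
  proof -
    have "1 - exp (u - v) \<le> v - u" using exp_ge_add_one_self[of "u - v"] by linarith
    then have "exp v * (1 - exp (u - v)) \<le> exp v * (v - u)" by (rule mult_left_mono) simp
    also have "\<dots> \<le> exp B * (v - u)" using that by (intro mult_right_mono) auto
    finally show ?thesis by (simp add: algebra_simps flip: exp_add)
  qed
  show ?thesis
  proof (cases "x \<le> y")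
    case True
    have "exp x \<le> exp y" using True by simp
    then show ?thesis using *[OF True assms(2)] True by (simp add: abs_if)
  next
    case False
    then have "exp y \<le> exp x" by simp
    then show ?thesis using *[of y x] assms(1) False by (simp add: abs_if)
  qed
qed

text \<open>Three effects add up between times \<open>u\<close> and \<open>t\<close>: the change of
  \<alpha>, the displacement by \<open>\<psi> u t\<close>, and the translation. The first costs
  \<open>t - u\<close> and the increment of \<Lambda>, the other two cost \<open>t - u\<close>. All
  constants must be uniform in the starting time \<open>s\<close>.\<close>

lemma affine_conjugate_displacement:
  fixes \<psi> :: "real \<Rightarrow> real \<Rightarrow> complex \<Rightarrow> complex" and \<kappa> \<Lambda> \<alpha> :: "real \<Rightarrow> real" and b :: real
  assumes \<psi>: "\<And>s t. 0 \<le> s \<Longrightarrow> s \<le> t \<Longrightarrow> \<psi> s t \<in> normalized_univalent"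
    and slope: "\<And>s t. 0 \<le> s \<Longrightarrow> s \<le> t \<Longrightarrow> slope (\<psi> s t) = \<kappa> s / \<kappa> t"
    and cocycle: "\<And>s u t z. 0 \<le> s \<Longrightarrow> s \<le> u \<Longrightarrow> u \<le> t \<Longrightarrow> z \<in> halfplane \<Longrightarrow> \<psi> s t z = \<psi> u t (\<psi> s u z)"
    and \<kappa>: "0 < \<kappa> 0" "\<And>s t. 0 \<le> s \<Longrightarrow> s \<le> t \<Longrightarrow> \<kappa> s \<le> \<kappa> t" "\<And>t. 0 \<le> t \<Longrightarrow> \<kappa> t \<le> 1"
    and L: "0 \<le> L" "\<And>s t. 0 \<le> s \<Longrightarrow> s \<le> t \<Longrightarrow> \<kappa> t - \<kappa> s \<le> L * (t - s)"
    and \<alpha>: "\<And>t. \<alpha> t = exp (\<Lambda> t) * \<kappa> t / \<kappa> 0"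
    and B: "\<And>t. 0 \<le> t \<Longrightarrow> t \<le> T \<Longrightarrow> \<bar>\<Lambda> t\<bar> \<le> B" and w: "w \<in> halfplane"
  defines "\<zeta> \<equiv> \<lambda>s. (w - \<i> * of_real (b * s)) / of_real (\<alpha> s)"
  shows "\<exists>Q\<ge>0. \<forall>s u t. 0 \<le> s \<and> s \<le> u \<and> u \<le> t \<and> t \<le> T \<longrightarrow>
    cmod ((of_real (\<alpha> u) * \<psi> s u (\<zeta> s) + \<i> * of_real (b * u)) -
          (of_real (\<alpha> t) * \<psi> s t (\<zeta> s) + \<i> * of_real (b * t))) \<le> Q * ((t - u) + \<bar>\<Lambda> t - \<Lambda> u\<bar>)"
proof -
  define k0 where "k0 = \<kappa> 0"
  have k0: "0 < k0" using \<kappa>(1) by (simp add: k0_def)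
  have \<kappa>_ge: "k0 \<le> \<kappa> t" if "0 \<le> t" for t using \<kappa>(2)[of 0 t] that by (simp add: k0_def)
  have Rw: "0 < Re w" using w by (simp add: halfplane_def)
  \<comment> \<open>For every \<open>s\<close> in \<open>{0..T}\<close> the point
    \<open>\<zeta> s\<close> has real part at least \<open>m1\<close> and modulus at most
    \<open>m2\<close>; its image \<open>\<eta>\<close> has modulus at most \<open>m3\<close> by the
    growth bound and real part at least \<open>m4\<close> by the slope bound.\<close>
  define m1 where "m1 = Re w * k0 * exp (- B)"
  define m2 where "m2 = (cmod w + \<bar>b\<bar> * \<bar>T\<bar>) * exp B"
  define m3 where "m3 = (m2 + 1)\<^sup>2 / m1"
  define m4 where "m4 = k0 * m1"
  define P where "P = L / k0 * (m3 + (m3 + 1)\<^sup>2 / m4)"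
  define A where "A = exp B / k0"
  define Q where "Q = m3 * (A * (L + 1)) + A * P + \<bar>b\<bar>"
  have pos: "0 < m1" "0 \<le> m2" "0 \<le> m3" "0 < m4" "0 \<le> P" "0 \<le> A"
    using k0 Rw L(1) by (auto simp: m1_def m2_def m3_def m4_def P_def A_def)
  have AL: "0 \<le> A * L" using pos L(1) by simp
  have "0 \<le> Q" using pos L(1) by (simp add: Q_def)
  have \<alpha>_bounds: "exp (- B) \<le> \<alpha> t" "\<alpha> t \<le> A" "0 < \<alpha> t" if "0 \<le> t" "t \<le> T" for t
  proof -
    have e: "exp (- B) \<le> exp (\<Lambda> t)" "exp (\<Lambda> t) \<le> exp B" using B[OF that] by auto
    have k: "1 \<le> \<kappa> t / k0" "\<kappa> t / k0 \<le> 1 / k0"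
      using \<kappa>_ge[OF that(1)] \<kappa>(3)[OF that(1)] k0 by (auto simp: divide_right_mono)
    have "exp (- B) * 1 \<le> exp (\<Lambda> t) * (\<kappa> t / k0)" using e k by (intro mult_mono) auto
    then show "exp (- B) \<le> \<alpha> t" by (simp add: \<alpha> k0_def)
    then show "0 < \<alpha> t" by (rule less_le_trans[OF exp_gt_zero])
    have "exp (\<Lambda> t) * (\<kappa> t / k0) \<le> exp B * (1 / k0)" using e k by (intro mult_mono) auto
    then show "\<alpha> t \<le> A" by (simp add: \<alpha> k0_def A_def)
  qed
  have main: "cmod ((of_real (\<alpha> u) * \<psi> s u (\<zeta> s) + \<i> * of_real (b * u)) -
          (of_real (\<alpha> t) * \<psi> s t (\<zeta> s) + \<i> * of_real (b * t))) \<le> Q * ((t - u) + \<bar>\<Lambda> t - \<Lambda> u\<bar>)"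
    if st: "0 \<le> s" "s \<le> u" "u \<le> t" "t \<le> T" for s u t
  proof -
    have s: "0 \<le> s" "s \<le> T" and u: "0 \<le> u" "u \<le> T" and t: "0 \<le> t" "t \<le> T" using st by auto
    note \<alpha>s = \<alpha>_bounds[OF s]
    have Re\<zeta>: "Re (\<zeta> s) = Re w / \<alpha> s" by (simp add: \<zeta>_def)
    have "\<alpha> s \<le> exp B / k0" using \<alpha>s by (simp add: A_def)
    then have "Re w / (exp B / k0) \<le> Re w / \<alpha> s"
      using Rw \<alpha>s k0 by (intro divide_left_mono) auto
    then have m1: "m1 \<le> Re (\<zeta> s)" by (simp add: Re\<zeta> m1_def exp_minus field_simps)
    then have \<zeta>H: "\<zeta> s \<in> halfplane" using pos by (simp add: halfplane_def)
    have "cmod (w - \<i> * of_real (b * s)) \<le> cmod w + cmod (\<i> * of_real (b * s))" by (rule norm_triangle_ineq4)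
    also have "cmod (\<i> * of_real (b * s)) = \<bar>b\<bar> * s" using s by (simp only: norm_mult norm_of_real abs_mult) simp
    also have "\<bar>b\<bar> * s \<le> \<bar>b\<bar> * \<bar>T\<bar>" using s by (intro mult_left_mono) auto
    finally have "cmod (w - \<i> * of_real (b * s)) \<le> cmod w + \<bar>b\<bar> * \<bar>T\<bar>" by simp
    then have "cmod (\<zeta> s) \<le> (cmod w + \<bar>b\<bar> * \<bar>T\<bar>) / exp (- B)"
      unfolding \<zeta>_def norm_divide using \<alpha>s by (intro frac_le) auto
    then have m2: "cmod (\<zeta> s) \<le> m2" by (simp add: m2_def exp_minus field_simps)
    define \<eta> where "\<eta> = \<psi> s u (\<zeta> s)"
    have su: "0 \<le> s" "s \<le> u" and ut: "0 \<le> u" "u \<le> t" using st by auto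
    have \<eta>H: "\<eta> \<in> halfplane" unfolding \<eta>_def using normalized_univalentD(6)[OF \<psi>[OF su] \<zeta>H] .
    have "cmod (\<zeta> s + 1) \<le> m2 + 1" using norm_triangle_ineq[of "\<zeta> s" 1] m2 by simp
    then have "(cmod (\<zeta> s + 1))\<^sup>2 / Re (\<zeta> s) \<le> m3"
      unfolding m3_def using m1 pos by (intro frac_le power_mono) auto
    then have m3: "cmod \<eta> \<le> m3"
      using normalized_univalent_growth[OF \<psi>[OF su] \<zeta>H] by (simp add: \<eta>_def)
    have "k0 \<le> \<kappa> s / \<kappa> u"
    proof -
      have "\<kappa> s / 1 \<le> \<kappa> s / \<kappa> u"
        using \<kappa>_ge[OF s(1)] \<kappa>_ge[OF u(1)] \<kappa>(3)[OF u(1)] k0 by (intro divide_left_mono) auto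
      then show ?thesis using \<kappa>_ge[OF s(1)] by simp
    qed
    then have "k0 * m1 \<le> slope (\<psi> s u) * Re (\<zeta> s)"
      unfolding slope[OF su] using m1 pos k0 by (intro mult_mono) auto
    also have "\<dots> \<le> Re \<eta>"
      unfolding \<eta>_def by (rule slope_mult_le[OF normalized_univalentD(7)[OF \<psi>[OF su]] \<zeta>H])
    finally have m4: "m4 \<le> Re \<eta>" by (simp add: m4_def)
    have "cmod (\<eta> + 1) \<le> m3 + 1" using norm_triangle_ineq[of \<eta> 1] m3 by simp
    then have "(cmod (\<eta> + 1))\<^sup>2 / Re \<eta> \<le> (m3 + 1)\<^sup>2 / m4"
      using m4 pos by (intro frac_le power_mono) auto
    then have R: "cmod \<eta> + (cmod (\<eta> + 1))\<^sup>2 / Re \<eta> \<le> m3 + (m3 + 1)\<^sup>2 / m4" using m3 by simp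
    have kt: "k0 \<le> \<kappa> t" using \<kappa>_ge[OF t(1)] .
    have "1 - slope (\<psi> u t) = (\<kappa> t - \<kappa> u) / \<kappa> t"
      unfolding slope[OF ut] using kt k0 by (simp add: diff_divide_distrib)
    also have "\<dots> \<le> L * (t - u) / k0"
      using L ut \<kappa>(2)[OF ut] kt k0 by (intro frac_le) auto
    finally have sl: "1 - slope (\<psi> u t) \<le> L / k0 * (t - u)" by simp
    have "cmod (\<psi> u t \<eta> - \<eta>) \<le> (1 - slope (\<psi> u t)) * (cmod \<eta> + (cmod (\<eta> + 1))\<^sup>2 / Re \<eta>)"
      by (rule normalized_univalent_displacement[OF \<psi>[OF ut] \<eta>H])
    also have "\<dots> \<le> (L / k0 * (t - u)) * (m3 + (m3 + 1)\<^sup>2 / m4)"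
      using sl R m4 pos L(1) k0 ut by (intro mult_mono) auto
    finally have disp: "cmod (\<eta> - \<psi> u t \<eta>) \<le> P * (t - u)"
      by (simp add: P_def mult.commute mult.left_commute norm_minus_commute)
    have eA: "exp B * (\<kappa> u / k0) \<le> A"
      unfolding A_def using \<kappa>(3)[OF u(1)] k0 by (simp add: divide_right_mono)
    \<comment> \<open>Product rule for differences: one term is controlled by the Lipschitz bound on
      \<kappa>, the other by the increment of \<Lambda>.\<close>
    have "\<alpha> t - \<alpha> u = exp (\<Lambda> t) * ((\<kappa> t - \<kappa> u) / k0) + (exp (\<Lambda> t) - exp (\<Lambda> u)) * (\<kappa> u / k0)"
      by (simp add: \<alpha> k0_def algebra_simps diff_divide_distrib)
    then have "\<bar>\<alpha> t - \<alpha> u\<bar> \<le> \<bar>exp (\<Lambda> t) * ((\<kappa> t - \<kappa> u) / k0)\<bar> + \<bar>(exp (\<Lambda> t) - exp (\<Lambda> u)) * (\<kappa> u / k0)\<bar>"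
      by (simp only: abs_triangle_ineq)
    also have "\<dots> = exp (\<Lambda> t) * ((\<kappa> t - \<kappa> u) / k0) + \<bar>exp (\<Lambda> t) - exp (\<Lambda> u)\<bar> * (\<kappa> u / k0)"
      using \<kappa>(2)[OF ut] k0 \<kappa>_ge[OF u(1)] by (simp add: abs_mult)
    also have "\<dots> \<le> exp B * (L * (t - u) / k0) + (exp B * \<bar>\<Lambda> t - \<Lambda> u\<bar>) * (\<kappa> u / k0)"
    proof (intro add_mono mult_mono divide_right_mono)
      show "exp (\<Lambda> t) \<le> exp B" using B[OF t] by simp
      show "\<kappa> t - \<kappa> u \<le> L * (t - u)" by (rule L(2)[OF ut])
      show "\<bar>exp (\<Lambda> t) - exp (\<Lambda> u)\<bar> \<le> exp B * \<bar>\<Lambda> t - \<Lambda> u\<bar>"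
        using B[OF t] B[OF u] by (intro exp_diff_le) auto
    qed (use \<kappa>(2)[OF ut] k0 \<kappa>_ge[OF u(1)] in auto)
    also have "\<dots> = A * L * (t - u) + exp B * (\<kappa> u / k0) * \<bar>\<Lambda> t - \<Lambda> u\<bar>"
      by (simp add: A_def algebra_simps)
    also have "\<dots> \<le> A * L * (t - u) + A * \<bar>\<Lambda> t - \<Lambda> u\<bar>"
      using mult_right_mono[OF eA, of "\<bar>\<Lambda> t - \<Lambda> u\<bar>"] by simp
    also have "\<dots> \<le> A * (L + 1) * ((t - u) + \<bar>\<Lambda> t - \<Lambda> u\<bar>)"
    proof -
      have "0 \<le> A * (t - u)" "0 \<le> A * L * \<bar>\<Lambda> t - \<Lambda> u\<bar>" using pos AL ut by simp_all
      then show ?thesis by (simp add: algebra_simps)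
    qed
    finally have d\<alpha>: "\<bar>\<alpha> t - \<alpha> u\<bar> \<le> A * (L + 1) * ((t - u) + \<bar>\<Lambda> t - \<Lambda> u\<bar>)" .
    have "\<psi> s t (\<zeta> s) = \<psi> u t \<eta>" unfolding \<eta>_def using cocycle st \<zeta>H by blast
    then have "(of_real (\<alpha> u) * \<psi> s u (\<zeta> s) + \<i> * of_real (b * u)) -
          (of_real (\<alpha> t) * \<psi> s t (\<zeta> s) + \<i> * of_real (b * t)) =
        of_real (\<alpha> u - \<alpha> t) * \<eta> + of_real (\<alpha> t) * (\<eta> - \<psi> u t \<eta>) + \<i> * of_real (b * (u - t))"
      by (simp add: \<eta>_def algebra_simps)
    also have "cmod \<dots> \<le> \<bar>\<alpha> u - \<alpha> t\<bar> * cmod \<eta> + \<bar>\<alpha> t\<bar> * cmod (\<eta> - \<psi> u t \<eta>) + \<bar>b * (u - t)\<bar>"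
      using norm_triangle_ineq[of "of_real (\<alpha> u - \<alpha> t) * \<eta> + of_real (\<alpha> t) * (\<eta> - \<psi> u t \<eta>)" "\<i> * of_real (b * (u - t))"]
        norm_triangle_ineq[of "of_real (\<alpha> u - \<alpha> t) * \<eta>" "of_real (\<alpha> t) * (\<eta> - \<psi> u t \<eta>)"]
      by (simp only: norm_mult norm_of_real norm_ii mult_1)
    also have "\<dots> \<le> (A * (L + 1) * ((t - u) + \<bar>\<Lambda> t - \<Lambda> u\<bar>)) * m3 + A * (P * (t - u)) + \<bar>b\<bar> * (t - u)"
    proof (intro add_mono mult_mono)
      show "\<bar>\<alpha> u - \<alpha> t\<bar> \<le> A * (L + 1) * ((t - u) + \<bar>\<Lambda> t - \<Lambda> u\<bar>)" using d\<alpha> by (simp add: abs_minus_commute)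
      show "\<bar>\<alpha> t\<bar> \<le> A" using \<alpha>_bounds[OF t] by simp
      show "\<bar>b * (u - t)\<bar> \<le> \<bar>b\<bar> * (t - u)" using ut by (simp add: abs_mult)
      show "0 \<le> A * (L + 1) * ((t - u) + \<bar>\<Lambda> t - \<Lambda> u\<bar>)" using pos L(1) ut by simp
    qed (use m3 disp pos in auto)
    also have "\<dots> \<le> (A * (L + 1) * ((t - u) + \<bar>\<Lambda> t - \<Lambda> u\<bar>)) * m3 +
        A * (P * ((t - u) + \<bar>\<Lambda> t - \<Lambda> u\<bar>)) + \<bar>b\<bar> * ((t - u) + \<bar>\<Lambda> t - \<Lambda> u\<bar>)"
    proof -
      have le: "t - u \<le> (t - u) + \<bar>\<Lambda> t - \<Lambda> u\<bar>" by simp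
      have "A * (P * (t - u)) \<le> A * (P * ((t - u) + \<bar>\<Lambda> t - \<Lambda> u\<bar>))"
        using mult_left_mono[OF mult_left_mono[OF le pos(5)] pos(6)] .
      moreover have "\<bar>b\<bar> * (t - u) \<le> \<bar>b\<bar> * ((t - u) + \<bar>\<Lambda> t - \<Lambda> u\<bar>)"
        by (rule mult_left_mono[OF le abs_ge_zero])
      ultimately show ?thesis by linarith
    qed
    also have "\<dots> = Q * ((t - u) + \<bar>\<Lambda> t - \<Lambda> u\<bar>)" by (simp add: Q_def algebra_simps)
    finally show ?thesis .
  qed
  then show ?thesis using \<open>0 \<le> Q\<close> by blast
qed

text \<open>The form \<open>c * (1 + k \<xi>)\<close> is that of the final majorant: the 1 pays for
  the Lipschitz part of the motion and \<open>k\<close> for \<Lambda>. A Borel density on the line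
  is moved to Lebesgue measure on the interval.\<close>

lemma mem_Lp_one_restrict:
  fixes k :: "real \<Rightarrow> real"
  assumes k: "k \<in> borel_measurable borel" "integrable lborel k" "\<And>\<xi>. 0 \<le> k \<xi>"
  shows "mem_Lp 1 (lebesgue_on {0..T}) (\<lambda>\<xi>. c * (1 + k \<xi>))"
proof -
  have restrict: "integrable (lebesgue_on {0..T}) h"
    if h: "h \<in> borel_measurable borel" "integrable lborel (\<lambda>x. indicator {0..T} x *\<^sub>R h x)" for h :: "real \<Rightarrow> real"
  proof -
    have "(\<lambda>x. indicator {0..T} x *\<^sub>R h x) \<in> borel_measurable lborel" using h(1) by simp
    from integrable_completion[OF this] h(2)
    have "integrable lebesgue (\<lambda>x. indicator {0..T} x *\<^sub>R h x)" by blast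
    then show ?thesis by (subst integrable_restrict_space) simp_all
  qed
  have ik: "integrable (lebesgue_on {0..T}) k"
    by (rule restrict[OF k(1) integrable_mult_indicator[OF _ k(2)]]) simp
  have one: "integrable (lebesgue_on {0..T}) (\<lambda>_. 1::real)"
    by (rule restrict) (simp_all add: integrable_real_indicator emeasure_lborel_Icc_eq)
  have int: "integrable (lebesgue_on {0..T}) (\<lambda>\<xi>. c * (1 + k \<xi>))"
    using ik one by (intro integrable_mult_right Bochner_Integration.integrable_add) auto
  then show ?thesis
    by (auto simp: mem_Lp_def powr_one_gt_zero_iff intro: borel_measurable_integrable)
qed

lemma set_integral_one_plus:
  fixes k :: "real \<Rightarrow> real"
  assumes k: "k \<in> borel_measurable borel" "integrable lborel k" and "u \<le> t"
  shows "(LINT \<xi>:{u..t}|lebesgue. c * (1 + k \<xi>)) = c * ((t - u) + (LINT \<xi>:{u..t}|lborel. k \<xi>))"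
proof -
  have m: "(\<lambda>\<xi>. indicator {u..t} \<xi> *\<^sub>R (c * (1 + k \<xi>))) \<in> borel_measurable lborel"
    using k(1) by simp
  have i1: "integrable lborel (\<lambda>\<xi>. indicator {u..t} \<xi> :: real)"
    by (rule integrable_real_indicator) (simp_all add: emeasure_lborel_Icc_eq)
  have i2: "integrable lborel (\<lambda>\<xi>. indicator {u..t} \<xi> *\<^sub>R k \<xi>)"
    using k(2) by (intro integrable_mult_indicator) auto
  have "(LINT \<xi>:{u..t}|lebesgue. c * (1 + k \<xi>)) = (LINT \<xi>|lborel. indicator {u..t} \<xi> *\<^sub>R (c * (1 + k \<xi>)))"
    unfolding set_lebesgue_integral_def using m by (rule integral_completion)
  also have "\<dots> = (LINT \<xi>|lborel. c * (indicator {u..t} \<xi> + indicator {u..t} \<xi> *\<^sub>R k \<xi>))"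
    by (rule Bochner_Integration.integral_cong) (auto simp: algebra_simps)
  also have "\<dots> = c * ((LINT \<xi>|lborel. indicator {u..t} \<xi>) + (LINT \<xi>|lborel. indicator {u..t} \<xi> *\<^sub>R k \<xi>))"
    using i1 i2 by simp
  also have "(LINT \<xi>|lborel. indicator {u..t} \<xi>) = t - u" using \<open>u \<le> t\<close> by simp
  finally show ?thesis by (simp add: set_lebesgue_integral_def)
qed

theorem theorem1p2:
  fixes \<phi> :: "complex \<Rightarrow> complex" and \<sigma> :: complex and t0 :: real and \<Lambda> :: "real \<Rightarrow> real"
  assumes "\<phi> holomorphic_on ball 0 1"
    and "\<phi> ` ball 0 1 \<subseteq> ball 0 1"
    and "inj_on \<phi> (ball 0 1)"
    and "boundary_regular_fixed_point \<phi> \<sigma>"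
    and "t0 > 0"
    and "locally_absolutely_continuous \<Lambda>"
    and "\<Lambda> 0 = 0"
    and "\<Lambda> t0 = - ln (Re (angular_deriv \<phi> \<sigma>))"
  shows "\<exists>\<Phi> :: real \<Rightarrow> real \<Rightarrow> complex \<Rightarrow> complex.
           evolution_family \<Phi> \<and>
           family_boundary_regular_fixed_point \<Phi> \<sigma> \<and>
           (\<forall>t\<ge>0. spectral_function \<Phi> \<sigma> t = \<Lambda> t) \<and>
           (\<forall>z\<in>ball 0 1. \<Phi> 0 t0 z = \<phi> z)"
proof -
  obtain D where \<sigma>: "norm \<sigma> = 1" and D: "has_angular_derivative \<phi> \<sigma> D"
    using assms(4) by (auto simp: boundary_regular_fixed_point_def)
  define G where "G w = half_of \<sigma> (\<phi> (disc_of \<sigma> w))" for w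
  have \<phi>b: "\<phi> z \<in> ball 0 1" if "z \<in> ball 0 1" for z using assms(2) that by blast
  have holG: "G holomorphic_on halfplane"
  proof -
    have "(\<phi> \<circ> disc_of \<sigma>) holomorphic_on halfplane"
      by (rule holomorphic_on_compose_gen[OF holomorphic_disc_of assms(1) image_subsetI[OF disc_of_in_ball[OF \<sigma>]]])
    then have "(half_of \<sigma> \<circ> (\<phi> \<circ> disc_of \<sigma>)) holomorphic_on halfplane"
      by (rule holomorphic_on_compose_gen[OF _ holomorphic_half_of[OF \<sigma>]])
         (use \<phi>b disc_of_in_ball[OF \<sigma>] in \<open>force simp del: mem_ball_0\<close>)
    then show ?thesis by (simp add: G_def[abs_def] o_def)
  qed
  have GH: "G w \<in> halfplane" if "w \<in> halfplane" for w
    unfolding G_def by (rule half_of_in_halfplane[OF \<sigma> \<phi>b[OF disc_of_in_ball[OF \<sigma> that]]])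
  have injG: "inj_on G halfplane"
  proof (rule inj_onI)
    fix x y assume xy: "x \<in> halfplane" "y \<in> halfplane" "G x = G y"
    note dx = disc_of_in_ball[OF \<sigma> xy(1)] and dy = disc_of_in_ball[OF \<sigma> xy(2)]
    have "\<phi> (disc_of \<sigma> x) = \<phi> (disc_of \<sigma> y)"
      using inj_onD[OF inj_on_half_of[OF \<sigma>] xy(3)[unfolded G_def] \<phi>b[OF dx] \<phi>b[OF dy]] .
    then have "disc_of \<sigma> x = disc_of \<sigma> y" using inj_onD[OF assms(3) _ dx dy] by blast
    then show "x = y" using inj_onD[OF inj_on_disc_of[OF \<sigma>] _ xy(1,2)] by blast
  qed
  have \<phi>G: "\<phi> z = disc_of \<sigma> (G (half_of \<sigma> z))" if "z \<in> ball 0 1" for z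
    using disc_of_half_of[OF \<sigma> that] disc_of_half_of[OF \<sigma> \<phi>b[OF that]] by (simp add: G_def)
  define c where "c = slope G"
  have c: "0 < c" and Dc: "D = of_real (1 / c)"
    unfolding c_def using slope_of_angular_derivative[OF \<sigma> holG _ \<phi>G D] GH by blast+
  have \<Lambda>t0: "\<Lambda> t0 = ln c"
    using assms(8) angular_deriv_eq[OF \<sigma> D] c by (simp add: Dc ln_div)
  \<comment> \<open>The affine automorphism with coefficients \<open>a\<close> and \<open>b\<close>
    sends 1 to \<open>G 1\<close>; dividing it out of \<open>G\<close> gives a map fixing 1, of
    slope \<open>c / a\<close>.\<close>
  define a where "a = Re (G 1)"
  define b where "b = Im (G 1)"
  have a: "0 < a" using GH[OF one_in_halfplane] by (simp add: a_def halfplane_def)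
  define f where "f w = of_real (1 / a) * G w + \<i> * of_real (- b / a)" for w
  have Gf: "G w = of_real a * f w + \<i> * of_real b" for w
    using a by (simp add: f_def field_simps)
  have slf: "slope f = c / a"
  proof -
    have "slope f = slope (\<lambda>z. of_real (1 / a) * z + \<i> * of_real (- b / a)) * slope G"
      unfolding f_def
    proof (rule slope_comp[OF _ _ holG _ c[unfolded c_def]])
      show "(\<lambda>z. of_real (1 / a) * z + \<i> * of_real (- b / a)) holomorphic_on halfplane"
        by (intro holomorphic_intros)
    qed (use a GH in \<open>auto simp: halfplane_def\<close>)
    then show ?thesis using slope_affine[of "1 / a" "- b / a"] a by (simp add: c_def)
  qed
  have f: "f \<in> normalized_univalent"
    unfolding normalized_univalent_def
  proof (intro CollectI conjI)
    show "f holomorphic_on halfplane" unfolding f_def by (intro holomorphic_intros holG)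
    show "f ` halfplane \<subseteq> halfplane"
    proof (rule image_subsetI)
      fix w assume "w \<in> halfplane"
      from affine_in_halfplane[OF _ GH[OF this], of "1 / a" "- b / a"] a
      show "f w \<in> halfplane" unfolding f_def by simp
    qed
    show "inj_on f halfplane"
      using injG unfolding inj_on_def Gf by metis
    have "G 1 = of_real a + \<i> * of_real b" by (simp add: a_def b_def complex_eq)
    then show "f 1 = 1" using a by (simp add: f_def field_simps)
    show "0 < slope f" using slf a c by simp
  qed
  obtain \<psi> \<kappa> L where \<psi>: "\<And>s t. 0 \<le> s \<Longrightarrow> s \<le> t \<Longrightarrow> \<psi> s t \<in> normalized_univalent"
    and slope: "\<And>s t. 0 \<le> s \<Longrightarrow> s \<le> t \<Longrightarrow> slope (\<psi> s t) = \<kappa> s / \<kappa> t"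
    and cocycle: "\<And>s u t z. 0 \<le> s \<Longrightarrow> s \<le> u \<Longrightarrow> u \<le> t \<Longrightarrow> z \<in> halfplane \<Longrightarrow> \<psi> s t z = \<psi> u t (\<psi> s u z)"
    and \<psi>f: "\<And>z. z \<in> halfplane \<Longrightarrow> \<psi> 0 t0 z = f z"
    and \<kappa>: "\<kappa> 0 = slope f" "\<kappa> t0 = 1" "\<And>s t. 0 \<le> s \<Longrightarrow> s \<le> t \<Longrightarrow> \<kappa> s \<le> \<kappa> t" "\<And>t. 0 \<le> t \<Longrightarrow> \<kappa> t \<le> 1"
    and L: "0 \<le> L" "\<And>s t. 0 \<le> s \<Longrightarrow> s \<le> t \<Longrightarrow> \<kappa> t - \<kappa> s \<le> L * (t - s)"
    by (rule halfplane_evolution[OF f assms(5)]) blast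
  have \<kappa>0: "0 < \<kappa> 0" using \<kappa>(1) slf a c by simp
  have \<kappa>pos: "0 < \<kappa> t" if "0 \<le> t" for t using \<kappa>(3)[of 0 t] that \<kappa>0 by simp
  \<comment> \<open>The translation is spread linearly over time and reaches \<open>b\<close> at
    \<open>t0\<close>.\<close>
  define \<beta> where "\<beta> = b / t0"
  \<comment> \<open>Forced by the spectral function: \<open>\<Psi> 0 t\<close> has slope
    \<open>\<alpha> t * \<kappa> 0 / \<kappa> t\<close>, and this must equal
    \<open>exp (\<Lambda> t)\<close>. At \<open>t0\<close> the value is \<open>a\<close>, since
    \<open>exp (\<Lambda> t0) = c\<close> and \<open>\<kappa> 0 = c / a\<close>.\<close>
  define \<alpha> where "\<alpha> t = exp (\<Lambda> t) * \<kappa> t / \<kappa> 0" for t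
  have \<alpha>pos: "0 < \<alpha> t" if "0 \<le> t" for t using \<kappa>pos[OF that] \<kappa>0 by (simp add: \<alpha>_def)
  have \<alpha>0: "\<alpha> 0 = 1" using \<kappa>0 assms(7) by (simp add: \<alpha>_def)
  have \<alpha>t0: "\<alpha> t0 = a" using \<Lambda>t0 c a \<kappa>(1,2) slf by (simp add: \<alpha>_def)
  \<comment> \<open>\<open>N s\<close> is the inverse of \<open>M s\<close>, so the affine maps at
    intermediate times cancel in compositions.\<close>
  define N where "N s w = (w - \<i> * of_real (\<beta> * s)) / of_real (\<alpha> s)" for s w
  define M where "M t w = of_real (\<alpha> t) * w + \<i> * of_real (\<beta> * t)" for t w
  define \<Psi> where "\<Psi> s t w = M t (\<psi> s t (N s w))" for s t w
  define \<Phi> where "\<Phi> s t z = disc_of \<sigma> (\<Psi> s t (half_of \<sigma> z))" for s t z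
  have N_affine: "N s w = of_real (1 / \<alpha> s) * w + \<i> * of_real (- \<beta> * s / \<alpha> s)" for s w
    by (simp add: N_def diff_divide_distrib)
  have NH: "N s w \<in> halfplane" if "0 \<le> s" "w \<in> halfplane" for s w
    unfolding N_affine using \<alpha>pos[OF that(1)] that(2) by (intro affine_in_halfplane) auto
  have MH: "M t w \<in> halfplane" if "0 \<le> t" "w \<in> halfplane" for t w
    unfolding M_def using \<alpha>pos[OF that(1)] that(2) by (intro affine_in_halfplane)
  have NM: "N t (M t w) = w" if "0 \<le> t" for t w
    using \<alpha>pos[OF that] by (simp add: N_def M_def)
  have MN: "M t (N t w) = w" if "0 \<le> t" for t w
    using \<alpha>pos[OF that] by (simp add: N_def M_def)
  have \<Psi>H: "\<Psi> s t w \<in> halfplane" if "0 \<le> s" "s \<le> t" "w \<in> halfplane" for s t w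
    unfolding \<Psi>_def using that by (intro MH normalized_univalentD(6)[OF \<psi>] NH) auto
  have hol\<psi>N: "(\<lambda>w. \<psi> s t (N s w)) holomorphic_on halfplane" if "0 \<le> s" "s \<le> t" for s t
  proof -
    have "N s holomorphic_on halfplane" unfolding N_affine by (intro holomorphic_intros)
    then have "(\<psi> s t \<circ> N s) holomorphic_on halfplane"
      by (rule holomorphic_on_compose_gen[OF _ normalized_univalentD(1)[OF \<psi>[OF that]] image_subsetI[OF NH[OF that(1)]]])
    then show ?thesis by (simp add: o_def)
  qed
  have hol\<Psi>: "\<Psi> s t holomorphic_on halfplane" if "0 \<le> s" "s \<le> t" for s t
    unfolding \<Psi>_def M_def by (intro holomorphic_intros hol\<psi>N that)
  have sl\<Psi>: "slope (\<Psi> s t) = \<alpha> t * (\<kappa> s / \<kappa> t * (1 / \<alpha> s))" if st: "0 \<le> s" "s \<le> t" for s t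
  proof -
    have t: "0 \<le> t" using st by simp
    have slN: "slope (N s) = 1 / \<alpha> s"
      unfolding N_affine using \<alpha>pos[OF st(1)] by (intro slope_affine) simp
    have "slope (\<lambda>w. \<psi> s t (N s w)) = slope (\<psi> s t) * slope (N s)"
    proof (rule slope_comp[OF normalized_univalentD(1,7)[OF \<psi>[OF st]]])
      show "N s holomorphic_on halfplane" unfolding N_affine by (intro holomorphic_intros)
      show "N s ` halfplane \<subseteq> halfplane" using NH[OF st(1)] by blast
      show "0 < slope (N s)" using slN \<alpha>pos[OF st(1)] by simp
    qed
    then have sl1: "slope (\<lambda>w. \<psi> s t (N s w)) = \<kappa> s / \<kappa> t * (1 / \<alpha> s)"
      using slope[OF st] slN by simp
    have slM: "slope (M t) = \<alpha> t" unfolding M_def using \<alpha>pos[OF t] by (rule slope_affine)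
    have "slope (\<Psi> s t) = slope (M t) * slope (\<lambda>w. \<psi> s t (N s w))"
      unfolding \<Psi>_def
    proof (rule slope_comp[OF _ _ hol\<psi>N[OF st]])
      show "M t holomorphic_on halfplane" unfolding M_def by (intro holomorphic_intros)
      show "0 \<le> Re (M t z)" if "z \<in> halfplane" for z
        using MH[OF t that] by (simp add: halfplane_def)
      show "(\<lambda>w. \<psi> s t (N s w)) ` halfplane \<subseteq> halfplane"
        using normalized_univalentD(6)[OF \<psi>[OF st] NH[OF st(1)]] by blast
      show "0 < slope (\<lambda>w. \<psi> s t (N s w))"
        using sl1 \<kappa>pos[OF st(1)] \<kappa>pos[OF t] \<alpha>pos[OF st(1)] by simp
    qed
    then show ?thesis using sl1 slM by simp
  qed
  have sl\<Psi>pos: "0 < slope (\<Psi> s t)" if st: "0 \<le> s" "s \<le> t" for s t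
    using sl\<Psi>[OF st] \<kappa>pos[of s] \<kappa>pos[of t] \<alpha>pos[of s] \<alpha>pos[of t] st by simp
  have ang: "has_angular_derivative (\<Phi> s t) \<sigma> (of_real (1 / slope (\<Psi> s t)))"
      "has_angular_limit (\<Phi> s t) \<sigma> \<sigma>" if "0 \<le> s" "s \<le> t" for s t
    by (rule angular_derivative_of_halfplane_map[OF \<sigma> hol\<Psi>[OF that] image_subsetI[OF \<Psi>H[OF that]] sl\<Psi>pos[OF that]];
        simp add: \<Phi>_def)+
  have brfp: "boundary_regular_fixed_point (\<Phi> s t) \<sigma>" if "0 \<le> s" "s \<le> t" for s t
    using ang[OF that] \<sigma> by (auto simp: boundary_regular_fixed_point_def)
  have spectral: "spectral_function \<Phi> \<sigma> t = \<Lambda> t" if t: "0 \<le> t" for t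
  proof -
    have "has_angular_derivative (\<Phi> 0 t) \<sigma> (of_real (1 / slope (\<Psi> 0 t)))"
      by (rule ang(1)[OF order_refl t])
    then have ad: "angular_deriv (\<Phi> 0 t) \<sigma> = of_real (1 / slope (\<Psi> 0 t))"
      by (rule angular_deriv_eq[OF \<sigma>])
    have "slope (\<Psi> 0 t) = exp (\<Lambda> t)"
      using sl\<Psi>[OF order_refl t] \<alpha>0 \<kappa>pos[OF t] \<kappa>0 by (simp add: \<alpha>_def)
    then show ?thesis unfolding spectral_function_def ad norm_of_real by (simp add: ln_div)
  qed
  have end_point: "\<Phi> 0 t0 z = \<phi> z" if z: "z \<in> ball 0 1" for z
  proof -
    define w where "w = half_of \<sigma> z"
    have w: "w \<in> halfplane" unfolding w_def by (rule half_of_in_halfplane[OF \<sigma> z])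
    have "N 0 w = w" using \<alpha>0 by (simp add: N_def)
    then have "\<Psi> 0 t0 w = G w"
      using \<psi>f[OF w] \<alpha>t0 assms(5) by (simp add: \<Psi>_def M_def Gf \<beta>_def)
    then show ?thesis using \<phi>G[OF z] by (simp add: \<Phi>_def w_def)
  qed
  \<comment> \<open>For a \<Lambda> that is merely absolutely continuous, the constructed majorant
    is known to be integrable, which is order 1.\<close>
  have "evolution_family_of_order 1 \<Phi>"
    unfolding evolution_family_of_order_def
  proof (intro conjI allI impI ballI)
    fix s t :: real assume st: "0 \<le> s \<and> s \<le> t"
    have "(\<Psi> s t \<circ> half_of \<sigma>) holomorphic_on ball 0 1"
      using st by (intro holomorphic_on_compose_gen[OF holomorphic_half_of[OF \<sigma>] hol\<Psi>
          image_subsetI[OF half_of_in_halfplane[OF \<sigma>]]]) auto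
    then have "(disc_of \<sigma> \<circ> (\<Psi> s t \<circ> half_of \<sigma>)) holomorphic_on ball 0 1"
      by (rule holomorphic_on_compose_gen[OF _ holomorphic_disc_of])
         (use st \<Psi>H half_of_in_halfplane[OF \<sigma>] in \<open>force simp del: mem_ball_0\<close>)
    then show "\<Phi> s t holomorphic_on ball 0 1" by (simp add: \<Phi>_def[abs_def] o_def)
    show "\<Phi> s t ` ball 0 1 \<subseteq> ball 0 1"
    proof (rule image_subsetI)
      fix z :: complex assume "z \<in> ball 0 1"
      then show "\<Phi> s t z \<in> ball 0 1"
        unfolding \<Phi>_def using st by (intro disc_of_in_ball[OF \<sigma>] \<Psi>H half_of_in_halfplane[OF \<sigma>]) auto
    qed
  next
    fix s :: real and z :: complex assume s: "0 \<le> s" and z: "z \<in> ball 0 1"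
    have w: "half_of \<sigma> z \<in> halfplane" by (rule half_of_in_halfplane[OF \<sigma> z])
    have "slope (\<psi> s s) = 1" using slope[OF s order_refl] \<kappa>pos[OF s] by simp
    then have "\<psi> s s (N s (half_of \<sigma> z)) = N s (half_of \<sigma> z)"
      using slope_one_imp_id[OF \<psi>[OF s order_refl] _ NH[OF s w]] by blast
    then show "\<Phi> s s z = z" using MN[OF s] disc_of_half_of[OF \<sigma> z] by (simp add: \<Phi>_def \<Psi>_def)
  next
    fix s u t :: real and z :: complex assume st: "0 \<le> s \<and> s \<le> u \<and> u \<le> t" and z: "z \<in> ball 0 1"
    have w: "half_of \<sigma> z \<in> halfplane" by (rule half_of_in_halfplane[OF \<sigma> z])
    have "\<Psi> s t (half_of \<sigma> z) = \<Psi> u t (\<Psi> s u (half_of \<sigma> z))"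
      using cocycle[of s u t "N s (half_of \<sigma> z)"] st NH[OF _ w, of s] NM[of u] by (simp add: \<Psi>_def)
    then show "\<Phi> s t z = \<Phi> u t (\<Phi> s u z)"
      using half_of_disc_of[OF \<sigma> \<Psi>H[OF _ _ w]] st by (simp add: \<Phi>_def)
  next
    fix z :: complex and T :: real assume z: "z \<in> ball 0 1" and T: "0 < T"
    define w where "w = half_of \<sigma> z"
    have w: "w \<in> halfplane" unfolding w_def by (rule half_of_in_halfplane[OF \<sigma> z])
    have ac: "absolutely_continuous_on_interval 0 T \<Lambda>"
      using assms(6) T by (simp add: locally_absolutely_continuous_def)
    obtain k where k: "k \<in> borel_measurable borel" "\<And>\<xi>. 0 \<le> k \<xi>" "integrable lborel k"
      and maj: "\<And>u t. 0 \<le> u \<Longrightarrow> u \<le> t \<Longrightarrow> t \<le> T \<Longrightarrow> \<bar>\<Lambda> t - \<Lambda> u\<bar> \<le> (LINT \<xi>:{u..t}|lborel. k \<xi>)"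
      by (rule absolutely_continuous_majorant[OF ac T]) blast
    \<comment> \<open>Since \<Lambda> vanishes at 0, the total mass of the majorant bounds it on
      \<open>{0..T}\<close>.\<close>
    define B where "B = (LINT \<xi>|lborel. k \<xi>)"
    have B: "\<bar>\<Lambda> t\<bar> \<le> B" if "0 \<le> t" "t \<le> T" for t
    proof -
      have "\<bar>\<Lambda> t\<bar> \<le> (LINT \<xi>:{0..t}|lborel. k \<xi>)" using maj[of 0 t] that assms(7) by simp
      also have "\<dots> \<le> B"
        unfolding B_def set_lebesgue_integral_def using k
        by (intro integral_mono integrable_mult_indicator) (auto simp: indicator_def)
      finally show ?thesis .
    qed
    have "\<exists>Q\<ge>0. \<forall>s u t. 0 \<le> s \<and> s \<le> u \<and> u \<le> t \<and> t \<le> T \<longrightarrow>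
        cmod (\<Psi> s u w - \<Psi> s t w) \<le> Q * ((t - u) + \<bar>\<Lambda> t - \<Lambda> u\<bar>)"
      unfolding \<Psi>_def M_def N_def
      by (rule affine_conjugate_displacement[OF \<psi> slope cocycle \<kappa>0 \<kappa>(3,4) L \<alpha>_def B w])
    then obtain Q where Q: "0 \<le> Q" "\<And>s u t. 0 \<le> s \<Longrightarrow> s \<le> u \<Longrightarrow> u \<le> t \<Longrightarrow> t \<le> T \<Longrightarrow>
        cmod (\<Psi> s u w - \<Psi> s t w) \<le> Q * ((t - u) + \<bar>\<Lambda> t - \<Lambda> u\<bar>)"
      by metis
    \<comment> \<open>The factor 2 is the Lipschitz constant of the Cayley transform on the
      half-plane.\<close>
    have bound: "norm (\<Phi> s u z - \<Phi> s t z) \<le> (LINT \<xi>:{u..t}|lebesgue. 2 * Q * (1 + k \<xi>))"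
      if st: "0 \<le> s" "s \<le> u" "u \<le> t" "t \<le> T" for s u t
    proof -
      have "norm (\<Phi> s u z - \<Phi> s t z) \<le> 2 * cmod (\<Psi> s u w - \<Psi> s t w)"
        unfolding \<Phi>_def w_def[symmetric] using st w by (intro disc_of_lipschitz[OF \<sigma>] \<Psi>H) auto
      also have "\<dots> \<le> 2 * (Q * ((t - u) + (LINT \<xi>:{u..t}|lborel. k \<xi>)))"
      proof -
        have "Q * ((t - u) + \<bar>\<Lambda> t - \<Lambda> u\<bar>) \<le> Q * ((t - u) + (LINT \<xi>:{u..t}|lborel. k \<xi>))"
          using maj[of u t] st Q(1) by (intro mult_left_mono) auto
        then show ?thesis using Q(2)[OF st] by simp
      qed
      also have "\<dots> = (LINT \<xi>:{u..t}|lebesgue. 2 * Q * (1 + k \<xi>))"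
        using set_integral_one_plus[OF k(1,3) st(3), of "2 * Q"] by (simp only: mult.assoc)
      finally show ?thesis .
    qed
    show "\<exists>k. mem_Lp 1 (lebesgue_on {0..T}) k \<and> (\<forall>\<xi>\<in>{0..T}. 0 \<le> k \<xi>) \<and>
        (\<forall>s u t. 0 \<le> s \<and> s \<le> u \<and> u \<le> t \<and> t \<le> T \<longrightarrow>
           norm (\<Phi> s u z - \<Phi> s t z) \<le> (LINT \<xi>:{u..t}|lebesgue. k \<xi>))"
      using mem_Lp_one_restrict[OF k(1,3,2), of T "2 * Q"] bound k(2) Q(1)
      by (intro exI[of _ "\<lambda>\<xi>. 2 * Q * (1 + k \<xi>)"]) auto
  qed
  then have "evolution_family \<Phi>" unfolding evolution_family_def by blast
  then show ?thesis
    using brfp spectral end_point unfolding family_boundary_regular_fixed_point_def by blast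
qed

end
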